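(* Let $\mathfrak C$ be a small 2-category and let $E\colon \mathfrak C\to\mathfrak{Cat}$ and $W\colon \mathfrak C^{op}\to\mathfrak{Cat}$ be pseudo-functors. Then the category $E\star W:=\pi_0\Delta(E,W)[\Sigma^{-1}]$ is, up to isomorphism, the pseudo-colimit of $E$ weighted by $W$. That is, there is a pseudo-natural transformation $\xi\colon W\to\mathfrak{Cat}(E,E\star W)$ inducing an isomorphism of categories \[ \mathfrak{Cat}(E\star W,\mathscr X)\cong \mathrm{Hom}(\mathfrak C^{op},\mathfrak{Cat})(W,\mathfrak{Cat}(E,\mathscr X)) \] for every small category $\mathscr X$ (a functor $F\colon E\star W\to\mathscr X$ being sent to the composite of $\xi$ with $\mathfrak{Cat}(E,F)$, and similarly for natural transformations).
   Context: $\mathfrak{Cat}$ is the 2-category of small categories, functors and natural transformations. $\mathfrak C^{op}$ is $\mathfrak C$ with 1-cells (not 2-cells) reversed. All pseudo-functors are assumed normalized (identity 1-cells are preserved strictly); they preserve vertical composition of 2-cells strictly and composition of 1-cells up to coherent invertible 2-cells. For $f\colon C\to D$ and $\alpha\colon f\Rightarrow g$ in $\mathfrak C$, write $f_!\colon EC\to ED$, $\alpha_!\colon f_!\Rightarrow g_!$ for their images under $E$, and $f^*\colon WD\to WC$, $\alpha^*\colon f^*\Rightarrow g^*$ for their images under $W$. $\mathrm{Hom}(\mathfrak K,\mathfrak L)$ is the 2-category of pseudo-functors $\mathfrak K\to\mathfrak L$, pseudo-natural transformations (with invertible coherence cells $\theta_f\colon \theta_B\circ Ff\Rightarrow Gf\circ\theta_A$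 for $f\colon A\to B$) and modifications. For a small category $\mathscr X$, $\mathfrak{Cat}(E,\mathscr X)\colon\mathfrak C^{op}\to\mathfrak{Cat}$ is the pseudo-functor $C\mapsto \mathfrak{Cat}(EC,\mathscr X)$, acting on $f$ by precomposition with $f_!$ and on 2-cells by whiskering. $\Delta(E,W)$ is the following 2-category. Objects: triples $(C,X,Y)$ with $C\in\mathfrak C_0$, $X\in EC$, $Y\in WC$. Arrows $(C,X,Y)\to(D,A,B)$: triples $(f,u,v)$ with $f\colon C\to D$ in $\mathfrak C$, $u\colon f_!X\to A$ in $ED$, $v\colon Y\to f^*B$ in $WC$. The composite of $(f,u,v)$ with $(g,x,y)\colon (D,A,B)\to(D',A',B')$ is $gf$ together with $(gf)_!X\cong g_!f_!X\xrightarrow{g_!u}g_!A\xrightarrow{x}A'$ and $Y\xrightarrow{v}f^*B\xrightarrow{f^*y}f^*g^*B'\cong(gf)^*B'$; identities are $(1,1,1)$. A 2-cell $(f,u,v)\Rightarrow(g,x,y)$ between arrows $(C,X,Y)\to(D,A,B)$ is a 2-cell $\alpha\colon f\Rightarrow g$ of $\mathfrak C$ with $x\circ(\alpha_!)_X=u$ and $(\alpha^* )_B\circ v=y$. An arrow $(f,u,v)$ is cartesian if $u$ and $v$ are both invertible. For a 2-category $\mathfrak A$, $\pi_0\mathfrak A$ is the 1-category with the same objects and with hom-sets $(\pi_0\mathfrak A)(A,B)=\pi_0(\mathfrak A(A,B))$, the connected components of the hom-categories. $\Sigma$ is the set of images in $\pi_0\Delta(E,W)$ of cartesian arrows, and $[\Sigma^{-1}]$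 denotes the category of fractions (localization) formally inverting $\Sigma$. *)

theory Defs
  imports "HOL-Library.FuncSet"
begin

section \<open>Small categories, functors, natural transformations\<close>

text \<open>
  Categories are small: objects and arrows form sets in the carrier types. \<open>Cmp A g f\<close>
  is \<open>g \<circ> f\<close>, that is, first \<open>f\<close>. Functions attached to functors,
  natural transformations etc. are extensional (arbitrary but fixed outside the relevant carrier),
  so that HOL equality of these data is the intended equality.
\<close>

record ('o, 'a) cat =
  Obj :: "'o set"
  Arr :: "'a set"
  Dom :: "'a \<Rightarrow> 'o"
  Cod :: "'a \<Rightarrow> 'o"
  Idn :: "'o \<Rightarrow> 'a"
  Cmp :: "'a \<Rightarrow> 'a \<Rightarrow> 'a"

definition homset :: "('o, 'a) cat \<Rightarrow> 'o \<Rightarrow> 'o \<Rightarrow> 'a set" where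
  "homset A x y = {f \<in> Arr A. Dom A f = x \<and> Cod A f = y}"

locale category =
  fixes A :: "('o, 'a) cat"
  assumes Dom_Obj: "f \<in> Arr A \<Longrightarrow> Dom A f \<in> Obj A"
    and Cod_Obj: "f \<in> Arr A \<Longrightarrow> Cod A f \<in> Obj A"
    and Idn_hom: "x \<in> Obj A \<Longrightarrow> Idn A x \<in> homset A x x"
    and Cmp_hom: "f \<in> homset A x y \<Longrightarrow> g \<in> homset A y z \<Longrightarrow> Cmp A g f \<in> homset A x z"
    and Cmp_Idn: "f \<in> homset A x y \<Longrightarrow> Cmp A f (Idn A x) = f"
    and Idn_Cmp: "f \<in> homset A x y \<Longrightarrow> Cmp A (Idn A y) f = f"
    and Cmp_assoc: "f \<in> homset A w x \<Longrightarrow> g \<in> homset A x y \<Longrightarrow> h \<in> homset A y z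
      \<Longrightarrow> Cmp A h (Cmp A g f) = Cmp A (Cmp A h g) f"

definition inverse_arrows :: "('o, 'a) cat \<Rightarrow> 'a \<Rightarrow> 'a \<Rightarrow> bool" where
  "inverse_arrows A f g \<longleftrightarrow> f \<in> Arr A \<and> g \<in> homset A (Cod A f) (Dom A f)
     \<and> Cmp A g f = Idn A (Dom A f) \<and> Cmp A f g = Idn A (Cod A f)"

definition iso_arr :: "('o, 'a) cat \<Rightarrow> 'a \<Rightarrow> bool" where
  "iso_arr A f \<longleftrightarrow> (\<exists>g. inverse_arrows A f g)"

definition inv_arr :: "('o, 'a) cat \<Rightarrow> 'a \<Rightarrow> 'a" where
  "inv_arr A f = (THE g. inverse_arrows A f g)"

definition op_cat :: "('o, 'a) cat \<Rightarrow> ('o, 'a) cat" where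
  "op_cat A = \<lparr>Obj = Obj A, Arr = Arr A, Dom = Cod A, Cod = Dom A, Idn = Idn A,
     Cmp = (\<lambda>g f. Cmp A f g)\<rparr>"

record ('o, 'a, 'p, 'b) ftor =
  fob :: "'o \<Rightarrow> 'p"
  far :: "'a \<Rightarrow> 'b"

locale is_functor = A: category A + B: category B
  for A :: "('o, 'a) cat" and B :: "('p, 'b) cat" +
  fixes F :: "('o, 'a, 'p, 'b) ftor"
  assumes fob_ext: "fob F \<in> extensional (Obj A)"
    and far_ext: "far F \<in> extensional (Arr A)"
    and fob_Obj: "x \<in> Obj A \<Longrightarrow> fob F x \<in> Obj B"
    and far_hom: "f \<in> homset A x y \<Longrightarrow> far F f \<in> homset B (fob F x) (fob F y)"
    and far_Idn: "x \<in> Obj A \<Longrightarrow> far F (Idn A x) = Idn B (fob F x)"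
    and far_Cmp: "f \<in> homset A x y \<Longrightarrow> g \<in> homset A y z
      \<Longrightarrow> far F (Cmp A g f) = Cmp B (far F g) (far F f)"

definition id_functor :: "('o, 'a) cat \<Rightarrow> ('o, 'a, 'o, 'a) ftor" where
  "id_functor A = \<lparr>fob = (\<lambda>x\<in>Obj A. x), far = (\<lambda>f\<in>Arr A. f)\<rparr>"

definition comp_functor ::
  "('o, 'a) cat \<Rightarrow> ('p, 'b, 'q, 'c) ftor \<Rightarrow> ('o, 'a, 'p, 'b) ftor \<Rightarrow> ('o, 'a, 'q, 'c) ftor" where
  "comp_functor A G F = \<lparr>fob = compose (Obj A) (fob G) (fob F), far = compose (Arr A) (far G) (far F)\<rparr>"

record ('o, 'a, 'p, 'b) ntrans =
  nsrc :: "('o, 'a, 'p, 'b) ftor"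
  ntgt :: "('o, 'a, 'p, 'b) ftor"
  ncmp :: "'o \<Rightarrow> 'b"

locale is_ntrans =
  S: is_functor A B "nsrc \<tau>" + T: is_functor A B "ntgt \<tau>"
  for A :: "('o, 'a) cat" and B :: "('p, 'b) cat" and \<tau> :: "('o, 'a, 'p, 'b) ntrans" +
  assumes ncmp_ext: "ncmp \<tau> \<in> extensional (Obj A)"
    and ncmp_hom: "x \<in> Obj A \<Longrightarrow> ncmp \<tau> x \<in> homset B (fob (nsrc \<tau>) x) (fob (ntgt \<tau>) x)"
    and natural: "f \<in> homset A x y
      \<Longrightarrow> Cmp B (ncmp \<tau> y) (far (nsrc \<tau>) f) = Cmp B (far (ntgt \<tau>) f) (ncmp \<tau> x)"

text \<open>The hom-category \<open>Cat(A, B)\<close>.\<close>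

definition functor_category ::
  "('o, 'a) cat \<Rightarrow> ('p, 'b) cat \<Rightarrow> (('o, 'a, 'p, 'b) ftor, ('o, 'a, 'p, 'b) ntrans) cat" where
  "functor_category A B =
     \<lparr>Obj = {F. is_functor A B F},
      Arr = {\<tau>. is_ntrans A B \<tau>},
      Dom = nsrc,
      Cod = ntgt,
      Idn = (\<lambda>F. \<lparr>nsrc = F, ntgt = F, ncmp = (\<lambda>x\<in>Obj A. Idn B (fob F x))\<rparr>),
      Cmp = (\<lambda>\<sigma> \<tau>. \<lparr>nsrc = nsrc \<tau>, ntgt = ntgt \<sigma>,
               ncmp = (\<lambda>x\<in>Obj A. Cmp B (ncmp \<sigma> x) (ncmp \<tau> x))\<rparr>)\<rparr>"

text \<open>Whiskerings \<open>G \<tau>\<close> and \<open>\<tau> F\<close>, and the horizontal composite \<open>\<sigma> * \<tau>\<close> of \<open>\<tau> : F \<Rightarrow> F' : A \<rightarrow> B\<close> and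
  \<open>\<sigma> : G \<Rightarrow> G' : B \<rightarrow> C\<close>, taken as \<open>\<sigma> F' \<circ> G \<tau>\<close>. In each case \<open>A\<close> is the domain of the composite.\<close>

definition whisker_left ::
  "('o, 'a) cat \<Rightarrow> ('p, 'b, 'q, 'c) ftor \<Rightarrow> ('o, 'a, 'p, 'b) ntrans \<Rightarrow> ('o, 'a, 'q, 'c) ntrans" where
  "whisker_left A G \<tau> =
     \<lparr>nsrc = comp_functor A G (nsrc \<tau>), ntgt = comp_functor A G (ntgt \<tau>),
      ncmp = (\<lambda>x\<in>Obj A. far G (ncmp \<tau> x))\<rparr>"

definition whisker_right ::
  "('o, 'a) cat \<Rightarrow> ('p, 'b, 'q, 'c) ntrans \<Rightarrow> ('o, 'a, 'p, 'b) ftor \<Rightarrow> ('o, 'a, 'q, 'c) ntrans" where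
  "whisker_right A \<tau> F =
     \<lparr>nsrc = comp_functor A (nsrc \<tau>) F, ntgt = comp_functor A (ntgt \<tau>) F,
      ncmp = (\<lambda>x\<in>Obj A. ncmp \<tau> (fob F x))\<rparr>"

definition hcomp_ntrans ::
  "('o, 'a) cat \<Rightarrow> ('q, 'c) cat \<Rightarrow> ('p, 'b, 'q, 'c) ntrans \<Rightarrow> ('o, 'a, 'p, 'b) ntrans
     \<Rightarrow> ('o, 'a, 'q, 'c) ntrans" where
  "hcomp_ntrans A C \<sigma> \<tau> =
     Cmp (functor_category A C) (whisker_right A \<sigma> (ntgt \<tau>)) (whisker_left A (nsrc \<sigma>) \<tau>)"

definition iso_of_categories ::
  "('o, 'a) cat \<Rightarrow> ('p, 'b) cat \<Rightarrow> ('o, 'a, 'p, 'b) ftor \<Rightarrow> bool" where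
  "iso_of_categories A B F \<longleftrightarrow> is_functor A B F
     \<and> (\<exists>G. is_functor B A G \<and> comp_functor A G F = id_functor A \<and> comp_functor B F G = id_functor B)"


section \<open>Small 2-categories\<close>

text \<open>
  \<open>one K\<close> is the underlying category (objects and 1-cells). \<open>two K\<close> is the disjoint union of all
  hom-categories: its objects are the 1-cells, its arrows the 2-cells, its composition is vertical
  composition. \<open>hcmp K \<beta> \<alpha>\<close> is the horizontal composite of \<open>\<alpha> : f \<Rightarrow> f' : a \<rightarrow> b\<close> followed by
  \<open>\<beta> : g \<Rightarrow> g' : b \<rightarrow> c\<close>.
\<close>

record ('c, 'f, 't) twocat =
  one :: "('c, 'f) cat"
  two :: "('f, 't) cat"
  hcmp :: "'t \<Rightarrow> 't \<Rightarrow> 't"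

definition hcomposable :: "('c, 'f, 't) twocat \<Rightarrow> 't \<Rightarrow> 't \<Rightarrow> bool" where
  "hcomposable K \<beta> \<alpha> \<longleftrightarrow> \<alpha> \<in> Arr (two K) \<and> \<beta> \<in> Arr (two K)
     \<and> Dom (one K) (Dom (two K) \<beta>) = Cod (one K) (Dom (two K) \<alpha>)"

locale two_category = one: category "one K" + two: category "two K"
  for K :: "('c, 'f, 't) twocat" +
  assumes Obj_two: "Obj (two K) = Arr (one K)"
    and globular: "\<alpha> \<in> Arr (two K) \<Longrightarrow>
      Dom (one K) (Dom (two K) \<alpha>) = Dom (one K) (Cod (two K) \<alpha>) \<and>
      Cod (one K) (Dom (two K) \<alpha>) = Cod (one K) (Cod (two K) \<alpha>)"
    and hcmp_hom: "hcomposable K \<beta> \<alpha> \<Longrightarrow>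
      hcmp K \<beta> \<alpha> \<in> homset (two K) (Cmp (one K) (Dom (two K) \<beta>) (Dom (two K) \<alpha>))
                                  (Cmp (one K) (Cod (two K) \<beta>) (Cod (two K) \<alpha>))"
    and hcmp_Idn: "f \<in> homset (one K) a b \<Longrightarrow> g \<in> homset (one K) b c \<Longrightarrow>
      hcmp K (Idn (two K) g) (Idn (two K) f) = Idn (two K) (Cmp (one K) g f)"
    and interchange: "hcomposable K \<beta> \<alpha> \<Longrightarrow> hcomposable K \<beta>' \<alpha>' \<Longrightarrow>
      Cod (two K) \<alpha> = Dom (two K) \<alpha>' \<Longrightarrow> Cod (two K) \<beta> = Dom (two K) \<beta>' \<Longrightarrow>
      hcmp K (Cmp (two K) \<beta>' \<beta>) (Cmp (two K) \<alpha>' \<alpha>) = Cmp (two K) (hcmp K \<beta>' \<alpha>') (hcmp K \<beta> \<alpha>)"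
    and hcmp_unit_right: "\<alpha> \<in> Arr (two K) \<Longrightarrow>
      hcmp K \<alpha> (Idn (two K) (Idn (one K) (Dom (one K) (Dom (two K) \<alpha>)))) = \<alpha>"
    and hcmp_unit_left: "\<alpha> \<in> Arr (two K) \<Longrightarrow>
      hcmp K (Idn (two K) (Idn (one K) (Cod (one K) (Dom (two K) \<alpha>)))) \<alpha> = \<alpha>"
    and hcmp_assoc: "hcomposable K \<beta> \<alpha> \<Longrightarrow> hcomposable K \<gamma> \<beta> \<Longrightarrow>
      hcmp K \<gamma> (hcmp K \<beta> \<alpha>) = hcmp K (hcmp K \<gamma> \<beta>) \<alpha>"

definition op2 :: "('c, 'f, 't) twocat \<Rightarrow> ('c, 'f, 't) twocat" where
  "op2 K = \<lparr>one = op_cat (one K), two = two K, hcmp = (\<lambda>\<beta> \<alpha>. hcmp K \<alpha> \<beta>)\<rparr>"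

definition hom_category :: "('c, 'f, 't) twocat \<Rightarrow> 'c \<Rightarrow> 'c \<Rightarrow> ('f, 't) cat" where
  "hom_category K a b =
     \<lparr>Obj = homset (one K) a b,
      Arr = {\<alpha> \<in> Arr (two K). Dom (two K) \<alpha> \<in> homset (one K) a b \<and> Cod (two K) \<alpha> \<in> homset (one K) a b},
      Dom = Dom (two K), Cod = Cod (two K), Idn = Idn (two K), Cmp = Cmp (two K)\<rparr>"


section \<open>Normalized pseudo-functors into Cat\<close>

text \<open>
  For \<open>f : a \<rightarrow> b\<close>, \<open>g : b \<rightarrow> c\<close> the coherence cell is \<open>pcmp P g f : P g \<circ> P f \<Rightarrow> P (g \<circ> f)\<close>.
  The categories \<open>P a\<close> have carriers in common types; since the domain is small, this is no
  restriction up to renaming of objects and arrows.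
\<close>

record ('c, 'f, 't, 'o, 'a) pftor =
  pob :: "'c \<Rightarrow> ('o, 'a) cat"
  pone :: "'f \<Rightarrow> ('o, 'a, 'o, 'a) ftor"
  ptwo :: "'t \<Rightarrow> ('o, 'a, 'o, 'a) ntrans"
  pcmp :: "'f \<Rightarrow> 'f \<Rightarrow> ('o, 'a, 'o, 'a) ntrans"

locale pseudofunctor = two_category K
  for K :: "('c, 'f, 't) twocat" +
  fixes P :: "('c, 'f, 't, 'o, 'a) pftor"
  assumes pob_category: "a \<in> Obj (one K) \<Longrightarrow> category (pob P a)"
    and pone_functor: "f \<in> homset (one K) a b \<Longrightarrow> is_functor (pob P a) (pob P b) (pone P f)"
    and ptwo_hom: "\<alpha> \<in> homset (two K) f g \<Longrightarrow> f \<in> homset (one K) a b \<Longrightarrow>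
      ptwo P \<alpha> \<in> homset (functor_category (pob P a) (pob P b)) (pone P f) (pone P g)"
    and ptwo_Idn: "f \<in> homset (one K) a b \<Longrightarrow>
      ptwo P (Idn (two K) f) = Idn (functor_category (pob P a) (pob P b)) (pone P f)"
    and ptwo_Cmp: "\<alpha> \<in> homset (two K) f g \<Longrightarrow> \<beta> \<in> homset (two K) g h \<Longrightarrow> f \<in> homset (one K) a b \<Longrightarrow>
      ptwo P (Cmp (two K) \<beta> \<alpha>) = Cmp (functor_category (pob P a) (pob P b)) (ptwo P \<beta>) (ptwo P \<alpha>)"
    and normalized: "a \<in> Obj (one K) \<Longrightarrow> pone P (Idn (one K) a) = id_functor (pob P a)"
    and pcmp_hom: "f \<in> homset (one K) a b \<Longrightarrow> g \<in> homset (one K) b c \<Longrightarrow>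
      pcmp P g f \<in> homset (functor_category (pob P a) (pob P c))
        (comp_functor (pob P a) (pone P g) (pone P f)) (pone P (Cmp (one K) g f))"
    and pcmp_iso: "f \<in> homset (one K) a b \<Longrightarrow> g \<in> homset (one K) b c \<Longrightarrow>
      iso_arr (functor_category (pob P a) (pob P c)) (pcmp P g f)"
    and pcmp_natural:
      "f \<in> homset (one K) a b \<Longrightarrow> g \<in> homset (one K) b c \<Longrightarrow>
       \<alpha> \<in> homset (two K) f f' \<Longrightarrow> \<beta> \<in> homset (two K) g g' \<Longrightarrow>
       Cmp (functor_category (pob P a) (pob P c))
         (pcmp P g' f') (hcomp_ntrans (pob P a) (pob P c) (ptwo P \<beta>) (ptwo P \<alpha>))
       = Cmp (functor_category (pob P a) (pob P c)) (ptwo P (hcmp K \<beta> \<alpha>)) (pcmp P g f)"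
    and pcmp_assoc:
      "f \<in> homset (one K) a b \<Longrightarrow> g \<in> homset (one K) b c \<Longrightarrow> h \<in> homset (one K) c d \<Longrightarrow>
       Cmp (functor_category (pob P a) (pob P d))
         (pcmp P h (Cmp (one K) g f)) (whisker_left (pob P a) (pone P h) (pcmp P g f))
       = Cmp (functor_category (pob P a) (pob P d))
         (pcmp P (Cmp (one K) h g) f) (whisker_right (pob P a) (pcmp P h g) (pone P f))"
    and pcmp_unit_right: "f \<in> homset (one K) a b \<Longrightarrow>
      pcmp P f (Idn (one K) a) = Idn (functor_category (pob P a) (pob P b)) (pone P f)"
    and pcmp_unit_left: "f \<in> homset (one K) a b \<Longrightarrow>
      pcmp P (Idn (one K) b) f = Idn (functor_category (pob P a) (pob P b)) (pone P f)"


section \<open>Pseudo-natural transformations and modifications\<close>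

text \<open>For \<open>f : a \<rightarrow> b\<close> the coherence cell is \<open>tone \<theta> f : \<theta>\<^sub>b \<circ> F f \<Rightarrow> G f \<circ> \<theta>\<^sub>a\<close>.\<close>

record ('c, 'f, 'o, 'a, 'p, 'b) pnat =
  tob :: "'c \<Rightarrow> ('o, 'a, 'p, 'b) ftor"
  tone :: "'f \<Rightarrow> ('o, 'a, 'p, 'b) ntrans"

locale pseudonatural = F: pseudofunctor K F + G: pseudofunctor K G
  for K :: "('c, 'f, 't) twocat"
    and F :: "('c, 'f, 't, 'o, 'a) pftor" and G :: "('c, 'f, 't, 'p, 'b) pftor" +
  fixes \<theta> :: "('c, 'f, 'o, 'a, 'p, 'b) pnat"
  assumes tob_ext: "tob \<theta> \<in> extensional (Obj (one K))"
    and tone_ext: "tone \<theta> \<in> extensional (Arr (one K))"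
    and tob_functor: "a \<in> Obj (one K) \<Longrightarrow> is_functor (pob F a) (pob G a) (tob \<theta> a)"
    and tone_hom: "f \<in> homset (one K) a b \<Longrightarrow>
      tone \<theta> f \<in> homset (functor_category (pob F a) (pob G b))
        (comp_functor (pob F a) (tob \<theta> b) (pone F f)) (comp_functor (pob F a) (pone G f) (tob \<theta> a))"
    and tone_iso: "f \<in> homset (one K) a b \<Longrightarrow>
      iso_arr (functor_category (pob F a) (pob G b)) (tone \<theta> f)"
    and tone_natural: "f \<in> homset (one K) a b \<Longrightarrow> \<alpha> \<in> homset (two K) f g \<Longrightarrow>
      Cmp (functor_category (pob F a) (pob G b))
        (whisker_right (pob F a) (ptwo G \<alpha>) (tob \<theta> a)) (tone \<theta> f)
      = Cmp (functor_category (pob F a) (pob G b))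
        (tone \<theta> g) (whisker_left (pob F a) (tob \<theta> b) (ptwo F \<alpha>))"
    and tone_Idn: "a \<in> Obj (one K) \<Longrightarrow>
      tone \<theta> (Idn (one K) a) = Idn (functor_category (pob F a) (pob G a)) (tob \<theta> a)"
    and tone_Cmp: "f \<in> homset (one K) a b \<Longrightarrow> g \<in> homset (one K) b c \<Longrightarrow>
      Cmp (functor_category (pob F a) (pob G c))
        (tone \<theta> (Cmp (one K) g f)) (whisker_left (pob F a) (tob \<theta> c) (pcmp F g f))
      = Cmp (functor_category (pob F a) (pob G c))
          (whisker_right (pob F a) (pcmp G g f) (tob \<theta> a))
          (Cmp (functor_category (pob F a) (pob G c))
            (whisker_left (pob F a) (pone G g) (tone \<theta> f))
            (whisker_right (pob F a) (tone \<theta> g) (pone F f)))"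

record ('c, 'f, 'o, 'a, 'p, 'b) modif =
  msrc :: "('c, 'f, 'o, 'a, 'p, 'b) pnat"
  mtgt :: "('c, 'f, 'o, 'a, 'p, 'b) pnat"
  mcmp :: "'c \<Rightarrow> ('o, 'a, 'p, 'b) ntrans"

locale modification =
  S: pseudonatural K F G "msrc m" + T: pseudonatural K F G "mtgt m"
  for K :: "('c, 'f, 't) twocat"
    and F :: "('c, 'f, 't, 'o, 'a) pftor" and G :: "('c, 'f, 't, 'p, 'b) pftor"
    and m :: "('c, 'f, 'o, 'a, 'p, 'b) modif" +
  assumes mcmp_ext: "mcmp m \<in> extensional (Obj (one K))"
    and mcmp_hom: "a \<in> Obj (one K) \<Longrightarrow>
      mcmp m a \<in> homset (functor_category (pob F a) (pob G a)) (tob (msrc m) a) (tob (mtgt m) a)"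
    and mcmp_natural: "f \<in> homset (one K) a b \<Longrightarrow>
      Cmp (functor_category (pob F a) (pob G b))
        (whisker_left (pob F a) (pone G f) (mcmp m a)) (tone (msrc m) f)
      = Cmp (functor_category (pob F a) (pob G b))
        (tone (mtgt m) f) (whisker_right (pob F a) (mcmp m b) (pone F f))"

text \<open>The hom-category \<open>Hom(K, Cat)(F, G)\<close> of the 2-category of pseudo-functors.\<close>

definition Hom_category ::
  "('c, 'f, 't) twocat \<Rightarrow> ('c, 'f, 't, 'o, 'a) pftor \<Rightarrow> ('c, 'f, 't, 'p, 'b) pftor
     \<Rightarrow> (('c, 'f, 'o, 'a, 'p, 'b) pnat, ('c, 'f, 'o, 'a, 'p, 'b) modif) cat" where
  "Hom_category K F G =
     \<lparr>Obj = {\<theta>. pseudonatural K F G \<theta>},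
      Arr = {m. modification K F G m},
      Dom = msrc,
      Cod = mtgt,
      Idn = (\<lambda>\<theta>. \<lparr>msrc = \<theta>, mtgt = \<theta>,
               mcmp = (\<lambda>a\<in>Obj (one K). Idn (functor_category (pob F a) (pob G a)) (tob \<theta> a))\<rparr>),
      Cmp = (\<lambda>n m. \<lparr>msrc = msrc m, mtgt = mtgt n,
               mcmp = (\<lambda>a\<in>Obj (one K). Cmp (functor_category (pob F a) (pob G a)) (mcmp n a) (mcmp m a))\<rparr>)\<rparr>"

text \<open>Composition of \<open>\<theta> : F \<rightarrow> G\<close> and \<open>\<chi> : G \<rightarrow> H\<close>, with coherence cell
  \<open>\<chi>\<^sub>b \<theta>\<^sub>b F f \<Rightarrow> \<chi>\<^sub>b G f \<theta>\<^sub>a \<Rightarrow> H f \<chi>\<^sub>a \<theta>\<^sub>a\<close>, and whiskering of a modification \<open>m : \<chi> \<Rightarrow> \<chi>'\<close> with \<open>\<theta>\<close>.\<close>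

definition comp_pnat ::
  "('c, 'f, 't) twocat \<Rightarrow> ('c, 'f, 't, 'o, 'a) pftor \<Rightarrow> ('c, 'f, 't, 'q, 'd) pftor
     \<Rightarrow> ('c, 'f, 'p, 'b, 'q, 'd) pnat \<Rightarrow> ('c, 'f, 'o, 'a, 'p, 'b) pnat
     \<Rightarrow> ('c, 'f, 'o, 'a, 'q, 'd) pnat" where
  "comp_pnat K F H \<chi> \<theta> =
     \<lparr>tob = (\<lambda>a\<in>Obj (one K). comp_functor (pob F a) (tob \<chi> a) (tob \<theta> a)),
      tone = (\<lambda>f\<in>Arr (one K).
        let a = Dom (one K) f; b = Cod (one K) f in
        Cmp (functor_category (pob F a) (pob H b))
          (whisker_right (pob F a) (tone \<chi> f) (tob \<theta> a))
          (whisker_left (pob F a) (tob \<chi> b) (tone \<theta> f)))\<rparr>"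

definition modif_whisker ::
  "('c, 'f, 't) twocat \<Rightarrow> ('c, 'f, 't, 'o, 'a) pftor \<Rightarrow> ('c, 'f, 't, 'q, 'd) pftor
     \<Rightarrow> ('c, 'f, 'p, 'b, 'q, 'd) modif \<Rightarrow> ('c, 'f, 'o, 'a, 'p, 'b) pnat
     \<Rightarrow> ('c, 'f, 'o, 'a, 'q, 'd) modif" where
  "modif_whisker K F H m \<theta> =
     \<lparr>msrc = comp_pnat K F H (msrc m) \<theta>, mtgt = comp_pnat K F H (mtgt m) \<theta>,
      mcmp = (\<lambda>a\<in>Obj (one K). whisker_right (pob F a) (mcmp m a) (tob \<theta> a))\<rparr>"


section \<open>The pseudo-functor \<open>Cat(E, X)\<close>\<close>

definition precomp ::
  "('o, 'a) cat \<Rightarrow> ('p, 'b) cat \<Rightarrow> ('x, 'y) cat \<Rightarrow> ('o, 'a, 'p, 'b) ftor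
   \<Rightarrow> (('p, 'b, 'x, 'y) ftor, ('p, 'b, 'x, 'y) ntrans, ('o, 'a, 'x, 'y) ftor, ('o, 'a, 'x, 'y) ntrans) ftor" where
  "precomp A B X F =
     \<lparr>fob = (\<lambda>G\<in>Obj (functor_category B X). comp_functor A G F),
      far = (\<lambda>\<gamma>\<in>Arr (functor_category B X). whisker_right A \<gamma> F)\<rparr>"

text \<open>A pseudo-functor on \<open>op2 K\<close>; composition of 1-cells in \<open>op2 K\<close> is reversed, hence the
  argument order in \<open>pcmp\<close>.\<close>

definition Cat_into ::
  "('c, 'f, 't) twocat \<Rightarrow> ('c, 'f, 't, 'o, 'a) pftor \<Rightarrow> ('x, 'y) cat
   \<Rightarrow> ('c, 'f, 't, ('o, 'a, 'x, 'y) ftor, ('o, 'a, 'x, 'y) ntrans) pftor" where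
  "Cat_into K E X =
     (let cod_cat = (\<lambda>f. pob E (Cod (one K) f)); dom_cat = (\<lambda>f. pob E (Dom (one K) f));
          pre = (\<lambda>f. precomp (dom_cat f) (cod_cat f) X (pone E f))
      in
     \<lparr>pob = (\<lambda>C. functor_category (pob E C) X),
      pone = pre,
      ptwo = (\<lambda>\<alpha>.
        let f = Dom (two K) \<alpha>; g = Cod (two K) \<alpha> in
        \<lparr>nsrc = pre f, ntgt = pre g,
         ncmp = (\<lambda>G\<in>Obj (functor_category (cod_cat f) X). whisker_left (dom_cat f) G (ptwo E \<alpha>))\<rparr>),
      pcmp = (\<lambda>f g.
        \<lparr>nsrc = comp_functor (functor_category (cod_cat g) X) (pre f) (pre g),
         ntgt = pre (Cmp (one K) g f),
         ncmp = (\<lambda>G\<in>Obj (functor_category (cod_cat g) X). whisker_left (dom_cat f) G (pcmp E g f))\<rparr>)\<rparr>)"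

text \<open>For \<open>F : A \<rightarrow> B\<close>, the (strict) transformation \<open>Cat(E, F) : Cat(E, A) \<rightarrow> Cat(E, B)\<close>, and
  for \<open>\<sigma> : F \<Rightarrow> F'\<close> the modification \<open>Cat(E, \<sigma>)\<close>.\<close>

definition postcomp ::
  "('o, 'a) cat \<Rightarrow> ('p, 'b) cat \<Rightarrow> ('p, 'b, 'x, 'y) ftor
   \<Rightarrow> (('o, 'a, 'p, 'b) ftor, ('o, 'a, 'p, 'b) ntrans, ('o, 'a, 'x, 'y) ftor, ('o, 'a, 'x, 'y) ntrans) ftor" where
  "postcomp C A F =
     \<lparr>fob = (\<lambda>G\<in>Obj (functor_category C A). comp_functor C F G),
      far = (\<lambda>\<gamma>\<in>Arr (functor_category C A). whisker_left C F \<gamma>)\<rparr>"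

definition Cat_post ::
  "('c, 'f, 't) twocat \<Rightarrow> ('c, 'f, 't, 'o, 'a) pftor \<Rightarrow> ('p, 'b) cat \<Rightarrow> ('x, 'y) cat
   \<Rightarrow> ('p, 'b, 'x, 'y) ftor
   \<Rightarrow> ('c, 'f, ('o, 'a, 'p, 'b) ftor, ('o, 'a, 'p, 'b) ntrans, ('o, 'a, 'x, 'y) ftor, ('o, 'a, 'x, 'y) ntrans) pnat" where
  "Cat_post K E A B F =
     \<lparr>tob = (\<lambda>C\<in>Obj (one K). postcomp (pob E C) A F),
      tone = (\<lambda>f\<in>Arr (one K).
        let C = Dom (one K) f; D = Cod (one K) f in
        Idn (functor_category (functor_category (pob E D) A) (functor_category (pob E C) B))
          (comp_functor (functor_category (pob E D) A)
            (postcomp (pob E C) A F) (precomp (pob E C) (pob E D) A (pone E f))))\<rparr>"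

definition Cat_post_modif ::
  "('c, 'f, 't) twocat \<Rightarrow> ('c, 'f, 't, 'o, 'a) pftor \<Rightarrow> ('p, 'b) cat \<Rightarrow> ('x, 'y) cat
   \<Rightarrow> ('p, 'b, 'x, 'y) ntrans
   \<Rightarrow> ('c, 'f, ('o, 'a, 'p, 'b) ftor, ('o, 'a, 'p, 'b) ntrans, ('o, 'a, 'x, 'y) ftor, ('o, 'a, 'x, 'y) ntrans) modif" where
  "Cat_post_modif K E A B \<sigma> =
     \<lparr>msrc = Cat_post K E A B (nsrc \<sigma>), mtgt = Cat_post K E A B (ntgt \<sigma>),
      mcmp = (\<lambda>C\<in>Obj (one K).
        \<lparr>nsrc = postcomp (pob E C) A (nsrc \<sigma>), ntgt = postcomp (pob E C) A (ntgt \<sigma>),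
         ncmp = (\<lambda>G\<in>Obj (functor_category (pob E C) A). whisker_right (pob E C) \<sigma> G)\<rparr>)\<rparr>"

text \<open>For \<open>\<xi> : W \<rightarrow> Cat(E, S)\<close>, the functor \<open>Cat(S, X) \<rightarrow> Hom(op2 K, Cat)(W, Cat(E, X))\<close> given by
  \<open>F \<mapsto> Cat(E, F) \<circ> \<xi>\<close> and \<open>\<sigma> \<mapsto> Cat(E, \<sigma>) \<xi>\<close>.\<close>

definition induced_functor ::
  "('c, 'f, 't) twocat \<Rightarrow> ('c, 'f, 't, 'o, 'a) pftor \<Rightarrow> ('c, 'f, 't, 'p, 'b) pftor
   \<Rightarrow> ('s, 'r) cat \<Rightarrow> ('c, 'f, 'p, 'b, ('o, 'a, 's, 'r) ftor, ('o, 'a, 's, 'r) ntrans) pnat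
   \<Rightarrow> ('x, 'y) cat
   \<Rightarrow> (('s, 'r, 'x, 'y) ftor, ('s, 'r, 'x, 'y) ntrans,
       ('c, 'f, 'p, 'b, ('o, 'a, 'x, 'y) ftor, ('o, 'a, 'x, 'y) ntrans) pnat,
       ('c, 'f, 'p, 'b, ('o, 'a, 'x, 'y) ftor, ('o, 'a, 'x, 'y) ntrans) modif) ftor" where
  "induced_functor K E W S \<xi> X =
     \<lparr>fob = (\<lambda>F\<in>Obj (functor_category S X).
        comp_pnat (op2 K) W (Cat_into K E X) (Cat_post K E S X F) \<xi>),
      far = (\<lambda>\<sigma>\<in>Arr (functor_category S X).
        modif_whisker (op2 K) W (Cat_into K E X) (Cat_post_modif K E S X \<sigma>) \<xi>)\<rparr>"


section \<open>Connected components and categories of fractions\<close>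

definition connected_rel :: "('o, 'a) cat \<Rightarrow> ('o \<times> 'o) set" where
  "connected_rel A = {(x, y). x \<in> Obj A \<and> y \<in> Obj A \<and>
     (x, y) \<in> ({(Dom A f, Cod A f) | f. f \<in> Arr A} \<union> {(Cod A f, Dom A f) | f. f \<in> Arr A})\<^sup>*}"

definition components :: "('o, 'a) cat \<Rightarrow> 'o set set" where
  "components A = Obj A // connected_rel A"

definition component_of :: "('c, 'f, 't) twocat \<Rightarrow> 'f \<Rightarrow> 'f set" where
  "component_of K f = connected_rel (hom_category K (Dom (one K) f) (Cod (one K) f)) `` {f}"

text \<open>An arrow of \<open>\<pi>\<^sub>0 K\<close> is a (nonempty) connected component of a hom-category, hence a set of
  parallel 1-cells. The union in the composition is over equal sets.\<close>

definition pi0 :: "('c, 'f, 't) twocat \<Rightarrow> ('c, 'f set) cat" where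
  "pi0 K =
     \<lparr>Obj = Obj (one K),
      Arr = (\<Union>a\<in>Obj (one K). \<Union>b\<in>Obj (one K). components (hom_category K a b)),
      Dom = (\<lambda>c. Dom (one K) (SOME f. f \<in> c)),
      Cod = (\<lambda>c. Cod (one K) (SOME f. f \<in> c)),
      Idn = (\<lambda>a. component_of K (Idn (one K) a)),
      Cmp = (\<lambda>d c. \<Union>g\<in>d. \<Union>f\<in>c. component_of K (Cmp (one K) g f))\<rparr>"

text \<open>The category of fractions is built from zigzags, listed in diagrammatic order: arrows of
  \<open>A\<close> traversed forwards and arrows of \<open>S\<close> traversed backwards, modulo the congruence generated by
  the composition and identities of \<open>A\<close> and by the inverse laws.\<close>

datatype 'a letter = Fwd 'a | Bwd 'a

inductive zigzag :: "('o, 'a) cat \<Rightarrow> 'a set \<Rightarrow> 'o \<Rightarrow> 'a letter list \<Rightarrow> 'o \<Rightarrow> bool"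
  for A S where
  zz_nil: "x \<in> Obj A \<Longrightarrow> zigzag A S x [] x"
| zz_fwd: "f \<in> Arr A \<Longrightarrow> zigzag A S (Cod A f) p y \<Longrightarrow> zigzag A S (Dom A f) (Fwd f # p) y"
| zz_bwd: "s \<in> S \<Longrightarrow> zigzag A S (Dom A s) p y \<Longrightarrow> zigzag A S (Cod A s) (Bwd s # p) y"

inductive zz_eq :: "('o, 'a) cat \<Rightarrow> 'a set \<Rightarrow> 'o \<Rightarrow> 'o \<Rightarrow> 'a letter list \<Rightarrow> 'a letter list \<Rightarrow> bool"
  for A S where
  eq_refl: "zigzag A S x p y \<Longrightarrow> zz_eq A S x y p p"
| eq_sym: "zz_eq A S x y p q \<Longrightarrow> zz_eq A S x y q p"
| eq_trans: "zz_eq A S x y p q \<Longrightarrow> zz_eq A S x y q r \<Longrightarrow> zz_eq A S x y p r"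
| eq_append: "zz_eq A S x y p p' \<Longrightarrow> zz_eq A S y z q q' \<Longrightarrow> zz_eq A S x z (p @ q) (p' @ q')"
| eq_Idn: "x \<in> Obj A \<Longrightarrow> zz_eq A S x x [Fwd (Idn A x)] []"
| eq_Cmp: "f \<in> homset A x y \<Longrightarrow> g \<in> homset A y z \<Longrightarrow> zz_eq A S x z [Fwd f, Fwd g] [Fwd (Cmp A g f)]"
| eq_inv_right: "s \<in> S \<Longrightarrow> zz_eq A S (Dom A s) (Dom A s) [Fwd s, Bwd s] []"
| eq_inv_left: "s \<in> S \<Longrightarrow> zz_eq A S (Cod A s) (Cod A s) [Bwd s, Fwd s] []"

text \<open>Arrows are triples of source, class of zigzags, and target.\<close>

definition zz_class :: "('o, 'a) cat \<Rightarrow> 'a set \<Rightarrow> 'o \<Rightarrow> 'a letter list \<Rightarrow> 'o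
    \<Rightarrow> 'o \<times> 'a letter list set \<times> 'o" where
  "zz_class A S x p y = (x, {q. zz_eq A S x y p q}, y)"

definition fractions :: "('o, 'a) cat \<Rightarrow> 'a set \<Rightarrow> ('o, 'o \<times> 'a letter list set \<times> 'o) cat" where
  "fractions A S =
     \<lparr>Obj = Obj A,
      Arr = {zz_class A S x p y | x p y. zigzag A S x p y},
      Dom = (\<lambda>(x, _, _). x),
      Cod = (\<lambda>(_, _, y). y),
      Idn = (\<lambda>x. zz_class A S x [] x),
      Cmp = (\<lambda>(_, d, z) (x, c, _). (x, \<Union>p\<in>c. \<Union>q\<in>d. {r. zz_eq A S x z (p @ q) r}, z))\<rparr>"

definition fractions_arr :: "('o, 'a) cat \<Rightarrow> 'a set \<Rightarrow> 'a \<Rightarrow> 'o \<times> 'a letter list set \<times> 'o" where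
  "fractions_arr A S f = zz_class A S (Dom A f) [Fwd f] (Cod A f)"


section \<open>The 2-category \<open>\<Delta>(E, W)\<close> and the category \<open>E \<star> W\<close>\<close>

type_synonym ('c, 'o, 'p) dobj = "'c \<times> 'o \<times> 'p"

text \<open>A 1-cell is recorded together with its source and target objects; a 2-cell together with its
  source and target 1-cells.\<close>

type_synonym ('c, 'f, 'o, 'a, 'p, 'b) dcell1 =
  "('c, 'o, 'p) dobj \<times> ('f \<times> 'a \<times> 'b) \<times> ('c, 'o, 'p) dobj"

type_synonym ('c, 'f, 't, 'o, 'a, 'p, 'b) dcell2 =
  "('c, 'f, 'o, 'a, 'p, 'b) dcell1 \<times> 't \<times> ('c, 'f, 'o, 'a, 'p, 'b) dcell1"

definition Delta_one ::
  "('c, 'f, 't) twocat \<Rightarrow> ('c, 'f, 't, 'o, 'a) pftor \<Rightarrow> ('c, 'f, 't, 'p, 'b) pftor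
   \<Rightarrow> (('c, 'o, 'p) dobj, ('c, 'f, 'o, 'a, 'p, 'b) dcell1) cat" where
  "Delta_one K E W =
     (let Ob = {(C, X, Y). C \<in> Obj (one K) \<and> X \<in> Obj (pob E C) \<and> Y \<in> Obj (pob W C)} in
     \<lparr>Obj = Ob,
      Arr = {((C, X, Y), (f, u, v), (D, A, B)) | C X Y f u v D A B.
        (C, X, Y) \<in> Ob \<and> (D, A, B) \<in> Ob \<and> f \<in> homset (one K) C D
        \<and> u \<in> homset (pob E D) (fob (pone E f) X) A
        \<and> v \<in> homset (pob W C) Y (fob (pone W f) B)},
      Dom = (\<lambda>(s, _, _). s),
      Cod = (\<lambda>(_, _, t). t),
      Idn = (\<lambda>(C, X, Y).
        ((C, X, Y), (Idn (one K) C, Idn (pob E C) X, Idn (pob W C) Y), (C, X, Y))),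
      Cmp = (\<lambda>(_, (g, x, y), (D', A', B')) ((C, X, Y), (f, u, v), _).
        ((C, X, Y),
         (Cmp (one K) g f,
          Cmp (pob E D') x (Cmp (pob E D') (far (pone E g) u) (inv_arr (pob E D') (ncmp (pcmp E g f) X))),
          Cmp (pob W C) (ncmp (pcmp W f g) B') (Cmp (pob W C) (far (pone W f) y) v)),
         (D', A', B')))\<rparr>)"

definition Delta ::
  "('c, 'f, 't) twocat \<Rightarrow> ('c, 'f, 't, 'o, 'a) pftor \<Rightarrow> ('c, 'f, 't, 'p, 'b) pftor
   \<Rightarrow> (('c, 'o, 'p) dobj, ('c, 'f, 'o, 'a, 'p, 'b) dcell1, ('c, 'f, 't, 'o, 'a, 'p, 'b) dcell2) twocat" where
  "Delta K E W =
     \<lparr>one = Delta_one K E W,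
      two =
        \<lparr>Obj = Arr (Delta_one K E W),
         Arr = {(((C, X, Y), (f, u, v), (D, A, B)), \<alpha>, ((C, X, Y), (g, x, y), (D, A, B)))
           | C X Y f u v D A B \<alpha> g x y.
             ((C, X, Y), (f, u, v), (D, A, B)) \<in> Arr (Delta_one K E W)
             \<and> ((C, X, Y), (g, x, y), (D, A, B)) \<in> Arr (Delta_one K E W)
             \<and> \<alpha> \<in> homset (two K) f g
             \<and> Cmp (pob E D) x (ncmp (ptwo E \<alpha>) X) = u
             \<and> Cmp (pob W C) (ncmp (ptwo W \<alpha>) B) v = y},
         Dom = (\<lambda>(s, _, _). s),
         Cod = (\<lambda>(_, _, t). t),
         Idn = (\<lambda>(s, (f, u, v), t). ((s, (f, u, v), t), Idn (two K) f, (s, (f, u, v), t))),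
         Cmp = (\<lambda>(_, \<beta>, r) (p, \<alpha>, _). (p, Cmp (two K) \<beta> \<alpha>, r))\<rparr>,
      hcmp = (\<lambda>(p', \<beta>, q') (p, \<alpha>, q).
        (Cmp (Delta_one K E W) p' p, hcmp K \<beta> \<alpha>, Cmp (Delta_one K E W) q' q))\<rparr>"

definition cartesian ::
  "('c, 'f, 't) twocat \<Rightarrow> ('c, 'f, 't, 'o, 'a) pftor \<Rightarrow> ('c, 'f, 't, 'p, 'b) pftor
   \<Rightarrow> ('c, 'f, 'o, 'a, 'p, 'b) dcell1 \<Rightarrow> bool" where
  "cartesian K E W = (\<lambda>((C, X, Y), (f, u, v), (D, A, B)).
     ((C, X, Y), (f, u, v), (D, A, B)) \<in> Arr (one (Delta K E W))
     \<and> iso_arr (pob E D) u \<and> iso_arr (pob W C) v)"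

definition Sigma_cart ::
  "('c, 'f, 't) twocat \<Rightarrow> ('c, 'f, 't, 'o, 'a) pftor \<Rightarrow> ('c, 'f, 't, 'p, 'b) pftor
   \<Rightarrow> ('c, 'f, 'o, 'a, 'p, 'b) dcell1 set set" where
  "Sigma_cart K E W = {component_of (Delta K E W) a | a. cartesian K E W a}"

type_synonym ('c, 'f, 'o, 'a, 'p, 'b) star_arr =
  "('c, 'o, 'p) dobj \<times> ('c, 'f, 'o, 'a, 'p, 'b) dcell1 set letter list set \<times> ('c, 'o, 'p) dobj"

definition star ::
  "('c, 'f, 't) twocat \<Rightarrow> ('c, 'f, 't, 'o, 'a) pftor \<Rightarrow> ('c, 'f, 't, 'p, 'b) pftor
   \<Rightarrow> (('c, 'o, 'p) dobj, ('c, 'f, 'o, 'a, 'p, 'b) star_arr) cat" where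
  "star K E W = fractions (pi0 (Delta K E W)) (Sigma_cart K E W)"

text \<open>The image in \<open>E \<star> W\<close> of an arrow of \<open>\<Delta>(E, W)\<close>.\<close>

definition star_class ::
  "('c, 'f, 't) twocat \<Rightarrow> ('c, 'f, 't, 'o, 'a) pftor \<Rightarrow> ('c, 'f, 't, 'p, 'b) pftor
   \<Rightarrow> ('c, 'f, 'o, 'a, 'p, 'b) dcell1 \<Rightarrow> ('c, 'f, 'o, 'a, 'p, 'b) star_arr" where
  "star_class K E W a =
     fractions_arr (pi0 (Delta K E W)) (Sigma_cart K E W) (component_of (Delta K E W) a)"

text \<open>
  The transformation \<open>\<xi> : W \<rightarrow> Cat(E, E \<star> W)\<close>. On objects \<open>\<xi>\<^sub>C(Y)(X) = (C, X, Y)\<close>, on arrows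
  \<open>\<xi>\<^sub>C(Y)(u) = (1, u, 1)\<close> and \<open>\<xi>\<^sub>C(v)\<^sub>X = (1, 1, v)\<close>; for \<open>f : C \<rightarrow> D\<close>, \<open>X\<close> in \<open>E C\<close> and \<open>B\<close> in \<open>W D\<close> the
  coherence cell at \<open>B\<close>, \<open>X\<close>, from \<open>(C, X, f\<^sup>* B)\<close> to \<open>(D, f\<^sub>! X, B)\<close>, is the class of the cartesian arrow
  \<open>(f, 1, 1)\<close>. It is a constant, not existentially quantified, since an existential witness could not
  be shared by categories \<open>X\<close> of all carrier types.
\<close>

definition xi_ob ::
  "('c, 'f, 't) twocat \<Rightarrow> ('c, 'f, 't, 'o, 'a) pftor \<Rightarrow> ('c, 'f, 't, 'p, 'b) pftor \<Rightarrow> 'c \<Rightarrow> 'p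
   \<Rightarrow> ('o, 'a, ('c, 'o, 'p) dobj, ('c, 'f, 'o, 'a, 'p, 'b) star_arr) ftor" where
  "xi_ob K E W C Y =
     \<lparr>fob = (\<lambda>X\<in>Obj (pob E C). (C, X, Y)),
      far = (\<lambda>u\<in>Arr (pob E C).
        star_class K E W
          ((C, Dom (pob E C) u, Y), (Idn (one K) C, u, Idn (pob W C) Y), (C, Cod (pob E C) u, Y)))\<rparr>"

definition xi_arr ::
  "('c, 'f, 't) twocat \<Rightarrow> ('c, 'f, 't, 'o, 'a) pftor \<Rightarrow> ('c, 'f, 't, 'p, 'b) pftor \<Rightarrow> 'c \<Rightarrow> 'b
   \<Rightarrow> ('o, 'a, ('c, 'o, 'p) dobj, ('c, 'f, 'o, 'a, 'p, 'b) star_arr) ntrans" where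
  "xi_arr K E W C v =
     \<lparr>nsrc = xi_ob K E W C (Dom (pob W C) v), ntgt = xi_ob K E W C (Cod (pob W C) v),
      ncmp = (\<lambda>X\<in>Obj (pob E C).
        star_class K E W
          ((C, X, Dom (pob W C) v), (Idn (one K) C, Idn (pob E C) X, v), (C, X, Cod (pob W C) v)))\<rparr>"

definition xi ::
  "('c, 'f, 't) twocat \<Rightarrow> ('c, 'f, 't, 'o, 'a) pftor \<Rightarrow> ('c, 'f, 't, 'p, 'b) pftor
   \<Rightarrow> ('c, 'f, 'p, 'b,
       ('o, 'a, ('c, 'o, 'p) dobj, ('c, 'f, 'o, 'a, 'p, 'b) star_arr) ftor,
       ('o, 'a, ('c, 'o, 'p) dobj, ('c, 'f, 'o, 'a, 'p, 'b) star_arr) ntrans) pnat" where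
  "xi K E W =
     \<lparr>tob = (\<lambda>C\<in>Obj (one K). \<lparr>fob = (\<lambda>Y\<in>Obj (pob W C). xi_ob K E W C Y),
                              far = (\<lambda>v\<in>Arr (pob W C). xi_arr K E W C v)\<rparr>),
      tone = (\<lambda>f\<in>Arr (one K).
        let C = Dom (one K) f; D = Cod (one K) f in
        \<lparr>nsrc = \<lparr>fob = (\<lambda>B\<in>Obj (pob W D). xi_ob K E W C (fob (pone W f) B)),
                 far = (\<lambda>y\<in>Arr (pob W D). xi_arr K E W C (far (pone W f) y))\<rparr>,
         ntgt = \<lparr>fob = (\<lambda>B\<in>Obj (pob W D). comp_functor (pob E C) (xi_ob K E W D B) (pone E f)),
                 far = (\<lambda>y\<in>Arr (pob W D). whisker_right (pob E C) (xi_arr K E W D y) (pone E f))\<rparr>,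
         ncmp = (\<lambda>B\<in>Obj (pob W D).
           \<lparr>nsrc = xi_ob K E W C (fob (pone W f) B),
            ntgt = comp_functor (pob E C) (xi_ob K E W D B) (pone E f),
            ncmp = (\<lambda>X\<in>Obj (pob E C).
              star_class K E W
                ((C, X, fob (pone W f) B),
                 (f, Idn (pob E D) (fob (pone E f) X), Idn (pob W C) (fob (pone W f) B)),
                 (D, fob (pone E f) X, B)))\<rparr>)\<rparr>)\<rparr>"

end

theory Submission
  imports Defs
begin

text \<open>
  A pseudo-natural transformation \<open>\<theta> : W \<rightarrow> Cat(E, Z)\<close> consists, once all variables are uncurried, of
  objects \<open>\<theta>\<^sub>C(Y)(X)\<close> of \<open>Z\<close>, one for each object \<open>(C, X, Y)\<close> of \<open>\<Delta>(E, W)\<close>, and of three kinds of arrows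
  between them: \<open>\<theta>\<^sub>C(Y)(u)\<close> for an arrow \<open>u\<close> of \<open>E C\<close>, \<open>\<theta>\<^sub>C(v)\<^sub>X\<close> for an arrow \<open>v\<close> of \<open>W C\<close>, and the
  invertible components \<open>\<theta>\<^sub>C(f\<^sup>* B)(X) \<rightarrow> \<theta>\<^sub>D(B)(f\<^sub>! X)\<close> of the coherence cell at \<open>f : C \<rightarrow> D\<close>. Such data are
  called a cylinder below. The three kinds of arrows sit over the 1-cells \<open>(1, u, 1)\<close>, \<open>(1, 1, v)\<close> and
  \<open>(f, 1, 1)\<close> of \<open>\<Delta>(E, W)\<close>, and every 1-cell factors as \<open>(f, u, v) = (1, u, 1) (f, 1, 1) (1, 1, v)\<close>.
  Hence a cylinder extends in exactly one way to an assignment on all 1-cells of \<open>\<Delta>(E, W)\<close>, and the axioms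
  for \<open>\<theta>\<close> say that the extension is a functor: functoriality and naturality in \<open>u\<close> and \<open>v\<close> together with
  the law for the coherence cell at \<open>g \<circ> f\<close> give preservation of composites (\<open>cyl_ext_Cmp\<close>), naturality
  of the coherence cells in 2-cells gives equal values on 1-cells joined by a 2-cell (\<open>cyl_ext_two_cell\<close>),
  and invertibility of the coherence cells gives invertible values on cartesian 1-cells
  (\<open>cyl_ext_cartesian\<close>).

  By construction \<open>E \<star> W\<close> is universal among categories that receive a functor with the last two
  properties (\<open>star_lift\<close>), so cylinders in \<open>Z\<close> correspond to functors \<open>E \<star> W \<rightarrow> Z\<close>. The classes of the
  three kinds of 1-cells form a cylinder in \<open>E \<star> W\<close> itself (\<open>pseudo_cylinder_star\<close>); its curried form is
  \<open>\<xi>\<close> (\<open>xi_eq\<close>), and the correspondence sends a functor \<open>F\<close> to the image of this cylinder under \<open>F\<close>, which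
  is the curried composite of \<open>\<xi>\<close> with \<open>Cat(E, F)\<close> (\<open>comp_pnat_Cat_post\<close>).

  The same description handles modifications. A modification is a family of arrows of \<open>Z\<close> indexed by
  the objects \<open>(C, X, Y)\<close> that is natural with respect to the three kinds of generators, and naturality
  on generators and on their inverses implies naturality on all of \<open>E \<star> W\<close> (\<open>star_naturality\<close>). So the
  induced functor is bijective on objects and on arrows, which makes it an isomorphism of categories.

  Uncurrying \<open>\<theta>\<close> and currying again returns \<open>\<theta>\<close> itself since its data are extensional
  (\<open>cyl_pnat_pnat_cyl\<close>). What remains is that the categories involved are categories: for \<open>E \<star> W\<close> this
  rests on \<open>\<Delta>(E, W)\<close> being a 2-category (\<open>two_category_Delta\<close>), and for pseudo-natural transformations
  on \<open>Cat(E, Z)\<close> being a pseudo-functor (\<open>pseudofunctor_Cat_into\<close>).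
\<close>

section \<open>Categories, functors and natural transformations\<close>

lemma in_homset: "f \<in> homset A x y \<longleftrightarrow> f \<in> Arr A \<and> Dom A f = x \<and> Cod A f = y"
  by (auto simp: homset_def)

text \<open>Membership in a hom-set is mostly restated as three conditions on \<open>Arr\<close>, \<open>Dom\<close> and \<open>Cod\<close>. Unlike the
  hom-set form, these conditions contain no variables that are absent from the conclusion, so that
  the simplifier can discharge them.\<close>

context category
begin

lemma Idn_simps [simp]:
  "x \<in> Obj A \<Longrightarrow> Idn A x \<in> Arr A"
  "x \<in> Obj A \<Longrightarrow> Dom A (Idn A x) = x"
  "x \<in> Obj A \<Longrightarrow> Cod A (Idn A x) = x"
  using Idn_hom by (auto simp: in_homset)

lemma Dom_Cod_Obj [simp]:
  "f \<in> Arr A \<Longrightarrow> Dom A f \<in> Obj A" "f \<in> Arr A \<Longrightarrow> Cod A f \<in> Obj A"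
  by (auto simp: Dom_Obj Cod_Obj)

lemma Cmp_simps [simp]:
  assumes "f \<in> Arr A" "g \<in> Arr A" "Cod A f = Dom A g"
  shows "Cmp A g f \<in> Arr A" "Dom A (Cmp A g f) = Dom A f" "Cod A (Cmp A g f) = Cod A g"
  using Cmp_hom[of f "Dom A f" "Dom A g" g "Cod A g"] assms by (auto simp: in_homset)

lemma Cmp_Idn_right [simp]: "f \<in> Arr A \<Longrightarrow> Dom A f = x \<Longrightarrow> Cmp A f (Idn A x) = f"
  using Cmp_Idn by (auto simp: in_homset)

lemma Cmp_Idn_left [simp]: "f \<in> Arr A \<Longrightarrow> Cod A f = x \<Longrightarrow> Cmp A (Idn A x) f = f"
  using Idn_Cmp by (auto simp: in_homset)

lemma assoc [simp]:
  "f \<in> Arr A \<Longrightarrow> g \<in> Arr A \<Longrightarrow> h \<in> Arr A \<Longrightarrow> Cod A f = Dom A g \<Longrightarrow> Cod A g = Dom A h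
    \<Longrightarrow> Cmp A (Cmp A h g) f = Cmp A h (Cmp A g f)"
  using Cmp_assoc by (auto simp: in_homset)

text \<open>Right-nested composites are the normal form of the simplifier; this turns a commuting square
  into a rewrite rule that applies inside such a composite.\<close>

lemma square_Cmp:
  "Cmp A a b = Cmp A c d \<Longrightarrow> a \<in> Arr A \<Longrightarrow> b \<in> Arr A \<Longrightarrow> c \<in> Arr A \<Longrightarrow> d \<in> Arr A
    \<Longrightarrow> Cod A b = Dom A a \<Longrightarrow> Cod A d = Dom A c \<Longrightarrow> k \<in> Arr A \<Longrightarrow> Cod A k = Dom A b \<Longrightarrow> Cod A k = Dom A d
    \<Longrightarrow> Cmp A a (Cmp A b k) = Cmp A c (Cmp A d k)"
  by (metis assoc)

lemma inverse_arrows_unique: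
  assumes "inverse_arrows A f g" "inverse_arrows A f h"
  shows "g = h"
proof -
  have "g = Cmp A g (Cmp A f h)" using assms by (auto simp: inverse_arrows_def in_homset)
  also have "\<dots> = Cmp A (Cmp A g f) h" using assms by (subst assoc) (auto simp: inverse_arrows_def in_homset)
  also have "\<dots> = h" using assms by (auto simp: inverse_arrows_def in_homset)
  finally show ?thesis .
qed

lemma inverse_arrows_inv_arr: "iso_arr A f \<Longrightarrow> inverse_arrows A f (inv_arr A f)"
  unfolding iso_arr_def inv_arr_def using inverse_arrows_unique by (auto intro: theI)

lemma inv_arr_eq: "inverse_arrows A f g \<Longrightarrow> inv_arr A f = g"
  using inverse_arrows_unique[of f "inv_arr A f" g] inverse_arrows_inv_arr[of f] unfolding iso_arr_def by blast

lemma inverse_arrowsI: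
  "f \<in> Arr A \<Longrightarrow> g \<in> Arr A \<Longrightarrow> Dom A g = Cod A f \<Longrightarrow> Cod A g = Dom A f
    \<Longrightarrow> Cmp A g f = Idn A (Dom A f) \<Longrightarrow> Cmp A f g = Idn A (Cod A f) \<Longrightarrow> inverse_arrows A f g"
  by (auto simp: inverse_arrows_def in_homset)

lemma iso_arr_Arr: "iso_arr A f \<Longrightarrow> f \<in> Arr A"
  by (auto simp: iso_arr_def inverse_arrows_def)

lemma inv_arr_simps [simp]:
  assumes "iso_arr A f"
  shows "inv_arr A f \<in> Arr A" "Dom A (inv_arr A f) = Cod A f" "Cod A (inv_arr A f) = Dom A f"
    "Cmp A (inv_arr A f) f = Idn A (Dom A f)" "Cmp A f (inv_arr A f) = Idn A (Cod A f)"
  using inverse_arrows_inv_arr[OF assms] by (auto simp: inverse_arrows_def in_homset)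

lemma inv_arr_Cmp_cancel [simp]:
  assumes "iso_arr A f" "k \<in> Arr A"
  shows "Cod A k = Dom A f \<Longrightarrow> Cmp A (inv_arr A f) (Cmp A f k) = k"
    "Cod A k = Cod A f \<Longrightarrow> Cmp A f (Cmp A (inv_arr A f) k) = k"
  using assms iso_arr_Arr[OF assms(1)] by (auto simp flip: assoc)

lemma inverse_arrows_Idn: "x \<in> Obj A \<Longrightarrow> inverse_arrows A (Idn A x) (Idn A x)"
  by (auto intro!: inverse_arrowsI)

lemma iso_arr_Idn [simp]: "x \<in> Obj A \<Longrightarrow> iso_arr A (Idn A x)"
  using inverse_arrows_Idn by (auto simp: iso_arr_def)

lemma inv_arr_Idn [simp]: "x \<in> Obj A \<Longrightarrow> inv_arr A (Idn A x) = Idn A x"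
  using inverse_arrows_Idn inv_arr_eq by auto

lemma iso_arr_Cmp:
  assumes "iso_arr A f" "iso_arr A g" "Cod A f = Dom A g"
  shows "iso_arr A (Cmp A g f)"
proof -
  have "inverse_arrows A (Cmp A g f) (Cmp A (inv_arr A f) (inv_arr A g))"
    using assms iso_arr_Arr[OF assms(1)] iso_arr_Arr[OF assms(2)] by (intro inverse_arrowsI) auto
  then show ?thesis by (auto simp: iso_arr_def)
qed

end

context is_functor
begin

lemma fob_simp [simp]: "x \<in> Obj A \<Longrightarrow> fob F x \<in> Obj B"
  by (rule fob_Obj)

lemma far_simps [simp]:
  assumes "f \<in> Arr A"
  shows "far F f \<in> Arr B" "Dom B (far F f) = fob F (Dom A f)" "Cod B (far F f) = fob F (Cod A f)"
  using far_hom[of f "Dom A f" "Cod A f"] assms by (auto simp: in_homset)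

lemma far_Idn_simp [simp]: "x \<in> Obj A \<Longrightarrow> far F (Idn A x) = Idn B (fob F x)"
  by (rule far_Idn)

lemma far_Cmp_simp [simp]:
  "f \<in> Arr A \<Longrightarrow> g \<in> Arr A \<Longrightarrow> Cod A f = Dom A g
    \<Longrightarrow> far F (Cmp A g f) = Cmp B (far F g) (far F f)"
  using far_Cmp by (auto simp: in_homset)

lemma inverse_arrows_far: "inverse_arrows A f g \<Longrightarrow> inverse_arrows B (far F f) (far F g)"
  unfolding inverse_arrows_def in_homset
  by (metis A.Dom_Obj A.Cod_Obj far_Cmp_simp far_Idn far_simps)

lemma iso_arr_far [simp]: "iso_arr A f \<Longrightarrow> iso_arr B (far F f)"
  using inverse_arrows_far by (auto simp: iso_arr_def)

lemma far_inv_arr: "iso_arr A f \<Longrightarrow> far F (inv_arr A f) = inv_arr B (far F f)"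
  using inverse_arrows_far A.inverse_arrows_inv_arr B.inv_arr_eq by metis

end

lemma is_functorI:
  assumes "category A" "category B"
    and "fob F \<in> extensional (Obj A)" "far F \<in> extensional (Arr A)"
    and "\<And>x. x \<in> Obj A \<Longrightarrow> fob F x \<in> Obj B"
    and "\<And>f. f \<in> Arr A \<Longrightarrow> far F f \<in> Arr B \<and> Dom B (far F f) = fob F (Dom A f)
      \<and> Cod B (far F f) = fob F (Cod A f)"
    and "\<And>x. x \<in> Obj A \<Longrightarrow> far F (Idn A x) = Idn B (fob F x)"
    and "\<And>f g. f \<in> Arr A \<Longrightarrow> g \<in> Arr A \<Longrightarrow> Cod A f = Dom A g
      \<Longrightarrow> far F (Cmp A g f) = Cmp B (far F g) (far F f)"
  shows "is_functor A B F"
  using assms by (auto simp: is_functor_def is_functor_axioms_def in_homset)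

lemma functor_eqI:
  assumes "is_functor A B F" "is_functor A B G"
    and "\<And>x. x \<in> Obj A \<Longrightarrow> fob F x = fob G x" "\<And>f. f \<in> Arr A \<Longrightarrow> far F f = far G f"
  shows "F = G"
proof -
  interpret F: is_functor A B F by fact
  interpret G: is_functor A B G by fact
  show ?thesis
    using F.fob_ext F.far_ext G.fob_ext G.far_ext assms(3,4)
    by (intro ftor.equality) (auto intro: extensionalityI)
qed

lemma id_functor_simps [simp]:
  "x \<in> Obj A \<Longrightarrow> fob (id_functor A) x = x" "f \<in> Arr A \<Longrightarrow> far (id_functor A) f = f"
  by (auto simp: id_functor_def)

lemma comp_functor_simps [simp]:
  "x \<in> Obj A \<Longrightarrow> fob (comp_functor A G F) x = fob G (fob F x)"
  "f \<in> Arr A \<Longrightarrow> far (comp_functor A G F) f = far G (far F f)"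
  by (auto simp: comp_functor_def compose_def)

lemma comp_functor_ext [simp]:
  "fob (comp_functor A G F) \<in> extensional (Obj A)" "far (comp_functor A G F) \<in> extensional (Arr A)"
  by (auto simp: comp_functor_def)

lemma is_functor_id [intro]: "category A \<Longrightarrow> is_functor A A (id_functor A)"
  by (rule is_functorI) (auto simp: id_functor_def category.Cmp_simps category.Idn_simps category.Dom_Cod_Obj)

lemma is_functor_comp [intro]:
  assumes "is_functor A B F" "is_functor B C G"
  shows "is_functor A C (comp_functor A G F)"
proof -
  interpret F: is_functor A B F by fact
  interpret G: is_functor B C G by fact
  show ?thesis
    by (rule is_functorI) (auto simp: F.A.category_axioms G.B.category_axioms)
qed

lemma comp_functor_assoc:
  assumes "is_functor A B F"
  shows "comp_functor A (comp_functor B H G) F = comp_functor A H (comp_functor A G F)"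
proof -
  interpret F: is_functor A B F by fact
  show ?thesis by (auto simp: comp_functor_def compose_def fun_eq_iff)
qed

lemma comp_functor_id [simp]:
  assumes "is_functor A B F"
  shows "comp_functor A (id_functor B) F = F" "comp_functor A F (id_functor A) = F"
proof -
  interpret F: is_functor A B F by fact
  show "comp_functor A (id_functor B) F = F" "comp_functor A F (id_functor A) = F"
    by (auto intro!: functor_eqI[of A B] is_functor_comp assms is_functor_id F.B.category_axioms F.A.category_axioms)
qed

text \<open>The inverse of a functor that is bijective on objects and on arrows is automatically
  functorial, so an isomorphism of categories may be recognized on carriers.\<close>

lemma iso_of_categories_if_bij:
  assumes "is_functor A B F" and ob: "bij_betw (fob F) (Obj A) (Obj B)"
    and ar: "bij_betw (far F) (Arr A) (Arr B)"
  shows "iso_of_categories A B F"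
proof -
  interpret F: is_functor A B F by fact
  define I where "I = the_inv_into (Obj A) (fob F)"
  define J where "J = the_inv_into (Arr A) (far F)"
  have I: "\<And>x. x \<in> Obj A \<Longrightarrow> I (fob F x) = x" "\<And>y. y \<in> Obj B \<Longrightarrow> fob F (I y) = y \<and> I y \<in> Obj A"
    using ob unfolding I_def bij_betw_def
    by (auto simp: the_inv_into_f_f f_the_inv_into_f intro: the_inv_into_into[OF _ _ order_refl, simplified])
  have J: "\<And>x. x \<in> Arr A \<Longrightarrow> J (far F x) = x" "\<And>y. y \<in> Arr B \<Longrightarrow> far F (J y) = y \<and> J y \<in> Arr A"
    using ar unfolding J_def bij_betw_def
    by (auto simp: the_inv_into_f_f f_the_inv_into_f intro: the_inv_into_into[OF _ _ order_refl, simplified])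
  have J_eq: "J g = f" if "g = far F f" "f \<in> Arr A" for f g using that J by simp
  have dc: "Dom A (J g) = I (Dom B g)" "Cod A (J g) = I (Cod B g)" if "g \<in> Arr B" for g
    using J(2)[OF that] I(1) by (metis F.A.Dom_Obj F.A.Cod_Obj F.far_simps)+
  define G where "G = \<lparr>fob = restrict I (Obj B), far = restrict J (Arr B)\<rparr>"
  have G: "is_functor B A G"
  proof (rule is_functorI)
    show "far G (Idn B x) = Idn A (fob G x)" if "x \<in> Obj B" for x
      using that I by (auto simp: G_def intro!: J_eq)
    show "far G (Cmp B g f) = Cmp A (far G g) (far G f)"
      if "f \<in> Arr B" "g \<in> Arr B" "Cod B f = Dom B g" for f g
      using that J dc by (auto simp: G_def intro!: J_eq)
  qed (use I J dc in \<open>auto simp: G_def F.A.category_axioms F.B.category_axioms\<close>)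
  interpret G: is_functor B A G by fact
  have "comp_functor A G F = id_functor A" "comp_functor B F G = id_functor B"
    using I J by (auto intro!: functor_eqI[OF is_functor_comp is_functor_id] assms(1) G
        simp: F.A.category_axioms F.B.category_axioms) (auto simp: G_def)
  then show ?thesis using assms(1) G by (auto simp: iso_of_categories_def)
qed

subsection \<open>Functor categories\<close>

abbreviation "Fun \<equiv> functor_category"

context is_ntrans
begin

lemma ncmp_simps [simp]:
  assumes "x \<in> Obj A"
  shows "ncmp \<tau> x \<in> Arr B" "Dom B (ncmp \<tau> x) = fob (nsrc \<tau>) x" "Cod B (ncmp \<tau> x) = fob (ntgt \<tau>) x"
  using ncmp_hom[OF assms] by (auto simp: in_homset)

lemma naturality:
  "f \<in> Arr A \<Longrightarrow> Cmp B (ncmp \<tau> (Cod A f)) (far (nsrc \<tau>) f) = Cmp B (far (ntgt \<tau>) f) (ncmp \<tau> (Dom A f))"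
  using natural by (auto simp: in_homset)

end

lemma is_ntransI:
  assumes "is_functor A B (nsrc \<tau>)" "is_functor A B (ntgt \<tau>)" "ncmp \<tau> \<in> extensional (Obj A)"
    and "\<And>x. x \<in> Obj A \<Longrightarrow> ncmp \<tau> x \<in> Arr B \<and> Dom B (ncmp \<tau> x) = fob (nsrc \<tau>) x
      \<and> Cod B (ncmp \<tau> x) = fob (ntgt \<tau>) x"
    and "\<And>f. f \<in> Arr A \<Longrightarrow>
      Cmp B (ncmp \<tau> (Cod A f)) (far (nsrc \<tau>) f) = Cmp B (far (ntgt \<tau>) f) (ncmp \<tau> (Dom A f))"
  shows "is_ntrans A B \<tau>"
  using assms by (auto simp: is_ntrans_def is_ntrans_axioms_def in_homset)

lemma ntrans_eqI:
  fixes \<sigma> \<tau> :: "('o, 'a, 'p, 'b) ntrans"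
  assumes "ncmp \<sigma> \<in> extensional (Obj A)" "ncmp \<tau> \<in> extensional (Obj A)"
    and "nsrc \<sigma> = nsrc \<tau>" "ntgt \<sigma> = ntgt \<tau>" "\<And>x. x \<in> Obj A \<Longrightarrow> ncmp \<sigma> x = ncmp \<tau> x"
  shows "\<sigma> = \<tau>"
  using assms by (intro ntrans.equality) (auto intro: extensionalityI)

lemma functor_category_simps [simp]:
  "Obj (Fun A B) = {F. is_functor A B F}"
  "Arr (Fun A B) = {\<tau>. is_ntrans A B \<tau>}"
  "Dom (Fun A B) = nsrc" "Cod (Fun A B) = ntgt"
  "nsrc (Idn (Fun A B) F) = F" "ntgt (Idn (Fun A B) F) = F"
  "ncmp (Idn (Fun A B) F) = (\<lambda>x\<in>Obj A. Idn B (fob F x))"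
  "nsrc (Cmp (Fun A B) \<sigma> \<tau>) = nsrc \<tau>" "ntgt (Cmp (Fun A B) \<sigma> \<tau>) = ntgt \<sigma>"
  "ncmp (Cmp (Fun A B) \<sigma> \<tau>) = (\<lambda>x\<in>Obj A. Cmp B (ncmp \<sigma> x) (ncmp \<tau> x))"
  by (simp_all add: functor_category_def)

lemma whisker_left_simps [simp]:
  "nsrc (whisker_left A G \<tau>) = comp_functor A G (nsrc \<tau>)"
  "ntgt (whisker_left A G \<tau>) = comp_functor A G (ntgt \<tau>)"
  "ncmp (whisker_left A G \<tau>) = (\<lambda>x\<in>Obj A. far G (ncmp \<tau> x))"
  by (simp_all add: whisker_left_def)

lemma whisker_right_simps [simp]:
  "nsrc (whisker_right A \<tau> F) = comp_functor A (nsrc \<tau>) F"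
  "ntgt (whisker_right A \<tau> F) = comp_functor A (ntgt \<tau>) F"
  "ncmp (whisker_right A \<tau> F) = (\<lambda>x\<in>Obj A. ncmp \<tau> (fob F x))"
  by (simp_all add: whisker_right_def)

lemma is_ntrans_Idn: "is_functor A B F \<Longrightarrow> is_ntrans A B (Idn (Fun A B) F)"
proof -
  assume F: "is_functor A B F"
  interpret F: is_functor A B F by fact
  show ?thesis by (rule is_ntransI) (auto simp: F)
qed

lemma is_ntrans_Cmp:
  assumes "is_ntrans A B \<tau>" "is_ntrans A B \<sigma>" "ntgt \<tau> = nsrc \<sigma>"
  shows "is_ntrans A B (Cmp (Fun A B) \<sigma> \<tau>)"
proof -
  interpret S: is_ntrans A B \<sigma> by fact
  interpret T: is_ntrans A B \<tau> by fact
  note [simp] = assms(3)[symmetric]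
  show ?thesis
  proof (rule is_ntransI)
    fix f assume f: "f \<in> Arr A"
    have "Cmp B (ncmp \<sigma> (Cod A f)) (Cmp B (ncmp \<tau> (Cod A f)) (far (nsrc \<tau>) f))
      = Cmp B (ncmp \<sigma> (Cod A f)) (Cmp B (far (nsrc \<sigma>) f) (ncmp \<tau> (Dom A f)))"
      using f T.naturality by simp
    also have "\<dots> = Cmp B (far (ntgt \<sigma>) f) (Cmp B (ncmp \<sigma> (Dom A f)) (ncmp \<tau> (Dom A f)))"
      by (rule S.S.B.square_Cmp[OF S.naturality]) (use f in auto)
    finally show "Cmp B (ncmp (Cmp (Fun A B) \<sigma> \<tau>) (Cod A f)) (far (nsrc (Cmp (Fun A B) \<sigma> \<tau>)) f)
      = Cmp B (far (ntgt (Cmp (Fun A B) \<sigma> \<tau>)) f) (ncmp (Cmp (Fun A B) \<sigma> \<tau>) (Dom A f))"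
      using f by simp
  qed (auto simp: T.S.is_functor_axioms S.T.is_functor_axioms)
qed

lemma category_functor_category:
  assumes "category A" "category B"
  shows "category (Fun A B)"
proof -
  interpret A: category A by fact
  interpret B: category B by fact
  show ?thesis
  proof
    show "Dom (Fun A B) f \<in> Obj (Fun A B)"
      "Cod (Fun A B) f \<in> Obj (Fun A B)"
      if "f \<in> Arr (Fun A B)" for f
      using that by (auto simp: is_ntrans_def)
    show "Idn (Fun A B) x \<in> homset (Fun A B) x x"
      if "x \<in> Obj (Fun A B)" for x
      using that by (auto simp: is_ntrans_Idn in_homset)
    show "Cmp (Fun A B) g f \<in> homset (Fun A B) x z"
      if "f \<in> homset (Fun A B) x y" "g \<in> homset (Fun A B) y z" for f g x y z
      using that by (auto simp: is_ntrans_Cmp in_homset)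
    show "Cmp (Fun A B) f (Idn (Fun A B) x) = f"
      "Cmp (Fun A B) (Idn (Fun A B) y) f = f"
      if f: "f \<in> homset (Fun A B) x y" for f x y
    proof -
      interpret f: is_ntrans A B f using f by (auto simp: in_homset)
      show "Cmp (Fun A B) f (Idn (Fun A B) x) = f"
        "Cmp (Fun A B) (Idn (Fun A B) y) f = f"
        using f f.ncmp_ext by (auto simp: in_homset intro!: ntrans_eqI[where A = A])
    qed
    show "Cmp (Fun A B) h (Cmp (Fun A B) g f)
       = Cmp (Fun A B) (Cmp (Fun A B) h g) f"
      if "f \<in> homset (Fun A B) w x" "g \<in> homset (Fun A B) x y"
        "h \<in> homset (Fun A B) y z" for f g h w x y z
    proof -
      interpret f: is_ntrans A B f using that by (auto simp: in_homset)
      interpret g: is_ntrans A B g using that by (auto simp: in_homset)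
      interpret h: is_ntrans A B h using that by (auto simp: in_homset)
      show ?thesis
        using that by (auto simp: in_homset intro!: ntrans_eqI[where A = A])
    qed
  qed
qed

lemma iso_arr_ncmp:
  assumes "iso_arr (Fun A B) \<tau>" "x \<in> Obj A"
  shows "iso_arr B (ncmp \<tau> x)"
proof -
  from assms(1) obtain \<sigma> where inv: "inverse_arrows (Fun A B) \<tau> \<sigma>"
    by (auto simp: iso_arr_def)
  then interpret S: is_ntrans A B \<sigma> by (auto simp: inverse_arrows_def in_homset)
  interpret T: is_ntrans A B \<tau> using inv by (auto simp: inverse_arrows_def in_homset)
  have [simp]: "nsrc \<sigma> = ntgt \<tau>" "ntgt \<sigma> = nsrc \<tau>" using inv by (auto simp: inverse_arrows_def in_homset)
  have eq: "Cmp (Fun A B) \<sigma> \<tau> = Idn (Fun A B) (nsrc \<tau>)"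
    "Cmp (Fun A B) \<tau> \<sigma> = Idn (Fun A B) (ntgt \<tau>)"
    using inv by (auto simp: inverse_arrows_def)
  have "inverse_arrows B (ncmp \<tau> x) (ncmp \<sigma> x)"
    using eq[THEN arg_cong[where f = "\<lambda>\<tau>. ncmp \<tau> x"]] assms(2)
    by (intro S.S.B.inverse_arrowsI) auto
  then show ?thesis by (auto simp: iso_arr_def)
qed

text \<open>Componentwise inverses of a natural transformation are automatically natural.\<close>

lemma iso_arr_functor_categoryI:
  assumes "is_ntrans A B \<tau>" "\<And>x. x \<in> Obj A \<Longrightarrow> iso_arr B (ncmp \<tau> x)"
  shows "iso_arr (Fun A B) \<tau>"
proof -
  interpret T: is_ntrans A B \<tau> by fact
  note iso [simp] = assms(2)
  define \<sigma> where "\<sigma> = \<lparr>nsrc = ntgt \<tau>, ntgt = nsrc \<tau>, ncmp = (\<lambda>x\<in>Obj A. inv_arr B (ncmp \<tau> x))\<rparr>"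
  have nat: "Cmp B (inv_arr B (ncmp \<tau> (Cod A f))) (far (ntgt \<tau>) f)
      = Cmp B (far (nsrc \<tau>) f) (inv_arr B (ncmp \<tau> (Dom A f)))" if f: "f \<in> Arr A" for f
  proof -
    have "Cmp B (inv_arr B (ncmp \<tau> (Cod A f))) (far (ntgt \<tau>) f)
      = Cmp B (inv_arr B (ncmp \<tau> (Cod A f)))
          (Cmp B (Cmp B (far (ntgt \<tau>) f) (ncmp \<tau> (Dom A f))) (inv_arr B (ncmp \<tau> (Dom A f))))"
      using f by simp
    also have "\<dots> = Cmp B (far (nsrc \<tau>) f) (inv_arr B (ncmp \<tau> (Dom A f)))"
      using f by (simp flip: T.naturality)
    finally show ?thesis .
  qed
  have S: "is_ntrans A B \<sigma>"
    by (rule is_ntransI) (auto simp: \<sigma>_def nat T.S.is_functor_axioms T.T.is_functor_axioms)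
  have "inverse_arrows (Fun A B) \<tau> \<sigma>"
    using S assms(1) unfolding inverse_arrows_def in_homset
    by (auto simp: \<sigma>_def intro!: ntrans_eqI[where A = A])
  then show ?thesis by (auto simp: iso_arr_def)
qed

lemma is_ntrans_whisker_left [intro]:
  assumes "is_ntrans A B \<tau>" "is_functor B C G"
  shows "is_ntrans A C (whisker_left A G \<tau>)"
proof -
  interpret T: is_ntrans A B \<tau> by fact
  interpret G: is_functor B C G by fact
  have "Cmp C (far G (ncmp \<tau> (Cod A f))) (far G (far (nsrc \<tau>) f))
    = Cmp C (far G (far (ntgt \<tau>) f)) (far G (ncmp \<tau> (Dom A f)))" if "f \<in> Arr A" for f
    using that T.naturality[OF that, THEN arg_cong[where f = "far G"]] by simp
  then show ?thesis
    by (intro is_ntransI)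
      (auto intro: is_functor_comp T.S.is_functor_axioms T.T.is_functor_axioms G.is_functor_axioms)
qed

lemma is_ntrans_whisker_right [intro]:
  assumes "is_functor A B F" "is_ntrans B C \<tau>"
  shows "is_ntrans A C (whisker_right A \<tau> F)"
proof -
  interpret T: is_ntrans B C \<tau> by fact
  interpret F: is_functor A B F by fact
  have "Cmp C (ncmp \<tau> (fob F (Cod A f))) (far (nsrc \<tau>) (far F f))
    = Cmp C (far (ntgt \<tau>) (far F f)) (ncmp \<tau> (fob F (Dom A f)))" if "f \<in> Arr A" for f
    using that T.naturality[of "far F f"] by simp
  then show ?thesis
    by (intro is_ntransI) (simp_all add: is_functor_comp[OF assms(1)] T.S.is_functor_axioms T.T.is_functor_axioms)
qed

section \<open>Connected components of hom-categories\<close>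

lemma connected_rel_refl: "x \<in> Obj A \<Longrightarrow> (x, x) \<in> connected_rel A"
  by (simp add: connected_rel_def)

lemma connected_rel_sym: "(x, y) \<in> connected_rel A \<Longrightarrow> (y, x) \<in> connected_rel A"
proof -
  let ?R = "{(Dom A f, Cod A f) | f. f \<in> Arr A} \<union> {(Cod A f, Dom A f) | f. f \<in> Arr A}"
  have "sym (?R\<^sup>*)" by (rule sym_rtrancl) (auto simp: sym_def)
  then show "(x, y) \<in> connected_rel A \<Longrightarrow> (y, x) \<in> connected_rel A"
    unfolding connected_rel_def sym_def by blast
qed

lemma connected_rel_trans:
  "(x, y) \<in> connected_rel A \<Longrightarrow> (y, z) \<in> connected_rel A \<Longrightarrow> (x, z) \<in> connected_rel A"
  unfolding connected_rel_def by (auto intro: rtrancl_trans)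

lemma connected_rel_Obj: "(x, y) \<in> connected_rel A \<Longrightarrow> x \<in> Obj A \<and> y \<in> Obj A"
  by (simp add: connected_rel_def)

lemma connected_rel_class_eq:
  assumes "x \<in> Obj A"
  shows "connected_rel A `` {x} = connected_rel A `` {y} \<longleftrightarrow> (x, y) \<in> connected_rel A"
proof
  assume "connected_rel A `` {x} = connected_rel A `` {y}"
  then have "(y, x) \<in> connected_rel A" using connected_rel_refl[OF assms] by blast
  then show "(x, y) \<in> connected_rel A" by (rule connected_rel_sym)
next
  assume "(x, y) \<in> connected_rel A"
  then show "connected_rel A `` {x} = connected_rel A `` {y}"
    by (auto intro: connected_rel_trans dest: connected_rel_sym)
qed

lemma connected_rel_map:
  assumes "\<And>f. f \<in> Arr A \<Longrightarrow> (h (Dom A f), h (Cod A f)) \<in> connected_rel B"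
    and "\<And>x. x \<in> Obj A \<Longrightarrow> h x \<in> Obj B"
    and "(x, y) \<in> connected_rel A"
  shows "(h x, h y) \<in> connected_rel B"
proof -
  let ?R = "{(Dom A f, Cod A f) | f. f \<in> Arr A} \<union> {(Cod A f, Dom A f) | f. f \<in> Arr A}"
  have x: "x \<in> Obj A" using assms(3) by (rule connected_rel_Obj[THEN conjunct1])
  have "(x, y) \<in> ?R\<^sup>*" using assms(3) by (simp add: connected_rel_def)
  then show ?thesis
  proof induction
    case base
    show ?case by (rule connected_rel_refl[OF assms(2)[OF x]])
  next
    case (step y z)
    from step.hyps(2) have "(h y, h z) \<in> connected_rel B"
      by (auto intro: assms(1) connected_rel_sym[OF assms(1)])
    with step.IH show ?case by (rule connected_rel_trans)
  qed
qed

context two_category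
begin

lemma two_simps [simp]: "\<alpha> \<in> Arr (two K) \<Longrightarrow> Dom (two K) \<alpha> \<in> Arr (one K)"
  "\<alpha> \<in> Arr (two K) \<Longrightarrow> Cod (two K) \<alpha> \<in> Arr (one K)"
  using two.Dom_Obj two.Cod_Obj Obj_two by auto

lemma Idn_two_simps [simp]: "f \<in> Arr (one K) \<Longrightarrow> Idn (two K) f \<in> Arr (two K)"
  "f \<in> Arr (one K) \<Longrightarrow> Dom (two K) (Idn (two K) f) = f"
  "f \<in> Arr (one K) \<Longrightarrow> Cod (two K) (Idn (two K) f) = f"
  by (simp_all add: Obj_two)

lemma globular_simps [simp]:
  "\<alpha> \<in> Arr (two K) \<Longrightarrow> Dom (one K) (Cod (two K) \<alpha>) = Dom (one K) (Dom (two K) \<alpha>)"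
  "\<alpha> \<in> Arr (two K) \<Longrightarrow> Cod (one K) (Cod (two K) \<alpha>) = Cod (one K) (Dom (two K) \<alpha>)"
  using globular by auto

lemma hcmp_simps [simp]:
  assumes "\<alpha> \<in> Arr (two K)" "\<beta> \<in> Arr (two K)"
    "Cod (one K) (Dom (two K) \<alpha>) = Dom (one K) (Dom (two K) \<beta>)"
  shows "hcmp K \<beta> \<alpha> \<in> Arr (two K)"
    "Dom (two K) (hcmp K \<beta> \<alpha>) = Cmp (one K) (Dom (two K) \<beta>) (Dom (two K) \<alpha>)"
    "Cod (two K) (hcmp K \<beta> \<alpha>) = Cmp (one K) (Cod (two K) \<beta>) (Cod (two K) \<alpha>)"
  using hcmp_hom[of \<beta> \<alpha>] assms by (auto simp: hcomposable_def in_homset)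

abbreviation conn :: "'f \<Rightarrow> 'f \<Rightarrow> bool" where
  "conn f g \<equiv> (f, g) \<in> connected_rel (hom_category K (Dom (one K) f) (Cod (one K) f))"

lemma Obj_hom_category: "f \<in> Arr (one K) \<Longrightarrow> f \<in> Obj (hom_category K (Dom (one K) f) (Cod (one K) f))"
  by (simp add: hom_category_def in_homset)

lemma component_of_eq:
  assumes "f \<in> Arr (one K)" "Dom (one K) g = Dom (one K) f" "Cod (one K) g = Cod (one K) f"
  shows "component_of K f = component_of K g \<longleftrightarrow> conn f g"
  unfolding component_of_def using assms
  by (simp add: connected_rel_class_eq[OF Obj_hom_category])

lemma conn_parallel:
  assumes "conn f g"
  shows "f \<in> Arr (one K)" "g \<in> Arr (one K)" "Dom (one K) g = Dom (one K) f" "Cod (one K) g = Cod (one K) f"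
  using connected_rel_Obj[OF assms] by (auto simp: hom_category_def in_homset)

lemma conn_arr: "conn f g \<Longrightarrow> f \<in> Arr (one K)"
  by (rule conn_parallel)

lemma in_component_of: "g \<in> component_of K f \<longleftrightarrow> conn f g"
  by (simp add: component_of_def)

lemma component_of_refl: "f \<in> Arr (one K) \<Longrightarrow> f \<in> component_of K f"
  by (simp add: in_component_of connected_rel_refl Obj_hom_category)

lemma two_cell_conn:
  assumes "\<alpha> \<in> Arr (two K)"
  shows "conn (Dom (two K) \<alpha>) (Cod (two K) \<alpha>)"
  using assms unfolding connected_rel_def hom_category_def by (auto simp: in_homset intro!: r_into_rtrancl)

text \<open>Whiskering a zigzag of 2-cells by a 1-cell on either side shows that composition of 1-cells
  respects connected components.\<close>

lemma conn_Cmp: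
  assumes "conn f f'" "conn g g'" "Cod (one K) f = Dom (one K) g"
  shows "conn (Cmp (one K) g f) (Cmp (one K) g' f')"
proof -
  note f = conn_parallel[OF assms(1)] and g = conn_parallel[OF assms(2)]
  have "(Cmp (one K) g f, Cmp (one K) g f')
      \<in> connected_rel (hom_category K (Dom (one K) f) (Cod (one K) g))"
  proof (rule connected_rel_map[where h = "Cmp (one K) g", OF _ _ assms(1)])
    fix \<alpha> assume "\<alpha> \<in> Arr (hom_category K (Dom (one K) f) (Cod (one K) f))"
    then show "(Cmp (one K) g (Dom (hom_category K (Dom (one K) f) (Cod (one K) f)) \<alpha>),
         Cmp (one K) g (Cod (hom_category K (Dom (one K) f) (Cod (one K) f)) \<alpha>))
        \<in> connected_rel (hom_category K (Dom (one K) f) (Cod (one K) g))"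
      using two_cell_conn[of "hcmp K (Idn (two K) g) \<alpha>"] g assms(3)
      by (auto simp: hom_category_def in_homset)
  qed (use g assms(3) in \<open>auto simp: hom_category_def in_homset\<close>)
  moreover have "(Cmp (one K) g f', Cmp (one K) g' f')
      \<in> connected_rel (hom_category K (Dom (one K) f) (Cod (one K) g))"
  proof (rule connected_rel_map[where h = "\<lambda>g. Cmp (one K) g f'", OF _ _ assms(2)])
    fix \<alpha> assume "\<alpha> \<in> Arr (hom_category K (Dom (one K) g) (Cod (one K) g))"
    then show "(Cmp (one K) (Dom (hom_category K (Dom (one K) g) (Cod (one K) g)) \<alpha>) f',
         Cmp (one K) (Cod (hom_category K (Dom (one K) g) (Cod (one K) g)) \<alpha>) f')
        \<in> connected_rel (hom_category K (Dom (one K) f) (Cod (one K) g))"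
      using two_cell_conn[of "hcmp K \<alpha> (Idn (two K) f')"] f assms(3)
      by (auto simp: hom_category_def in_homset)
  qed (use f assms(3) in \<open>auto simp: hom_category_def in_homset\<close>)
  ultimately have "(Cmp (one K) g f, Cmp (one K) g' f')
      \<in> connected_rel (hom_category K (Dom (one K) f) (Cod (one K) g))"
    by (rule connected_rel_trans)
  then show ?thesis
    using one.Cmp_simps[OF conn_arr[OF assms(1)] conn_arr[OF assms(2)] assms(3)] by (simp only:)
qed

lemma pi0_Obj [simp]: "Obj (pi0 K) = Obj (one K)"
  by (simp add: pi0_def)

lemma pi0_Arr: "Arr (pi0 K) = component_of K ` Arr (one K)"
proof -
  have "components (hom_category K a b) = component_of K ` homset (one K) a b" for a b
    by (auto simp: components_def quotient_def component_of_def hom_category_def in_homset)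
  then have "Arr (pi0 K) = (\<Union>a\<in>Obj (one K). \<Union>b\<in>Obj (one K). component_of K ` homset (one K) a b)"
    by (simp add: pi0_def)
  also have "\<dots> = component_of K ` Arr (one K)"
    by (fastforce simp: in_homset)
  finally show ?thesis .
qed

text \<open>The members of a component are parallel, so the representative picked in the definition of source
  and target does not matter.\<close>

lemma pi0_SOME:
  assumes "f \<in> Arr (one K)"
  shows "conn f (SOME g. g \<in> component_of K f)"
  using someI[of "\<lambda>g. g \<in> component_of K f", OF component_of_refl[OF assms]]
  by (simp add: in_component_of)

lemma pi0_Dom_Cod [simp]:
  assumes "f \<in> Arr (one K)"
  shows "Dom (pi0 K) (component_of K f) = Dom (one K) f" "Cod (pi0 K) (component_of K f) = Cod (one K) f"
  using conn_parallel[OF pi0_SOME[OF assms]] by (simp_all add: pi0_def)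

lemma pi0_Idn: "Idn (pi0 K) x = component_of K (Idn (one K) x)"
  by (simp add: pi0_def)

lemma pi0_Cmp [simp]:
  assumes "f \<in> Arr (one K)" "g \<in> Arr (one K)" "Cod (one K) f = Dom (one K) g"
  shows "Cmp (pi0 K) (component_of K g) (component_of K f) = component_of K (Cmp (one K) g f)"
proof -
  have "component_of K (Cmp (one K) g' f') = component_of K (Cmp (one K) g f)"
    if "conn f f'" "conn g g'" for f' g'
  proof -
    note c = conn_Cmp[OF that assms(3)]
    then show ?thesis using component_of_eq[of "Cmp (one K) g f" "Cmp (one K) g' f'"] conn_parallel[OF c] by simp
  qed
  then have eq: "component_of K (Cmp (one K) g' f') = component_of K (Cmp (one K) g f)"
    if "f' \<in> component_of K f" "g' \<in> component_of K g" for f' g'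
    using that by (simp only: in_component_of)
  have ne: "component_of K f \<noteq> {}" "component_of K g \<noteq> {}"
    using component_of_refl[OF assms(1)] component_of_refl[OF assms(2)] by blast+
  have "(\<Union>g'\<in>component_of K g. \<Union>f'\<in>component_of K f. component_of K (Cmp (one K) g' f'))
      = component_of K (Cmp (one K) g f)"
    by (intro SUP_eq_const ne eq)
  then show ?thesis by (simp add: pi0_def)
qed

lemma category_pi0: "category (pi0 K)"
proof
  fix x assume "x \<in> Obj (pi0 K)"
  then show "Idn (pi0 K) x \<in> homset (pi0 K) x x"
    by (auto simp: pi0_Idn in_homset pi0_Arr)
qed (auto simp: in_homset pi0_Arr pi0_Idn)

lemma conn_imp_eq:
  assumes "\<And>\<alpha>. \<alpha> \<in> Arr (two K) \<Longrightarrow> h (Dom (two K) \<alpha>) = h (Cod (two K) \<alpha>)" "conn f g"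
  shows "h f = h g"
proof -
  let ?A = "hom_category K (Dom (one K) f) (Cod (one K) f)"
  have "(f, g) \<in> ({(Dom ?A \<alpha>, Cod ?A \<alpha>) | \<alpha>. \<alpha> \<in> Arr ?A} \<union> {(Cod ?A \<alpha>, Dom ?A \<alpha>) | \<alpha>. \<alpha> \<in> Arr ?A})\<^sup>*"
    using assms(2) by (simp add: connected_rel_def)
  then show ?thesis
  proof induction
    case (step y z)
    then show ?case using assms(1) by (auto simp: hom_category_def)
  qed simp
qed

text \<open>Parallel 1-cells joined by a single 2-cell generate the relation of lying in one component, so a
  functor that identifies the former identifies the latter.\<close>

lemma pi0_lift:
  assumes "is_functor (one K) X F"
    and inv: "\<And>\<alpha>. \<alpha> \<in> Arr (two K) \<Longrightarrow> far F (Dom (two K) \<alpha>) = far F (Cod (two K) \<alpha>)"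
  obtains G where "is_functor (pi0 K) X G" "\<And>x. x \<in> Obj (one K) \<Longrightarrow> fob G x = fob F x"
    "\<And>f. f \<in> Arr (one K) \<Longrightarrow> far G (component_of K f) = far F f"
proof -
  interpret F: is_functor "one K" X F by fact
  define G where "G = \<lparr>fob = fob F, far = (\<lambda>c\<in>Arr (pi0 K). far F (SOME f. f \<in> c))\<rparr>"
  have far: "far G (component_of K f) = far F f" if "f \<in> Arr (one K)" for f
    using conn_imp_eq[of "far F", OF inv pi0_SOME[OF that], symmetric] that by (simp add: G_def pi0_Arr)
  have fob: "fob G x = fob F x" for x by (simp add: G_def)
  have "is_functor (pi0 K) X G"
  proof (rule is_functorI[OF category_pi0 F.B.category_axioms])
    show "fob G \<in> extensional (Obj (pi0 K))" using F.fob_ext by (simp add: G_def)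
    show "far G \<in> extensional (Arr (pi0 K))" by (simp add: G_def)
    show "far G (Idn (pi0 K) x) = Idn X (fob G x)" if "x \<in> Obj (pi0 K)" for x
      using that by (simp add: pi0_Idn far fob)
    show "fob G x \<in> Obj X" if "x \<in> Obj (pi0 K)" for x
      using that by (simp add: fob)
    show "far G c \<in> Arr X \<and> Dom X (far G c) = fob G (Dom (pi0 K) c) \<and> Cod X (far G c) = fob G (Cod (pi0 K) c)"
      if "c \<in> Arr (pi0 K)" for c
      using that by (auto simp: pi0_Arr far fob)
    show "far G (Cmp (pi0 K) d c) = Cmp X (far G d) (far G c)"
      if "c \<in> Arr (pi0 K)" "d \<in> Arr (pi0 K)" "Cod (pi0 K) c = Dom (pi0 K) d" for c d
      using that by (auto simp: pi0_Arr far)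
  qed
  then show thesis using that[of G] far fob by blast
qed

end

section \<open>Categories of fractions\<close>

locale fraction_data = category A for A :: "('o, 'a) cat" +
  fixes S :: "'a set"
  assumes S_Arr: "S \<subseteq> Arr A"
begin

abbreviation "Fr \<equiv> fractions A S"

lemma S_simp [simp]: "s \<in> S \<Longrightarrow> s \<in> Arr A"
  using S_Arr by auto

lemma zigzag_Obj: "zigzag A S x p y \<Longrightarrow> x \<in> Obj A \<and> y \<in> Obj A"
  by (induction rule: zigzag.induct) auto

lemma zigzag_append: "zigzag A S x p y \<Longrightarrow> zigzag A S y q z \<Longrightarrow> zigzag A S x (p @ q) z"
  by (induction rule: zigzag.induct) (auto intro: zigzag.intros)

lemma zigzag_letters:
  "f \<in> Arr A \<Longrightarrow> zigzag A S (Dom A f) [Fwd f] (Cod A f)"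
  "s \<in> S \<Longrightarrow> zigzag A S (Cod A s) [Bwd s] (Dom A s)"
  by (auto intro!: zigzag.intros)

lemma zz_eq_zigzag: "zz_eq A S x y p q \<Longrightarrow> zigzag A S x p y \<and> zigzag A S x q y"
proof (induction rule: zz_eq.induct)
  case (eq_Idn x)
  then show ?case using zigzag_letters(1)[of "Idn A x"] by (auto intro: zz_nil)
next
  case (eq_Cmp f x y g z)
  then show ?case
    using zigzag_letters(1)[of "Cmp A g f"] zigzag_append[of x "[Fwd f]" y "[Fwd g]"]
      zigzag_letters(1)[of f] zigzag_letters(1)[of g] by (auto simp: in_homset)
next
  case (eq_inv_right s)
  then show ?case
    using zigzag_append[OF zigzag_letters(1) zigzag_letters(2), of s] by (auto intro: zz_nil)
next
  case (eq_inv_left s)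
  then show ?case
    using zigzag_append[OF zigzag_letters(2) zigzag_letters(1), of s] by (auto intro: zz_nil)
qed (auto intro: zigzag_append)

lemma zz_class_eq_iff:
  assumes "zigzag A S x p y"
  shows "zz_class A S x p y = zz_class A S x q y \<longleftrightarrow> zz_eq A S x y p q"
proof
  assume "zz_class A S x p y = zz_class A S x q y"
  then have "zz_eq A S x y q p" using eq_refl[OF assms] by (auto simp: zz_class_def)
  then show "zz_eq A S x y p q" by (rule eq_sym)
qed (auto simp: zz_class_def intro: eq_sym eq_trans)

lemma fractions_Obj [simp]: "Obj Fr = Obj A"
  by (simp add: fractions_def)

lemma fractions_Arr: "a \<in> Arr Fr \<longleftrightarrow> (\<exists>x p y. zigzag A S x p y \<and> a = zz_class A S x p y)"
  by (auto simp: fractions_def)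

lemma zz_class_simps [simp]:
  "zigzag A S x p y \<Longrightarrow> zz_class A S x p y \<in> Arr Fr"
  "Dom Fr (zz_class A S x p y) = x" "Cod Fr (zz_class A S x p y) = y"
  by (auto simp: fractions_Arr) (simp_all add: fractions_def zz_class_def)

lemma fractions_Idn: "Idn Fr x = zz_class A S x [] x"
  by (simp add: fractions_def)

lemma fractions_Cmp:
  assumes "zigzag A S x p y" "zigzag A S y q z"
  shows "Cmp Fr (zz_class A S y q z) (zz_class A S x p y) = zz_class A S x (p @ q) z"
proof -
  have "(\<Union>p'\<in>{r. zz_eq A S x y p r}. \<Union>q'\<in>{r. zz_eq A S y z q r}. {r. zz_eq A S x z (p' @ q') r})
      = {r. zz_eq A S x z (p @ q) r}" (is "?L = ?R")
  proof
    show "?L \<subseteq> ?R" by (auto intro: eq_trans eq_append)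
    show "?R \<subseteq> ?L" using eq_refl[OF assms(1)] eq_refl[OF assms(2)] by blast
  qed
  then show ?thesis by (simp add: fractions_def zz_class_def)
qed

lemma category_fractions: "category Fr"
proof
  fix f g h w x y z
  assume f: "f \<in> homset Fr w x" "g \<in> homset Fr x y" "h \<in> homset Fr y z"
  then obtain p q r where "zigzag A S w p x" "f = zz_class A S w p x"
    "zigzag A S x q y" "g = zz_class A S x q y" "zigzag A S y r z" "h = zz_class A S y r z"
    by (auto simp: in_homset fractions_Arr)
  then show "Cmp Fr h (Cmp Fr g f) = Cmp Fr (Cmp Fr h g) f"
    by (simp add: fractions_Cmp zigzag_append)
next
  fix f g x y z
  assume f: "f \<in> homset Fr x y"
  then obtain p where p: "zigzag A S x p y" "f = zz_class A S x p y"
    by (auto simp: in_homset fractions_Arr)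
  then have nil: "zigzag A S x [] x" "zigzag A S y [] y" using zigzag_Obj by (auto intro: zz_nil)
  show "Cmp Fr f (Idn Fr x) = f" "Cmp Fr (Idn Fr y) f = f"
    using p nil by (simp_all add: fractions_Idn fractions_Cmp)
  assume "g \<in> homset Fr y z"
  then obtain q where "zigzag A S y q z" "g = zz_class A S y q z"
    by (auto simp: in_homset fractions_Arr)
  then show "Cmp Fr g f \<in> homset Fr x z" using p
    by (auto simp: in_homset fractions_Cmp intro!: zz_class_simps zigzag_append)
qed (auto simp: fractions_Arr in_homset fractions_Idn zigzag_Obj intro: zz_nil)

sublocale Fr: category Fr by (rule category_fractions)

lemma fractions_arr_simps [simp]:
  assumes "f \<in> Arr A"
  shows "fractions_arr A S f \<in> Arr Fr"
    "Dom Fr (fractions_arr A S f) = Dom A f" "Cod Fr (fractions_arr A S f) = Cod A f"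
  using zigzag_letters(1)[OF assms] by (auto simp: fractions_arr_def)

lemma fractions_arr_Idn: "x \<in> Obj A \<Longrightarrow> fractions_arr A S (Idn A x) = Idn Fr x"
  using zigzag_letters(1)[of "Idn A x"]
  by (simp add: fractions_arr_def fractions_Idn zz_class_eq_iff eq_Idn)

lemma fractions_arr_Cmp:
  assumes "f \<in> Arr A" "g \<in> Arr A" "Cod A f = Dom A g"
  shows "fractions_arr A S (Cmp A g f) = Cmp Fr (fractions_arr A S g) (fractions_arr A S f)"
proof -
  have "zz_eq A S (Dom A f) (Cod A g) [Fwd (Cmp A g f)] [Fwd f, Fwd g]"
    by (rule eq_sym, rule eq_Cmp[where y = "Cod A f"]) (use assms in \<open>auto simp: in_homset\<close>)
  then show ?thesis
    using zigzag_letters(1)[of f] zigzag_letters(1)[of g] zigzag_letters(1)[of "Cmp A g f"] assms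
    by (simp add: fractions_arr_def fractions_Cmp zz_class_eq_iff)
qed

lemma inverse_arrows_Bwd:
  assumes "s \<in> S"
  shows "inverse_arrows Fr (fractions_arr A S s) (zz_class A S (Cod A s) [Bwd s] (Dom A s))"
  using assms zigzag_letters(1)[of s] zigzag_letters(2)[OF assms]
    zigzag_append[OF zigzag_letters(1) zigzag_letters(2), of s]
    zigzag_append[OF zigzag_letters(2) zigzag_letters(1), of s]
  by (intro Fr.inverse_arrowsI)
    (auto simp: fractions_arr_def fractions_Cmp fractions_Idn zz_class_eq_iff intro: eq_inv_right eq_inv_left)

lemma iso_arr_fractions_arr: "s \<in> S \<Longrightarrow> iso_arr Fr (fractions_arr A S s)"
  unfolding iso_arr_def using inverse_arrows_Bwd by blast

text \<open>Zigzags are consumed from the source end, so the induction precomposes with one letter at a time.\<close>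

lemma fractions_induct [consumes 1, case_names Idn Fwd Bwd]:
  assumes "a \<in> Arr Fr"
    and Idn: "\<And>x. x \<in> Obj A \<Longrightarrow> P (Idn Fr x)"
    and Fwd: "\<And>f a. f \<in> Arr A \<Longrightarrow> a \<in> Arr Fr \<Longrightarrow> Dom Fr a = Cod A f \<Longrightarrow> P a
      \<Longrightarrow> P (Cmp Fr a (fractions_arr A S f))"
    and Bwd: "\<And>s a. s \<in> S \<Longrightarrow> a \<in> Arr Fr \<Longrightarrow> Dom Fr a = Dom A s \<Longrightarrow> P a
      \<Longrightarrow> P (Cmp Fr a (inv_arr Fr (fractions_arr A S s)))"
  shows "P a"
proof -
  obtain x p y where zz: "zigzag A S x p y" and a: "a = zz_class A S x p y"
    using assms(1) by (auto simp: fractions_Arr)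
  from zz have "P (zz_class A S x p y)"
  proof (induction rule: zigzag.induct)
    case (zz_nil x)
    then show ?case using Idn by (simp add: fractions_Idn)
  next
    case (zz_fwd f p y)
    then have "zz_class A S (Dom A f) (Fwd f # p) y = Cmp Fr (zz_class A S (Cod A f) p y) (fractions_arr A S f)"
      using fractions_Cmp[OF zigzag_letters(1)] by (simp add: fractions_arr_def)
    then show ?case using Fwd zz_fwd by simp
  next
    case (zz_bwd s p y)
    then have "zz_class A S (Cod A s) (Bwd s # p) y
        = Cmp Fr (zz_class A S (Dom A s) p y) (inv_arr Fr (fractions_arr A S s))"
      using fractions_Cmp[OF zigzag_letters(2)] Fr.inv_arr_eq[OF inverse_arrows_Bwd] by simp
    then show ?case using Bwd zz_bwd by simp
  qed
  then show ?thesis by (simp add: a)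
qed

end

locale fraction_lift = fraction_data A S + F: is_functor A X F
  for A :: "('o, 'a) cat" and S :: "'a set" and X :: "('x, 'y) cat" and F :: "('o, 'a, 'x, 'y) ftor" +
  assumes inverted: "s \<in> S \<Longrightarrow> iso_arr X (far F s)"
begin

primrec zz_eval :: "'o \<Rightarrow> 'a letter list \<Rightarrow> 'y" where
  "zz_eval x [] = Idn X (fob F x)"
| "zz_eval x (l # p) = (case l of
     Fwd f \<Rightarrow> Cmp X (zz_eval (Cod A f) p) (far F f)
   | Bwd s \<Rightarrow> Cmp X (zz_eval (Dom A s) p) (inv_arr X (far F s)))"

lemma zz_eval_hom:
  "zigzag A S x p y \<Longrightarrow> zz_eval x p \<in> Arr X \<and> Dom X (zz_eval x p) = fob F x \<and> Cod X (zz_eval x p) = fob F y"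
  by (induction rule: zigzag.induct) (auto simp: inverted)

lemma zz_eval_append:
  "zigzag A S x p y \<Longrightarrow> zigzag A S y q z \<Longrightarrow> zz_eval x (p @ q) = Cmp X (zz_eval y q) (zz_eval x p)"
  by (induction rule: zigzag.induct) (auto simp: inverted zz_eval_hom)

text \<open>The relations that generate the congruence on zigzags hold between the values of any functor that
  inverts \<open>S\<close>.\<close>

lemma zz_eval_cong: "zz_eq A S x y p q \<Longrightarrow> zz_eval x p = zz_eval x q"
proof (induction rule: zz_eq.induct)
  case (eq_append x y p p' z q q')
  then show ?case using zz_eq_zigzag zz_eval_append by metis
qed (auto simp: in_homset inverted)

text \<open>By the previous lemma it does not matter which zigzag is picked from a class.\<close>

definition fr_lift where
  "fr_lift = \<lparr>fob = fob F, far = (\<lambda>a\<in>Arr Fr. zz_eval (Dom Fr a) (SOME p. p \<in> fst (snd a)))\<rparr>"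

lemma fr_lift_class:
  assumes "zigzag A S x p y"
  shows "far fr_lift (zz_class A S x p y) = zz_eval x p"
proof -
  have "p \<in> {r. zz_eq A S x y p r}" using eq_refl[OF assms] by simp
  then have "zz_eq A S x y p (SOME r. r \<in> {r. zz_eq A S x y p r})"
    using someI[of "\<lambda>r. r \<in> {r. zz_eq A S x y p r}"] by blast
  then have "zz_eval x (SOME r. r \<in> {r. zz_eq A S x y p r}) = zz_eval x p"
    using zz_eval_cong by metis
  moreover have "fst (snd (zz_class A S x p y)) = {r. zz_eq A S x y p r}"
    by (simp add: zz_class_def)
  ultimately show ?thesis using assms by (simp add: fr_lift_def)
qed

lemma fr_lift_fob [simp]: "fob fr_lift x = fob F x"
  by (simp add: fr_lift_def)

lemma fr_lift_fractions_arr: "f \<in> Arr A \<Longrightarrow> far fr_lift (fractions_arr A S f) = far F f"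
  using fr_lift_class[OF zigzag_letters(1)] by (simp add: fractions_arr_def)

lemma fr_lift_functor: "is_functor Fr X fr_lift"
proof (rule is_functorI[OF category_fractions F.B.category_axioms])
  show "fob fr_lift \<in> extensional (Obj Fr)" using F.fob_ext by (simp add: fr_lift_def)
  show "far fr_lift \<in> extensional (Arr Fr)" by (simp add: fr_lift_def)
  show "far fr_lift (Idn Fr x) = Idn X (fob fr_lift x)" if "x \<in> Obj Fr" for x
    using that fr_lift_class[OF zz_nil] by (simp add: fractions_Idn)
  show "far fr_lift (Cmp Fr g f) = Cmp X (far fr_lift g) (far fr_lift f)"
    if f: "f \<in> Arr Fr" "g \<in> Arr Fr" "Cod Fr f = Dom Fr g" for f g
  proof -
    obtain x p y q z where "zigzag A S x p y" "f = zz_class A S x p y"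
      "zigzag A S y q z" "g = zz_class A S y q z"
      using f unfolding fractions_Arr by (metis zz_class_simps(2,3))
    then show ?thesis by (simp add: fractions_Cmp fr_lift_class zigzag_append zz_eval_append)
  qed
qed (auto simp: fractions_Arr fr_lift_class zz_eval_hom)

end

section \<open>Pseudo-functors, componentwise\<close>

context category
begin

lemma inv_arr_Cmp:
  assumes "iso_arr A f" "iso_arr A g" "Cod A f = Dom A g"
  shows "inv_arr A (Cmp A g f) = Cmp A (inv_arr A f) (inv_arr A g)"
  using assms iso_arr_Arr[OF assms(1)] iso_arr_Arr[OF assms(2)]
  by (intro inv_arr_eq inverse_arrowsI) auto

lemma inv_arr_square:
  assumes "Cmp A b i = Cmp A j a" "iso_arr A i" "iso_arr A j" "a \<in> Arr A" "b \<in> Arr A"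
    "Dom A b = Cod A i" "Cod A a = Dom A j" "Dom A a = Dom A i" "Cod A b = Cod A j"
  shows "Cmp A (inv_arr A j) b = Cmp A a (inv_arr A i)"
proof -
  note [simp] = assms(2-) assms(2,3)[THEN iso_arr_Arr]
  have "Cmp A (inv_arr A j) b = Cmp A (inv_arr A j) (Cmp A (Cmp A b i) (inv_arr A i))"
    by simp
  also have "\<dots> = Cmp A a (inv_arr A i)"
    unfolding assms(1) by simp
  finally show ?thesis .
qed

end

lemma op_cat_simps [simp]:
  "Obj (op_cat A) = Obj A" "Arr (op_cat A) = Arr A" "Dom (op_cat A) = Cod A" "Cod (op_cat A) = Dom A"
  "Idn (op_cat A) = Idn A" "Cmp (op_cat A) g f = Cmp A f g"
  by (simp_all add: op_cat_def)

lemma homset_op_cat [simp]: "homset (op_cat A) x y = homset A y x"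
  by (auto simp: in_homset)

lemma op2_simps [simp]:
  "one (op2 K) = op_cat (one K)" "two (op2 K) = two K" "hcmp (op2 K) \<beta> \<alpha> = hcmp K \<alpha> \<beta>"
  by (simp_all add: op2_def)

text \<open>The axioms of a pseudo-functor equate natural transformations. Their components at an object are
  equations between arrows of a single category, which is the form in which \<open>\<Delta>(E, W)\<close> needs them.\<close>

context pseudofunctor
begin

lemma fob_pone_Idn [simp]: "a \<in> Obj (one K) \<Longrightarrow> x \<in> Obj (pob P a) \<Longrightarrow> fob (pone P (Idn (one K) a)) x = x"
  and far_pone_Idn [simp]: "a \<in> Obj (one K) \<Longrightarrow> u \<in> Arr (pob P a) \<Longrightarrow> far (pone P (Idn (one K) a)) u = u"
  by (simp_all add: normalized)

lemma ptwo_component: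
  assumes \<alpha>: "\<alpha> \<in> homset (two K) f g" and f: "f \<in> homset (one K) a b" and x: "x \<in> Obj (pob P a)"
  shows "ncmp (ptwo P \<alpha>) x \<in> Arr (pob P b)"
    "Dom (pob P b) (ncmp (ptwo P \<alpha>) x) = fob (pone P f) x"
    "Cod (pob P b) (ncmp (ptwo P \<alpha>) x) = fob (pone P g) x"
proof -
  interpret is_ntrans "pob P a" "pob P b" "ptwo P \<alpha>"
    using ptwo_hom[OF \<alpha> f] by (simp add: in_homset)
  show "ncmp (ptwo P \<alpha>) x \<in> Arr (pob P b)"
    "Dom (pob P b) (ncmp (ptwo P \<alpha>) x) = fob (pone P f) x"
    "Cod (pob P b) (ncmp (ptwo P \<alpha>) x) = fob (pone P g) x"
    using ptwo_hom[OF \<alpha> f] x by (simp_all add: in_homset)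
qed

lemma ptwo_naturality:
  assumes \<alpha>: "\<alpha> \<in> homset (two K) f g" and f: "f \<in> homset (one K) a b" and u: "u \<in> homset (pob P a) x y"
  shows "Cmp (pob P b) (ncmp (ptwo P \<alpha>) y) (far (pone P f) u)
    = Cmp (pob P b) (far (pone P g) u) (ncmp (ptwo P \<alpha>) x)"
proof -
  interpret is_ntrans "pob P a" "pob P b" "ptwo P \<alpha>"
    using ptwo_hom[OF \<alpha> f] by (simp add: in_homset)
  show ?thesis
    using ptwo_hom[OF \<alpha> f] natural[OF u] by (simp_all add: in_homset)
qed

lemma ptwo_Idn_component:
  "f \<in> homset (one K) a b \<Longrightarrow> x \<in> Obj (pob P a)
    \<Longrightarrow> ncmp (ptwo P (Idn (two K) f)) x = Idn (pob P b) (fob (pone P f) x)"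
  by (simp add: ptwo_Idn)

lemma ptwo_Cmp_component:
  "\<alpha> \<in> homset (two K) f g \<Longrightarrow> \<beta> \<in> homset (two K) g h \<Longrightarrow> f \<in> homset (one K) a b \<Longrightarrow> x \<in> Obj (pob P a)
    \<Longrightarrow> ncmp (ptwo P (Cmp (two K) \<beta> \<alpha>)) x = Cmp (pob P b) (ncmp (ptwo P \<beta>) x) (ncmp (ptwo P \<alpha>) x)"
  by (simp add: ptwo_Cmp)

lemma pcmp_component:
  assumes f: "f \<in> homset (one K) a b" and g: "g \<in> homset (one K) b c" and x: "x \<in> Obj (pob P a)"
  shows "ncmp (pcmp P g f) x \<in> Arr (pob P c)"
    "Dom (pob P c) (ncmp (pcmp P g f) x) = fob (pone P g) (fob (pone P f) x)"
    "Cod (pob P c) (ncmp (pcmp P g f) x) = fob (pone P (Cmp (one K) g f)) x"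
    "iso_arr (pob P c) (ncmp (pcmp P g f) x)"
proof -
  interpret is_ntrans "pob P a" "pob P c" "pcmp P g f"
    using pcmp_hom[OF f g] by (simp add: in_homset)
  show "ncmp (pcmp P g f) x \<in> Arr (pob P c)"
    "Dom (pob P c) (ncmp (pcmp P g f) x) = fob (pone P g) (fob (pone P f) x)"
    "Cod (pob P c) (ncmp (pcmp P g f) x) = fob (pone P (Cmp (one K) g f)) x"
    "iso_arr (pob P c) (ncmp (pcmp P g f) x)"
    using pcmp_hom[OF f g] iso_arr_ncmp[OF pcmp_iso[OF f g] x] x by (simp_all add: in_homset)
qed

lemma pcmp_naturality:
  assumes f: "f \<in> homset (one K) a b" and g: "g \<in> homset (one K) b c" and u: "u \<in> homset (pob P a) x y"
  shows "Cmp (pob P c) (ncmp (pcmp P g f) y) (far (pone P g) (far (pone P f) u))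
    = Cmp (pob P c) (far (pone P (Cmp (one K) g f)) u) (ncmp (pcmp P g f) x)"
proof -
  interpret is_ntrans "pob P a" "pob P c" "pcmp P g f"
    using pcmp_hom[OF f g] by (simp add: in_homset)
  show ?thesis using pcmp_hom[OF f g] natural[OF u] u by (simp add: in_homset)
qed

lemma pcmp_two_naturality:
  assumes "f \<in> homset (one K) a b" "g \<in> homset (one K) b c"
    "\<alpha> \<in> homset (two K) f f'" "\<beta> \<in> homset (two K) g g'" "x \<in> Obj (pob P a)"
  shows "Cmp (pob P c) (ncmp (pcmp P g' f') x)
      (Cmp (pob P c) (ncmp (ptwo P \<beta>) (fob (pone P f') x)) (far (pone P g) (ncmp (ptwo P \<alpha>) x)))
    = Cmp (pob P c) (ncmp (ptwo P (hcmp K \<beta> \<alpha>)) x) (ncmp (pcmp P g f) x)"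
proof -
  have "ntgt (ptwo P \<alpha>) = pone P f'" "nsrc (ptwo P \<beta>) = pone P g"
    using ptwo_hom[OF assms(3,1)] ptwo_hom[OF assms(4,2)] by (auto simp: in_homset)
  then show ?thesis
    using pcmp_natural[OF assms(1-4), THEN arg_cong[where f = "\<lambda>\<tau>. ncmp \<tau> x"]] assms(5)
    by (simp add: hcomp_ntrans_def)
qed

lemma pcmp_assoc_component:
  assumes "f \<in> homset (one K) a b" "g \<in> homset (one K) b c" "h \<in> homset (one K) c d" "x \<in> Obj (pob P a)"
  shows "Cmp (pob P d) (ncmp (pcmp P h (Cmp (one K) g f)) x) (far (pone P h) (ncmp (pcmp P g f) x))
    = Cmp (pob P d) (ncmp (pcmp P (Cmp (one K) h g) f) x) (ncmp (pcmp P h g) (fob (pone P f) x))"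
  using pcmp_assoc[OF assms(1-3), THEN arg_cong[where f = "\<lambda>\<tau>. ncmp \<tau> x"]] assms(4) by simp

lemma pcmp_unit_right_component:
  "f \<in> homset (one K) a b \<Longrightarrow> x \<in> Obj (pob P a)
    \<Longrightarrow> ncmp (pcmp P f (Idn (one K) a)) x = Idn (pob P b) (fob (pone P f) x)"
  by (simp add: pcmp_unit_right)

lemma pcmp_unit_left_component:
  "f \<in> homset (one K) a b \<Longrightarrow> x \<in> Obj (pob P a)
    \<Longrightarrow> ncmp (pcmp P (Idn (one K) b) f) x = Idn (pob P b) (fob (pone P f) x)"
  by (simp add: pcmp_unit_left)

lemma Cmp_one_homset:
  "f \<in> homset (one K) a b \<Longrightarrow> g \<in> homset (one K) b c \<Longrightarrow> Cmp (one K) g f \<in> homset (one K) a c"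
  by (simp add: in_homset)

text \<open>Composition in \<open>\<Delta>(E, W)\<close> uses the inverses of the coherence cells of \<open>E\<close>, so naturality and
  associativity are needed for these as well.\<close>

lemma inv_pcmp_naturality:
  assumes f: "f \<in> homset (one K) a b" and g: "g \<in> homset (one K) b c" and u: "u \<in> homset (pob P a) x y"
  shows "Cmp (pob P c) (inv_arr (pob P c) (ncmp (pcmp P g f) y)) (far (pone P (Cmp (one K) g f)) u)
    = Cmp (pob P c) (far (pone P g) (far (pone P f) u)) (inv_arr (pob P c) (ncmp (pcmp P g f) x))"
proof -
  interpret f: is_functor "pob P a" "pob P b" "pone P f" by (rule pone_functor[OF f])
  interpret g: is_functor "pob P b" "pob P c" "pone P g" by (rule pone_functor[OF g])
  interpret gf: is_functor "pob P a" "pob P c" "pone P (Cmp (one K) g f)"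
    by (rule pone_functor[OF Cmp_one_homset[OF f g]])
  have u': "u \<in> Arr (pob P a)" "Dom (pob P a) u = x" "Cod (pob P a) u = y" using u by (auto simp: in_homset)
  then have xy: "x \<in> Obj (pob P a)" "y \<in> Obj (pob P a)" by auto
  note [simp] = u' xy pcmp_component[OF f g xy(1)] pcmp_component[OF f g xy(2)]
  show ?thesis
    by (rule g.B.inv_arr_square[OF pcmp_naturality[OF f g u, symmetric]]) simp_all
qed

lemma inv_pcmp_assoc:
  assumes f: "f \<in> homset (one K) a b" and g: "g \<in> homset (one K) b c" and h: "h \<in> homset (one K) c d"
    and x: "x \<in> Obj (pob P a)"
  shows "Cmp (pob P d) (inv_arr (pob P d) (ncmp (pcmp P h g) (fob (pone P f) x)))
      (inv_arr (pob P d) (ncmp (pcmp P (Cmp (one K) h g) f) x))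
    = Cmp (pob P d) (far (pone P h) (inv_arr (pob P c) (ncmp (pcmp P g f) x)))
      (inv_arr (pob P d) (ncmp (pcmp P h (Cmp (one K) g f)) x))"
proof -
  interpret f: is_functor "pob P a" "pob P b" "pone P f" by (rule pone_functor[OF f])
  interpret h: is_functor "pob P c" "pob P d" "pone P h" by (rule pone_functor[OF h])
  note gf = Cmp_one_homset[OF f g] and hg = Cmp_one_homset[OF g h]
  have x': "fob (pone P f) x \<in> Obj (pob P b)" using x by simp
  note [simp] = pcmp_component[OF f g x] pcmp_component[OF f hg x] pcmp_component[OF gf h x]
    pcmp_component[OF g h x']
  have "Cmp (one K) h (Cmp (one K) g f) = Cmp (one K) (Cmp (one K) h g) f"
    using one.Cmp_assoc[OF f g h] .
  then show ?thesis
    using pcmp_assoc_component[OF f g h x, THEN arg_cong[where f = "inv_arr (pob P d)"]]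
    by (simp add: h.B.inv_arr_Cmp h.far_inv_arr)
qed

end

section \<open>The 2-category \<open>\<Delta>(E, W)\<close>\<close>

locale weighted_pair = two_category K + E: pseudofunctor K E + W: pseudofunctor "op2 K" W
  for K :: "('c, 'f, 't) twocat"
    and E :: "('c, 'f, 't, 'o, 'a) pftor" and W :: "('c, 'f, 't, 'p, 'b) pftor"
begin

text \<open>A 1-cell \<open>f : C \<rightarrow> D\<close> of \<open>K\<close> is a 1-cell \<open>D \<rightarrow> C\<close> of \<open>op2 K\<close>. The facts on \<open>W\<close> are restated with 1-cells
  directed as in \<open>K\<close>; the first argument of \<open>pcmp W\<close> is the 1-cell that comes first in \<open>K\<close>.\<close>

lemmas op_unfold = op2_simps op_cat_simps homset_op_cat

lemmas W_category = W.pob_category[unfolded op_unfold]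
lemmas W_pone_functor = W.pone_functor[unfolded op_unfold]
lemmas W_pone_Idn = W.fob_pone_Idn[unfolded op_unfold] W.far_pone_Idn[unfolded op_unfold]
lemmas W_ptwo_component = W.ptwo_component[unfolded op_unfold]
lemmas W_ptwo_naturality = W.ptwo_naturality[unfolded op_unfold]
lemmas W_ptwo_Idn = W.ptwo_Idn_component[unfolded op_unfold]
lemmas W_ptwo_Cmp = W.ptwo_Cmp_component[unfolded op_unfold]
lemmas W_pcmp_component = W.pcmp_component[unfolded op_unfold]
lemmas W_pcmp_naturality = W.pcmp_naturality[unfolded op_unfold]
lemmas W_pcmp_two_naturality = W.pcmp_two_naturality[unfolded op_unfold]
lemmas W_pcmp_assoc = W.pcmp_assoc_component[unfolded op_unfold]
lemmas W_pcmp_unit_right = W.pcmp_unit_right_component[unfolded op_unfold]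
lemmas W_pcmp_unit_left = W.pcmp_unit_left_component[unfolded op_unfold]

declare W_pone_Idn [simp]

end

text \<open>Interpreting this locale for a 1-cell makes the rules for the functors \<open>f\<^sub>!\<close> and \<open>f\<^sup>*\<close> available to the
  simplifier.\<close>

locale one_cell = weighted_pair K E W
  for K :: "('c, 'f, 't) twocat"
    and E :: "('c, 'f, 't, 'o, 'a) pftor" and W :: "('c, 'f, 't, 'p, 'b) pftor" +
  fixes f :: 'f and C D :: 'c
  assumes cell: "f \<in> homset (one K) C D"
begin

lemma cell_simps [simp]:
  "f \<in> Arr (one K)" "Dom (one K) f = C" "Cod (one K) f = D" "C \<in> Obj (one K)" "D \<in> Obj (one K)"
  using cell by (auto simp: in_homset)

sublocale Ef: is_functor "pob E C" "pob E D" "pone E f" by (rule E.pone_functor[OF cell])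
sublocale Wf: is_functor "pob W D" "pob W C" "pone W f" by (rule W_pone_functor[OF cell])

end

context weighted_pair
begin

lemma one_cellI: "f \<in> homset (one K) C D \<Longrightarrow> one_cell K E W f C D"
  by unfold_locales

abbreviation "D1 \<equiv> Delta_one K E W"

lemma Delta_one_Obj:
  "(C, X, Y) \<in> Obj D1 \<longleftrightarrow> C \<in> Obj (one K) \<and> X \<in> Obj (pob E C) \<and> Y \<in> Obj (pob W C)"
  by (simp add: Delta_one_def)

lemma Delta_one_Arr:
  "((C, X, Y), (f, u, v), (D, A, B)) \<in> Arr D1 \<longleftrightarrow> (C, X, Y) \<in> Obj D1 \<and> (D, A, B) \<in> Obj D1
     \<and> f \<in> homset (one K) C D \<and> u \<in> homset (pob E D) (fob (pone E f) X) A
     \<and> v \<in> homset (pob W C) Y (fob (pone W f) B)"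
  by (simp add: Delta_one_def)

lemma Delta_one_cases:
  assumes "a \<in> Arr D1"
  obtains C X Y f u v D A B where "a = ((C, X, Y), (f, u, v), (D, A, B))"
    "(C, X, Y) \<in> Obj D1" "(D, A, B) \<in> Obj D1" "f \<in> homset (one K) C D"
    "u \<in> homset (pob E D) (fob (pone E f) X) A" "v \<in> homset (pob W C) Y (fob (pone W f) B)"
  using assms unfolding Delta_one_def by auto

lemma Delta_one_simps [simp]:
  "Dom D1 (s, m, t) = s" "Cod D1 (s, m, t) = t"
  "Idn D1 (C, X, Y) = ((C, X, Y), (Idn (one K) C, Idn (pob E C) X, Idn (pob W C) Y), (C, X, Y))"
  "Cmp D1 (r, (g, x, y), (D', A', B')) ((C, X, Y), (f, u, v), s) =
    ((C, X, Y),
      (Cmp (one K) g f,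
       Cmp (pob E D') x (Cmp (pob E D') (far (pone E g) u) (inv_arr (pob E D') (ncmp (pcmp E g f) X))),
       Cmp (pob W C) (ncmp (pcmp W f g) B') (Cmp (pob W C) (far (pone W f) y) v)),
      (D', A', B'))"
  by (simp_all add: Delta_one_def)

lemma Delta_one_Cmp_Arr:
  assumes a: "((C, X, Y), (f, u, v), (D, A, B)) \<in> Arr D1"
    and b: "((D, A, B), (g, x, y), (D', A', B')) \<in> Arr D1"
  shows "Cmp D1 ((D, A, B), (g, x, y), (D', A', B')) ((C, X, Y), (f, u, v), (D, A, B)) \<in> Arr D1"
proof -
  have f: "f \<in> homset (one K) C D" and g: "g \<in> homset (one K) D D'"
    and X: "X \<in> Obj (pob E C)" and B': "B' \<in> Obj (pob W D')"
    using a b by (auto simp: Delta_one_Arr Delta_one_Obj)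
  interpret f: one_cell K E W f C D by (rule one_cellI[OF f])
  interpret g: one_cell K E W g D D' by (rule one_cellI[OF g])
  note [simp] = E.pcmp_component[OF f g X] W_pcmp_component[OF g f B']
  show ?thesis
    using a b E.Cmp_one_homset[OF f g] by (simp add: Delta_one_Arr Delta_one_Obj in_homset)
qed

lemma Delta_one_Idn_Arr: "(C, X, Y) \<in> Obj D1 \<Longrightarrow> Idn D1 (C, X, Y) \<in> Arr D1"
  using E.pob_category[of C] W_category[of C]
  by (auto simp: Delta_one_Arr Delta_one_Obj in_homset category.Idn_simps)

lemma Delta_one_Idn:
  assumes a: "((C, X, Y), (f, u, v), (D, A, B)) \<in> Arr D1"
  shows "Cmp D1 ((C, X, Y), (f, u, v), (D, A, B)) (Idn D1 (C, X, Y)) = ((C, X, Y), (f, u, v), (D, A, B))"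
    "Cmp D1 (Idn D1 (D, A, B)) ((C, X, Y), (f, u, v), (D, A, B)) = ((C, X, Y), (f, u, v), (D, A, B))"
proof -
  have f: "f \<in> homset (one K) C D" and X: "X \<in> Obj (pob E C)" and B: "B \<in> Obj (pob W D)"
    using a by (auto simp: Delta_one_Arr Delta_one_Obj)
  interpret f: one_cell K E W f C D by (rule one_cellI[OF f])
  note [simp] = E.pcmp_unit_right_component[OF f X] W_pcmp_unit_right[OF f B]
    E.pcmp_unit_left_component[OF f X] W_pcmp_unit_left[OF f B]
  show "Cmp D1 ((C, X, Y), (f, u, v), (D, A, B)) (Idn D1 (C, X, Y)) = ((C, X, Y), (f, u, v), (D, A, B))"
    "Cmp D1 (Idn D1 (D, A, B)) ((C, X, Y), (f, u, v), (D, A, B)) = ((C, X, Y), (f, u, v), (D, A, B))"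
    using a f by (simp_all add: Delta_one_Arr Delta_one_Obj in_homset)
qed

text \<open>The \<open>E\<close>-part of the equation moves \<open>u\<close> past the inverse coherence cell at \<open>h\<close>, \<open>g\<close> by naturality and
  then uses associativity of the inverse coherence cells; the \<open>W\<close>-part is dual, with the coherence
  cells of \<open>W\<close> themselves.\<close>

lemma Delta_one_assoc:
  assumes a: "((C, X, Y), (f, u, v), (D, A, B)) \<in> Arr D1"
    and b: "((D, A, B), (g, x, y), (D', A', B')) \<in> Arr D1"
    and c: "((D', A', B'), (h, r, s), (D2, A2, B2)) \<in> Arr D1"
  shows "Cmp D1 ((D', A', B'), (h, r, s), (D2, A2, B2))
      (Cmp D1 ((D, A, B), (g, x, y), (D', A', B')) ((C, X, Y), (f, u, v), (D, A, B)))
    = Cmp D1 (Cmp D1 ((D', A', B'), (h, r, s), (D2, A2, B2)) ((D, A, B), (g, x, y), (D', A', B')))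
      ((C, X, Y), (f, u, v), (D, A, B))"
proof -
  have f: "f \<in> homset (one K) C D" and g: "g \<in> homset (one K) D D'" and h: "h \<in> homset (one K) D' D2"
    and X: "X \<in> Obj (pob E C)" and A: "A \<in> Obj (pob E D)"
    and B': "B' \<in> Obj (pob W D')" and B2: "B2 \<in> Obj (pob W D2)"
    and u: "u \<in> homset (pob E D) (fob (pone E f) X) A" and s: "s \<in> homset (pob W D') B' (fob (pone W h) B2)"
    using a b c by (auto simp: Delta_one_Arr Delta_one_Obj)
  note gf = E.Cmp_one_homset[OF f g] and hg = E.Cmp_one_homset[OF g h]
  interpret f: one_cell K E W f C D by (rule one_cellI[OF f])
  interpret g: one_cell K E W g D D' by (rule one_cellI[OF g])
  interpret h: one_cell K E W h D' D2 by (rule one_cellI[OF h])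
  interpret hg: one_cell K E W "Cmp (one K) h g" D D2 by (rule one_cellI[OF hg])
  interpret gf: one_cell K E W "Cmp (one K) g f" C D' by (rule one_cellI[OF gf])
  have X': "fob (pone E f) X \<in> Obj (pob E D)" and B3: "fob (pone W h) B2 \<in> Obj (pob W D')"
    using X B2 by auto
  have assoc1: "Cmp (one K) h (Cmp (one K) g f) = Cmp (one K) (Cmp (one K) h g) f"
    using one.Cmp_assoc[OF f g h] .
  note [simp] = E.pcmp_component[OF f g X] E.pcmp_component[OF gf h X] E.pcmp_component[OF g h A]
    E.pcmp_component[OF g h X'] E.pcmp_component[OF f hg X]
    W_pcmp_component[OF g f B'] W_pcmp_component[OF h gf B2] W_pcmp_component[OF h g B2]
    W_pcmp_component[OF hg f B2] W_pcmp_component[OF g f B3]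
  note cells = a[unfolded Delta_one_Arr Delta_one_Obj in_homset] b[unfolded Delta_one_Arr Delta_one_Obj in_homset]
    c[unfolded Delta_one_Arr Delta_one_Obj in_homset]
  have [simp]: "Cod (one K) f = Dom (one K) g" "Cod (one K) g = Dom (one K) h" using f g h by (auto simp: in_homset)
  have E: "Cmp (pob E D2) (inv_arr (pob E D2) (ncmp (pcmp E h g) A))
      (Cmp (pob E D2) (far (pone E (Cmp (one K) h g)) u) (inv_arr (pob E D2) (ncmp (pcmp E (Cmp (one K) h g) f) X)))
    = Cmp (pob E D2) (far (pone E h) (far (pone E g) u))
      (Cmp (pob E D2) (far (pone E h) (inv_arr (pob E D') (ncmp (pcmp E g f) X)))
        (inv_arr (pob E D2) (ncmp (pcmp E h (Cmp (one K) g f)) X)))"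
    (is "Cmp _ ?p (Cmp _ ?u ?q) = Cmp _ ?u' (Cmp _ ?r ?t)")
  proof -
    have "Cmp (pob E D2) ?p (Cmp (pob E D2) ?u ?q)
      = Cmp (pob E D2) ?u' (Cmp (pob E D2) (inv_arr (pob E D2) (ncmp (pcmp E h g) (fob (pone E f) X))) ?q)"
      by (rule h.Ef.B.square_Cmp[OF E.inv_pcmp_naturality[OF g h u]]) (use cells in simp_all)
    also have "\<dots> = Cmp (pob E D2) ?u' (Cmp (pob E D2) ?r ?t)"
      by (simp only: E.inv_pcmp_assoc[OF f g h X])
    finally show ?thesis .
  qed
  have W: "Cmp (pob W C) (ncmp (pcmp W f (Cmp (one K) h g)) B2)
      (Cmp (pob W C) (far (pone W f) (ncmp (pcmp W g h) B2))
        (Cmp (pob W C) (far (pone W f) (far (pone W g) s)) (Cmp (pob W C) (far (pone W f) y) v)))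
    = Cmp (pob W C) (ncmp (pcmp W (Cmp (one K) g f) h) B2)
      (Cmp (pob W C) (far (pone W (Cmp (one K) g f)) s)
        (Cmp (pob W C) (ncmp (pcmp W f g) B') (Cmp (pob W C) (far (pone W f) y) v)))"
    (is "Cmp _ ?p (Cmp _ ?q (Cmp _ ?s ?k)) = Cmp _ ?p' (Cmp _ ?s' (Cmp _ ?q' _))")
  proof -
    have "Cmp (pob W C) ?p (Cmp (pob W C) ?q (Cmp (pob W C) ?s ?k))
      = Cmp (pob W C) ?p' (Cmp (pob W C) (ncmp (pcmp W f g) (fob (pone W h) B2)) (Cmp (pob W C) ?s ?k))"
      by (rule f.Wf.B.square_Cmp[OF W_pcmp_assoc[OF h g f B2]]) (use cells in simp_all)
    also have "Cmp (pob W C) (ncmp (pcmp W f g) (fob (pone W h) B2)) (Cmp (pob W C) ?s ?k)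
      = Cmp (pob W C) ?s' (Cmp (pob W C) ?q' ?k)"
      by (rule f.Wf.B.square_Cmp[OF W_pcmp_naturality[OF g f s]]) (use cells in simp_all)
    finally show ?thesis .
  qed
  show ?thesis
    using cells E W by simp
qed

lemma category_Delta_one: "category D1"
proof
  fix a assume "a \<in> Arr D1"
  then show "Dom D1 a \<in> Obj D1" "Cod D1 a \<in> Obj D1"
    by (auto elim: Delta_one_cases)
next
  fix x assume "x \<in> Obj D1"
  then show "Idn D1 x \<in> homset D1 x x"
    using Delta_one_Idn_Arr by (cases x) (auto simp: in_homset)
next
  fix a x y assume "a \<in> homset D1 x y"
  then have a: "a \<in> Arr D1" "Dom D1 a = x" "Cod D1 a = y" by (auto simp: in_homset)
  obtain C X Y m D A B where "a = ((C, X, Y), m, (D, A, B))" by (metis prod_cases3)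
  moreover obtain f u v where "m = (f, u, v)" by (metis prod_cases3)
  ultimately have eq: "a = ((C, X, Y), (f, u, v), (D, A, B))" by simp
  then show "Cmp D1 a (Idn D1 x) = a" "Cmp D1 (Idn D1 y) a = a"
    using a Delta_one_Idn[of C X Y f u v D A B] by (simp_all del: Delta_one_simps(3,4))
next
  fix a b x y z assume "a \<in> homset D1 x y" "b \<in> homset D1 y z"
  then show "Cmp D1 b a \<in> homset D1 x z"
    using Delta_one_Cmp_Arr by (cases a; cases b; cases x; cases y; cases z) (auto simp: in_homset)
next
  fix a b c w x y z assume "a \<in> homset D1 w x" "b \<in> homset D1 x y" "c \<in> homset D1 y z"
  then show "Cmp D1 c (Cmp D1 b a) = Cmp D1 (Cmp D1 c b) a"
    using Delta_one_assoc
    by (cases a; cases b; cases c; cases w; cases x; cases y; cases z)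
      (auto simp: in_homset simp del: Delta_one_simps(4))
qed

abbreviation "D2 \<equiv> Delta K E W"

lemma one_Delta [simp]: "one D2 = D1"
  by (simp add: Delta_def)

lemma Delta_two_Arr:
  "(((C, X, Y), (f, u, v), (D, A, B)), \<alpha>, ((C', X', Y'), (g, x, y), (D', A', B'))) \<in> Arr (two D2) \<longleftrightarrow>
     C' = C \<and> X' = X \<and> Y' = Y \<and> D' = D \<and> A' = A \<and> B' = B
     \<and> ((C, X, Y), (f, u, v), (D, A, B)) \<in> Arr D1 \<and> ((C, X, Y), (g, x, y), (D, A, B)) \<in> Arr D1
     \<and> \<alpha> \<in> homset (two K) f g
     \<and> Cmp (pob E D) x (ncmp (ptwo E \<alpha>) X) = u \<and> Cmp (pob W C) (ncmp (ptwo W \<alpha>) B) v = y"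
  by (auto simp: Delta_def)

lemma Delta_two_cases:
  assumes "c \<in> Arr (two D2)"
  obtains C X Y f u v D A B \<alpha> g x y where
    "c = (((C, X, Y), (f, u, v), (D, A, B)), \<alpha>, ((C, X, Y), (g, x, y), (D, A, B)))"
  using assms unfolding Delta_def by auto

lemma Delta_two_simps [simp]:
  "Obj (two D2) = Arr D1" "Dom (two D2) (p, \<alpha>, q) = p" "Cod (two D2) (p, \<alpha>, q) = q"
  "Idn (two D2) (s, (f, u, v), t) = ((s, (f, u, v), t), Idn (two K) f, (s, (f, u, v), t))"
  "Cmp (two D2) (q', \<beta>, r) (p, \<alpha>, q) = (p, Cmp (two K) \<beta> \<alpha>, r)"
  "hcmp D2 (p', \<beta>, q') (p, \<alpha>, q) = (Cmp D1 p' p, hcmp K \<beta> \<alpha>, Cmp D1 q' q)"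
  by (simp_all add: Delta_def)

lemma Delta_two_Idn:
  assumes "((C, X, Y), (f, u, v), (D, A, B)) \<in> Arr D1"
  shows "Idn (two D2) ((C, X, Y), (f, u, v), (D, A, B)) \<in> Arr (two D2)"
proof -
  have f: "f \<in> homset (one K) C D" and X: "X \<in> Obj (pob E C)" and B: "B \<in> Obj (pob W D)"
    using assms by (auto simp: Delta_one_Arr Delta_one_Obj)
  interpret f: one_cell K E W f C D by (rule one_cellI[OF f])
  show ?thesis
    using assms f X B
    by (simp add: Delta_two_Arr Delta_one_Arr Delta_one_Obj in_homset
        E.ptwo_Idn_component[OF f X] W_ptwo_Idn[OF f B])
qed

lemma Delta_two_Cmp:
  assumes c: "(((C, X, Y), (f, u, v), (D, A, B)), \<alpha>, ((C, X, Y), (g, x, y), (D, A, B))) \<in> Arr (two D2)"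
    and d: "(((C, X, Y), (g, x, y), (D, A, B)), \<beta>, ((C, X, Y), (h, r, s), (D, A, B))) \<in> Arr (two D2)"
  shows "(((C, X, Y), (f, u, v), (D, A, B)), Cmp (two K) \<beta> \<alpha>, ((C, X, Y), (h, r, s), (D, A, B))) \<in> Arr (two D2)"
proof -
  have f: "f \<in> homset (one K) C D" and g: "g \<in> homset (one K) C D"
    and X: "X \<in> Obj (pob E C)" and B: "B \<in> Obj (pob W D)"
    and \<alpha>: "\<alpha> \<in> homset (two K) f g" and \<beta>: "\<beta> \<in> homset (two K) g h"
    using c d by (auto simp: Delta_two_Arr Delta_one_Arr Delta_one_Obj)
  interpret f: one_cell K E W f C D by (rule one_cellI[OF f])
  note [simp] = E.ptwo_component[OF \<alpha> f X] E.ptwo_component[OF \<beta> g X]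
    W_ptwo_component[OF \<alpha> f B] W_ptwo_component[OF \<beta> g B]
    E.ptwo_Cmp_component[OF \<alpha> \<beta> f X] W_ptwo_Cmp[OF \<alpha> \<beta> f B]
  note cells = c[unfolded Delta_two_Arr Delta_one_Arr in_homset] d[unfolded Delta_two_Arr Delta_one_Arr in_homset]
  have "Cmp (pob E D) r (Cmp (pob E D) (ncmp (ptwo E \<beta>) X) (ncmp (ptwo E \<alpha>) X)) = u"
    using cells by (subst f.Ef.B.assoc[symmetric]) simp_all
  moreover have "Cmp (pob W C) (Cmp (pob W C) (ncmp (ptwo W \<beta>) B) (ncmp (ptwo W \<alpha>) B)) v = s"
    using cells by (subst f.Wf.B.assoc) simp_all
  ultimately show ?thesis
    using c d unfolding Delta_two_Arr by (simp add: in_homset)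
qed

text \<open>The conditions on a horizontal composite are naturality of the coherence cells of \<open>E\<close> and \<open>W\<close>
  in 2-cells together with naturality of \<open>\<beta>\<^sub>!\<close> and \<open>\<alpha>\<^sup>*\<close>.\<close>

lemma Delta_hcmp:
  assumes c: "(((C, X, Y), (f, u, v), (D, A, B)), \<alpha>, ((C, X, Y), (f', u', v'), (D, A, B))) \<in> Arr (two D2)"
    and d: "(((D, A, B), (g, x, y), (D', A', B')), \<beta>, ((D, A, B), (g', x', y'), (D', A', B'))) \<in> Arr (two D2)"
  shows "(Cmp D1 ((D, A, B), (g, x, y), (D', A', B')) ((C, X, Y), (f, u, v), (D, A, B)), hcmp K \<beta> \<alpha>,
     Cmp D1 ((D, A, B), (g', x', y'), (D', A', B')) ((C, X, Y), (f', u', v'), (D, A, B))) \<in> Arr (two D2)"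
proof -
  have f: "f \<in> homset (one K) C D" and f': "f' \<in> homset (one K) C D"
    and g: "g \<in> homset (one K) D D'" and g': "g' \<in> homset (one K) D D'"
    and X: "X \<in> Obj (pob E C)" and A: "A \<in> Obj (pob E D)"
    and B: "B \<in> Obj (pob W D)" and B': "B' \<in> Obj (pob W D')"
    and \<alpha>: "\<alpha> \<in> homset (two K) f f'" and \<beta>: "\<beta> \<in> homset (two K) g g'"
    and u': "u' \<in> homset (pob E D) (fob (pone E f') X) A"
    and y: "y \<in> homset (pob W D) B (fob (pone W g) B')"
    using c d by (auto simp: Delta_two_Arr Delta_one_Arr Delta_one_Obj)
  interpret f: one_cell K E W f C D by (rule one_cellI[OF f])
  interpret g: one_cell K E W g D D' by (rule one_cellI[OF g])
  interpret f': one_cell K E W f' C D by (rule one_cellI[OF f'])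
  interpret g': one_cell K E W g' D D' by (rule one_cellI[OF g'])
  have \<beta>\<alpha>: "hcmp K \<beta> \<alpha> \<in> homset (two K) (Cmp (one K) g f) (Cmp (one K) g' f')"
    using \<alpha> \<beta> f g by (auto simp: in_homset)
  note gf = E.Cmp_one_homset[OF f g] and gf' = E.Cmp_one_homset[OF f' g']
  have X': "fob (pone E f') X \<in> Obj (pob E D)" and B3: "fob (pone W g) B' \<in> Obj (pob W D)"
    using X B' by auto
  note [simp] = E.ptwo_component[OF \<alpha> f X] E.ptwo_component[OF \<beta> g A] E.ptwo_component[OF \<beta> g X']
    E.ptwo_component[OF \<beta>\<alpha> gf X] W_ptwo_component[OF \<beta>\<alpha> gf B']
    W_ptwo_component[OF \<alpha> f B] W_ptwo_component[OF \<beta> g B'] W_ptwo_component[OF \<alpha> f B3]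
    E.pcmp_component[OF f g X] E.pcmp_component[OF f' g' X]
    W_pcmp_component[OF g f B'] W_pcmp_component[OF g' f' B']
  note cells = c[unfolded Delta_two_Arr Delta_one_Arr Delta_one_Obj in_homset]
    d[unfolded Delta_two_Arr Delta_one_Arr Delta_one_Obj in_homset]
  have arrs: "((C, X, Y), (f, u, v), (D, A, B)) \<in> Arr D1" "((C, X, Y), (f', u', v'), (D, A, B)) \<in> Arr D1"
    "((D, A, B), (g, x, y), (D', A', B')) \<in> Arr D1" "((D, A, B), (g', x', y'), (D', A', B')) \<in> Arr D1"
    using c d by (simp_all add: Delta_two_Arr)
  note arrs_typing = arrs[unfolded Delta_one_Arr Delta_one_Obj in_homset]
  have E: "Cmp (pob E D') x' (Cmp (pob E D') (far (pone E g') u') (Cmp (pob E D')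
        (inv_arr (pob E D') (ncmp (pcmp E g' f') X)) (ncmp (ptwo E (hcmp K \<beta> \<alpha>)) X)))
    = Cmp (pob E D') x (Cmp (pob E D') (far (pone E g) u) (inv_arr (pob E D') (ncmp (pcmp E g f) X)))"
  proof -
    let ?C = "Cmp (pob E D')"
    have "?C (inv_arr (pob E D') (ncmp (pcmp E g' f') X)) (ncmp (ptwo E (hcmp K \<beta> \<alpha>)) X)
      = ?C (?C (ncmp (ptwo E \<beta>) (fob (pone E f') X)) (far (pone E g) (ncmp (ptwo E \<alpha>) X)))
        (inv_arr (pob E D') (ncmp (pcmp E g f) X))"
      by (rule g.Ef.B.inv_arr_square[OF E.pcmp_two_naturality[OF f g \<alpha> \<beta> X, symmetric]]) simp_all
    then have "?C x' (?C (far (pone E g') u') (?C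
        (inv_arr (pob E D') (ncmp (pcmp E g' f') X)) (ncmp (ptwo E (hcmp K \<beta> \<alpha>)) X)))
      = ?C x' (?C (far (pone E g') u') (?C (ncmp (ptwo E \<beta>) (fob (pone E f') X))
          (?C (far (pone E g) (ncmp (ptwo E \<alpha>) X)) (inv_arr (pob E D') (ncmp (pcmp E g f) X)))))"
      using cells by simp
    also have "\<dots> = ?C x' (?C (ncmp (ptwo E \<beta>) A) (?C (far (pone E g) u')
          (?C (far (pone E g) (ncmp (ptwo E \<alpha>) X)) (inv_arr (pob E D') (ncmp (pcmp E g f) X)))))"
      by (rule arg_cong[where f = "?C x'"],
          rule g.Ef.B.square_Cmp[OF E.ptwo_naturality[OF \<beta> g u', symmetric]]) (use cells in simp_all)
    also have "\<dots> = ?C (?C x' (ncmp (ptwo E \<beta>) A)) (?C (far (pone E g) (Cmp (pob E D) u' (ncmp (ptwo E \<alpha>) X)))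
          (inv_arr (pob E D') (ncmp (pcmp E g f) X)))"
      using arrs_typing by simp
    also have "\<dots> = ?C x (?C (far (pone E g) u) (inv_arr (pob E D') (ncmp (pcmp E g f) X)))"
      using cells by (simp only:)
    finally show ?thesis .
  qed
  have W: "Cmp (pob W C) (ncmp (ptwo W (hcmp K \<beta> \<alpha>)) B') (Cmp (pob W C) (ncmp (pcmp W f g) B')
        (Cmp (pob W C) (far (pone W f) y) v))
    = Cmp (pob W C) (ncmp (pcmp W f' g') B') (Cmp (pob W C) (far (pone W f') y') v')"
  proof -
    let ?C = "Cmp (pob W C)"
    have "?C (ncmp (ptwo W (hcmp K \<beta> \<alpha>)) B') (?C (ncmp (pcmp W f g) B') (?C (far (pone W f) y) v))
      = ?C (?C (ncmp (ptwo W (hcmp K \<beta> \<alpha>)) B') (ncmp (pcmp W f g) B')) (?C (far (pone W f) y) v)"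
      using cells by simp
    also have "\<dots> = ?C (?C (ncmp (pcmp W f' g') B') (?C (ncmp (ptwo W \<alpha>) (fob (pone W g') B'))
        (far (pone W f) (ncmp (ptwo W \<beta>) B')))) (?C (far (pone W f) y) v)"
      by (simp only: W_pcmp_two_naturality[OF g f \<beta> \<alpha> B', unfolded op_unfold])
    also have "\<dots> = ?C (?C (ncmp (pcmp W f' g') B') (?C (far (pone W f') (ncmp (ptwo W \<beta>) B'))
        (ncmp (ptwo W \<alpha>) (fob (pone W g) B')))) (?C (far (pone W f) y) v)"
      by (subst W_ptwo_naturality[OF \<alpha> f, where x = "fob (pone W g) B'"]) (simp_all add: in_homset)
    also have "\<dots> = ?C (ncmp (pcmp W f' g') B') (?C (far (pone W f') (ncmp (ptwo W \<beta>) B'))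
        (?C (ncmp (ptwo W \<alpha>) (fob (pone W g) B')) (?C (far (pone W f) y) v)))"
      using cells B' by simp
    also have "?C (ncmp (ptwo W \<alpha>) (fob (pone W g) B')) (?C (far (pone W f) y) v)
      = ?C (far (pone W f') y) (?C (ncmp (ptwo W \<alpha>) B) v)"
      by (rule f.Wf.B.square_Cmp[OF W_ptwo_naturality[OF \<alpha> f y]]) (use cells in simp_all)
    also have "?C (far (pone W f') (ncmp (ptwo W \<beta>) B')) (?C (far (pone W f') y) (?C (ncmp (ptwo W \<alpha>) B) v))
      = ?C (far (pone W f') (Cmp (pob W D) (ncmp (ptwo W \<beta>) B') y)) (?C (ncmp (ptwo W \<alpha>) B) v)"
      using arrs_typing by simp
    also have "\<dots> = ?C (far (pone W f') y') v'"
      using cells by (simp only:)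
    finally show ?thesis .
  qed
  note comps = Delta_one_Cmp_Arr[OF arrs(1,3)] Delta_one_Cmp_Arr[OF arrs(2,4)]
  show ?thesis
    using comps \<beta>\<alpha> E W cells unfolding Delta_one_simps Delta_two_Arr by simp
qed

text \<open>The 1-cell of \<open>K\<close> underlying a 1-cell of \<open>\<Delta>(E, W)\<close>. A 2-cell of \<open>\<Delta>(E, W)\<close> is determined by its
  source, its target and its underlying 2-cell of \<open>K\<close>, so that the equational axioms of a
  2-category are inherited from \<open>K\<close>.\<close>

definition base_cell :: "('c, 'f, 'o, 'a, 'p, 'b) dcell1 \<Rightarrow> 'f" where
  "base_cell = (\<lambda>(_, (f, _, _), _). f)"

lemma base_cell_simp [simp]: "base_cell (s, (f, u, v), t) = f"
  by (simp add: base_cell_def)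

lemma base_cell_Arr:
  assumes "p \<in> Arr D1"
  shows "base_cell p \<in> homset (one K) (fst (Dom D1 p)) (fst (Cod D1 p))"
  using assms by (elim Delta_one_cases) simp

lemma base_cell_Idn: "base_cell (Idn D1 x) = Idn (one K) (fst x)"
  by (cases x) simp

lemma base_cell_Cmp: "base_cell (Cmp D1 q p) = Cmp (one K) (base_cell q) (base_cell p)"
  by (cases q; cases p) (auto simp: base_cell_def)

lemma Delta_two_D:
  assumes "(p, \<alpha>, q) \<in> Arr (two D2)"
  shows "p \<in> Arr D1" "q \<in> Arr D1" "Dom D1 q = Dom D1 p" "Cod D1 q = Cod D1 p"
    "\<alpha> \<in> Arr (two K)" "Dom (two K) \<alpha> = base_cell p" "Cod (two K) \<alpha> = base_cell q"
proof -
  obtain C X Y f u v D A B g x y where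
    eq: "p = ((C, X, Y), (f, u, v), (D, A, B))" "q = ((C, X, Y), (g, x, y), (D, A, B))"
    using assms by (elim Delta_two_cases) auto
  show "p \<in> Arr D1" "q \<in> Arr D1" "Dom D1 q = Dom D1 p" "Cod D1 q = Cod D1 p"
    "\<alpha> \<in> Arr (two K)" "Dom (two K) \<alpha> = base_cell p" "Cod (two K) \<alpha> = base_cell q"
    using assms unfolding eq Delta_two_Arr by (simp_all add: in_homset)
qed

lemma Delta_two_Idn_eq: "Idn (two D2) p = (p, Idn (two K) (base_cell p), p)"
  by (cases p) (auto simp: base_cell_def)

lemma Delta_two_Idn_Arr:
  assumes "p \<in> Arr D1"
  shows "(p, Idn (two K) (base_cell p), p) \<in> Arr (two D2)"
proof -
  obtain C X Y f u v D A B where "p = ((C, X, Y), (f, u, v), (D, A, B))"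
    using assms by (rule Delta_one_cases)
  then show ?thesis using Delta_two_Idn[of C X Y f u v D A B] assms by simp
qed

lemma Delta_two_Cmp_Arr:
  assumes "(p, \<alpha>, q) \<in> Arr (two D2)" "(q, \<beta>, r) \<in> Arr (two D2)"
  shows "(p, Cmp (two K) \<beta> \<alpha>, r) \<in> Arr (two D2)"
proof -
  obtain C X Y f u v D A B g x y where
    eq: "p = ((C, X, Y), (f, u, v), (D, A, B))" "q = ((C, X, Y), (g, x, y), (D, A, B))"
    using assms(1) by (elim Delta_two_cases) auto
  moreover obtain h i j where "r = ((C, X, Y), (h, i, j), (D, A, B))"
    using assms(2) eq(2) by (elim Delta_two_cases) auto
  ultimately show ?thesis using Delta_two_Cmp assms by simp
qed

lemma Delta_two_hcmp_Arr:
  assumes "(p, \<alpha>, q) \<in> Arr (two D2)" "(p', \<beta>, q') \<in> Arr (two D2)" "Cod D1 p = Dom D1 p'"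
  shows "(Cmp D1 p' p, hcmp K \<beta> \<alpha>, Cmp D1 q' q) \<in> Arr (two D2)"
proof -
  obtain C X Y f u v D A B g x y where
    eq: "p = ((C, X, Y), (f, u, v), (D, A, B))" "q = ((C, X, Y), (g, x, y), (D, A, B))"
    using assms(1) by (elim Delta_two_cases) auto
  moreover obtain f' u' v' D' A' B' g' x' y' where
    "p' = ((D, A, B), (f', u', v'), (D', A', B'))" "q' = ((D, A, B), (g', x', y'), (D', A', B'))"
    using assms(2,3) eq by (elim Delta_two_cases) auto
  ultimately show ?thesis using Delta_hcmp assms by (simp del: Delta_one_simps(4))
qed

lemma category_Delta_two: "category (two D2)"
proof
  fix c assume "c \<in> Arr (two D2)"
  then show "Dom (two D2) c \<in> Obj (two D2)" "Cod (two D2) c \<in> Obj (two D2)"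
    by (cases c; auto dest: Delta_two_D)+
next
  fix p assume "p \<in> Obj (two D2)"
  then show "Idn (two D2) p \<in> homset (two D2) p p"
    using Delta_two_Idn_Arr by (simp add: Delta_two_Idn_eq in_homset)
next
  fix c p q assume "c \<in> homset (two D2) p q"
  then obtain \<alpha> where c: "c = (p, \<alpha>, q)" "(p, \<alpha>, q) \<in> Arr (two D2)"
    by (cases c) (auto simp: in_homset)
  show "Cmp (two D2) c (Idn (two D2) p) = c" "Cmp (two D2) (Idn (two D2) q) c = c"
    using Delta_two_D[OF c(2)] by (simp_all add: c Delta_two_Idn_eq)
next
  fix c d p q r assume "c \<in> homset (two D2) p q" "d \<in> homset (two D2) q r"
  then show "Cmp (two D2) d c \<in> homset (two D2) p r"
    by (cases c; cases d) (auto simp: in_homset intro: Delta_two_Cmp_Arr)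
next
  fix c d e p q r s
  assume "c \<in> homset (two D2) p q" "d \<in> homset (two D2) q r" "e \<in> homset (two D2) r s"
  then show "Cmp (two D2) e (Cmp (two D2) d c) = Cmp (two D2) (Cmp (two D2) e d) c"
    by (cases c; cases d; cases e) (auto simp: in_homset Delta_two_D)
qed

lemma two_category_Delta: "two_category D2"
proof (intro two_category.intro two_category_axioms.intro)
  interpret D: category D1 by (rule category_Delta_one)
  show "category (one D2)" "category (two D2)"
    by (simp_all add: category_Delta_one category_Delta_two)
  show "Obj (two D2) = Arr (one D2)" by simp
  fix c assume "c \<in> Arr (two D2)"
  then obtain p \<alpha> q where c: "c = (p, \<alpha>, q)" "(p, \<alpha>, q) \<in> Arr (two D2)" by (cases c) auto
  note cD = Delta_two_D[OF c(2)] and pq = base_cell_Arr[OF Delta_two_D(1)[OF c(2)]] base_cell_Arr[OF Delta_two_D(2)[OF c(2)]]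
  show "Dom (one D2) (Dom (two D2) c) = Dom (one D2) (Cod (two D2) c) \<and>
      Cod (one D2) (Dom (two D2) c) = Cod (one D2) (Cod (two D2) c)"
    using c cD by simp
  show "hcmp D2 c (Idn (two D2) (Idn (one D2) (Dom (one D2) (Dom (two D2) c)))) = c"
    using c cD pq hcmp_unit_right[of \<alpha>] by (simp add: Delta_two_Idn_eq base_cell_Idn in_homset)
  show "hcmp D2 (Idn (two D2) (Idn (one D2) (Cod (one D2) (Dom (two D2) c)))) c = c"
    using c cD pq hcmp_unit_left[of \<alpha>] by (simp add: Delta_two_Idn_eq base_cell_Idn in_homset)
next
  fix p q a b c assume "p \<in> homset (one D2) a b" "q \<in> homset (one D2) b c"
  then show "hcmp D2 (Idn (two D2) q) (Idn (two D2) p) = Idn (two D2) (Cmp (one D2) q p)"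
    using base_cell_Arr[of p] base_cell_Arr[of q] hcmp_Idn[of "base_cell p" "fst a" "fst b" "base_cell q" "fst c"]
    by (simp add: Delta_two_Idn_eq base_cell_Cmp in_homset)
next
  interpret D: category D1 by (rule category_Delta_one)
  have split: "\<exists>p' \<beta> q' p \<alpha> q. d = (p', \<beta>, q') \<and> c = (p, \<alpha>, q) \<and> (p', \<beta>, q') \<in> Arr (two D2)
      \<and> (p, \<alpha>, q) \<in> Arr (two D2) \<and> Cod D1 p = Dom D1 p' \<and> hcomposable K \<beta> \<alpha>"
    if dc: "hcomposable D2 d c" for c d
  proof -
    obtain p' \<beta> q' where d: "d = (p', \<beta>, q')" by (cases d)
    obtain p \<alpha> q where c: "c = (p, \<alpha>, q)" by (cases c)
    have mem: "(p', \<beta>, q') \<in> Arr (two D2)" "(p, \<alpha>, q) \<in> Arr (two D2)" "Cod D1 p = Dom D1 p'"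
      using dc by (auto simp: d c hcomposable_def)
    have "hcomposable K \<beta> \<alpha>"
      using mem(3) Delta_two_D[OF mem(1)] Delta_two_D[OF mem(2)] base_cell_Arr[of p] base_cell_Arr[of p']
      by (simp add: hcomposable_def in_homset)
    then show ?thesis using mem d c by blast
  qed
  fix c d assume "hcomposable D2 d c"
  from split[OF this] obtain p' \<beta> q' p \<alpha> q where dc: "d = (p', \<beta>, q')" "c = (p, \<alpha>, q)"
    and mem: "(p', \<beta>, q') \<in> Arr (two D2)" "(p, \<alpha>, q) \<in> Arr (two D2)" "Cod D1 p = Dom D1 p'"
    and h: "hcomposable K \<beta> \<alpha>" by blast
  note cells = Delta_two_D[OF mem(1)] Delta_two_D[OF mem(2)]
  show "hcmp D2 d c \<in> homset (two D2)
      (Cmp (one D2) (Dom (two D2) d) (Dom (two D2) c)) (Cmp (one D2) (Cod (two D2) d) (Cod (two D2) c))"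
    using Delta_two_hcmp_Arr[OF mem(2,1,3)] by (simp add: dc in_homset)
  show "hcmp D2 (Cmp (two D2) d' d) (Cmp (two D2) c' c) = Cmp (two D2) (hcmp D2 d' c') (hcmp D2 d c)"
    if "hcomposable D2 d' c'" "Cod (two D2) c = Dom (two D2) c'" "Cod (two D2) d = Dom (two D2) d'" for c' d'
  proof -
    from split[OF that(1)] obtain r' \<beta>' s' r \<alpha>' s where dc': "d' = (r', \<beta>', s')" "c' = (r, \<alpha>', s)"
      and mem': "(r', \<beta>', s') \<in> Arr (two D2)" "(r, \<alpha>', s) \<in> Arr (two D2)"
      and h': "hcomposable K \<beta>' \<alpha>'" by blast
    have "hcmp K (Cmp (two K) \<beta>' \<beta>) (Cmp (two K) \<alpha>' \<alpha>) = Cmp (two K) (hcmp K \<beta>' \<alpha>') (hcmp K \<beta> \<alpha>)"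
      using that cells Delta_two_D[OF mem'(1)] Delta_two_D[OF mem'(2)]
      by (intro interchange[OF h h']) (simp_all add: dc dc')
    then show ?thesis by (simp add: dc dc')
  qed
  show "hcmp D2 e (hcmp D2 d c) = hcmp D2 (hcmp D2 e d) c" if "hcomposable D2 e d" for e
  proof -
    from split[OF that] obtain r \<gamma> s where e: "e = (r, \<gamma>, s)" "(r, \<gamma>, s) \<in> Arr (two D2)" "Cod D1 p' = Dom D1 r"
      and h': "hcomposable K \<gamma> \<beta>" unfolding dc by blast
    show ?thesis using hcmp_assoc[OF h h'] cells Delta_two_D[OF e(2)] e(3) mem(3)
      by (simp add: dc e(1))
  qed
qed

sublocale D: two_category D2
  rewrites "one D2 = D1"
  using two_category_Delta by simp_all

section \<open>The category \<open>E \<star> W\<close>\<close>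

lemma cartesian_Arr: "cartesian K E W a \<Longrightarrow> a \<in> Arr D1"
  by (auto simp: cartesian_def)

sublocale Fr: fraction_data "pi0 D2" "Sigma_cart K E W"
  by (intro fraction_data.intro fraction_data_axioms.intro D.category_pi0)
    (auto simp: Sigma_cart_def D.pi0_Arr cartesian_Arr)

abbreviation "St \<equiv> star K E W"
abbreviation "cl \<equiv> star_class K E W"

lemma star_eq: "St = fractions (pi0 D2) (Sigma_cart K E W)"
  by (simp add: star_def)

lemma category_star: "category St"
  unfolding star_eq by (rule Fr.category_fractions)

sublocale St: category St by (rule category_star)

lemma star_Obj [simp]: "Obj St = Obj D1"
  by (simp add: star_eq)

lemma star_class_simps [simp]:
  assumes "a \<in> Arr D1"
  shows "cl a \<in> Arr St" "Dom St (cl a) = Dom D1 a" "Cod St (cl a) = Cod D1 a"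
  using assms by (simp_all add: star_eq star_class_def D.pi0_Arr)

lemma star_class_Idn: "x \<in> Obj D1 \<Longrightarrow> cl (Idn D1 x) = Idn St x"
  using Fr.fractions_arr_Idn[of x] by (simp add: star_eq star_class_def D.pi0_Idn)

lemma star_class_Cmp:
  "a \<in> Arr D1 \<Longrightarrow> b \<in> Arr D1 \<Longrightarrow> Cod D1 a = Dom D1 b \<Longrightarrow> cl (Cmp D1 b a) = Cmp St (cl b) (cl a)"
  using Fr.fractions_arr_Cmp[of "component_of D2 a" "component_of D2 b"]
  by (simp add: star_eq star_class_def D.pi0_Arr)

lemma star_class_two_cell:
  assumes "(p, \<alpha>, q) \<in> Arr (two D2)"
  shows "cl p = cl q"
  using D.two_cell_conn[OF assms] D.component_of_eq[of p q] Delta_two_D[OF assms]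
  by (simp add: star_class_def)

lemma iso_star_class: "cartesian K E W a \<Longrightarrow> iso_arr St (cl a)"
  unfolding star_eq star_class_def by (rule Fr.iso_arr_fractions_arr) (unfold Sigma_cart_def, blast)

lemma star_induct [consumes 1, case_names Idn Fwd Bwd]:
  assumes "a \<in> Arr St"
    and "\<And>x. x \<in> Obj D1 \<Longrightarrow> P (Idn St x)"
    and "\<And>d a. d \<in> Arr D1 \<Longrightarrow> a \<in> Arr St \<Longrightarrow> Dom St a = Cod D1 d \<Longrightarrow> P a \<Longrightarrow> P (Cmp St a (cl d))"
    and "\<And>d a. cartesian K E W d \<Longrightarrow> a \<in> Arr St \<Longrightarrow> Dom St a = Dom D1 d \<Longrightarrow> P a
      \<Longrightarrow> P (Cmp St a (inv_arr St (cl d)))"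
  shows "P a"
  using assms(1) unfolding star_eq
proof (induction rule: Fr.fractions_induct)
  case (Idn x)
  then show ?case using assms(2) by (simp add: star_eq)
next
  case (Fwd f a)
  from Fwd.hyps(1) obtain d where d: "d \<in> Arr D1" "f = component_of D2 d" unfolding D.pi0_Arr by blast
  have "P (Cmp St a (cl d))"
    by (rule assms(3)) (use Fwd d in \<open>simp_all add: star_eq\<close>)
  then show ?case by (simp add: star_class_def star_eq d)
next
  case (Bwd s a)
  from Bwd.hyps(1) obtain d where d: "cartesian K E W d" "s = component_of D2 d"
    unfolding Sigma_cart_def by blast
  have "P (Cmp St a (inv_arr St (cl d)))"
    by (rule assms(4)) (use Bwd d cartesian_Arr[OF d(1)] in \<open>simp_all add: star_eq\<close>)
  then show ?case by (simp add: star_class_def star_eq d)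
qed

text \<open>The universal property of \<open>E \<star> W\<close>: it is initial among categories under the underlying
  category of \<open>\<Delta>(E, W)\<close> in which 2-cells become equalities and cartesian arrows become invertible.\<close>

lemma star_lift:
  assumes "is_functor D1 X P"
    and "\<And>p \<alpha> q. (p, \<alpha>, q) \<in> Arr (two D2) \<Longrightarrow> far P p = far P q"
    and iso: "\<And>a. cartesian K E W a \<Longrightarrow> iso_arr X (far P a)"
  obtains F where "is_functor St X F" "\<And>x. x \<in> Obj D1 \<Longrightarrow> fob F x = fob P x"
    "\<And>a. a \<in> Arr D1 \<Longrightarrow> far F (cl a) = far P a"
proof -
  have "far P (Dom (two D2) c) = far P (Cod (two D2) c)" if "c \<in> Arr (two D2)" for c
    using that assms(2) by (cases c) auto
  then obtain G where G: "is_functor (pi0 D2) X G" "\<And>x. x \<in> Obj D1 \<Longrightarrow> fob G x = fob P x"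
    "\<And>a. a \<in> Arr D1 \<Longrightarrow> far G (component_of D2 a) = far P a"
    using D.pi0_lift[OF assms(1)] by blast
  have inv: "iso_arr X (far G s)" if "s \<in> Sigma_cart K E W" for s
  proof -
    from that obtain d where d: "cartesian K E W d" "s = component_of D2 d"
      unfolding Sigma_cart_def by blast
    then show ?thesis using iso[OF d(1)] G(3)[OF cartesian_Arr[OF d(1)]] by simp
  qed
  interpret L: fraction_lift "pi0 D2" "Sigma_cart K E W" X G
    using G(1) inv by (intro fraction_lift.intro fraction_lift_axioms.intro Fr.fraction_data_axioms)
  show thesis
  proof (rule that[of L.fr_lift])
    show "is_functor St X L.fr_lift" unfolding star_eq by (rule L.fr_lift_functor)
    show "fob L.fr_lift x = fob P x" if "x \<in> Obj D1" for x using G(2)[OF that] by simp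
    fix a assume a: "a \<in> Arr D1"
    then have "component_of D2 a \<in> Arr (pi0 D2)" by (simp add: D.pi0_Arr)
    then show "far L.fr_lift (cl a) = far P a"
      using L.fr_lift_fractions_arr G(3)[OF a] by (simp add: star_class_def)
  qed
qed

end

section \<open>The pseudo-functor \<open>Cat(E, X)\<close>\<close>

lemma precomp_simps [simp]:
  "is_functor B X G \<Longrightarrow> fob (precomp A B X F) G = comp_functor A G F"
  "is_ntrans B X \<gamma> \<Longrightarrow> far (precomp A B X F) \<gamma> = whisker_right A \<gamma> F"
  by (simp_all add: precomp_def)

lemma is_functor_precomp:
  assumes F: "is_functor A B F" and X: "category X"
  shows "is_functor (Fun B X) (Fun A X) (precomp A B X F)"
proof -
  interpret F: is_functor A B F by fact
  show ?thesis
  proof (rule is_functorI)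
    show "category (Fun B X)" "category (Fun A X)"
      using F.A.category_axioms F.B.category_axioms X by (simp_all add: category_functor_category)
    show "far (precomp A B X F) (Idn (Fun B X) G)
        = Idn (Fun A X) (fob (precomp A B X F) G)" if "G \<in> Obj (Fun B X)" for G
      using that by (intro ntrans_eqI[where A = A]) (auto simp: is_ntrans_Idn)
    show "far (precomp A B X F) (Cmp (Fun B X) \<delta> \<gamma>)
        = Cmp (Fun A X) (far (precomp A B X F) \<delta>) (far (precomp A B X F) \<gamma>)"
      if "\<gamma> \<in> Arr (Fun B X)" "\<delta> \<in> Arr (Fun B X)"
        "Cod (Fun B X) \<gamma> = Dom (Fun B X) \<delta>" for \<gamma> \<delta>
      using that by (intro ntrans_eqI[where A = A]) (auto simp: is_ntrans_Cmp)
    show "fob (precomp A B X F) \<in> extensional (Obj (Fun B X))"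
      "far (precomp A B X F) \<in> extensional (Arr (Fun B X))"
      by (simp_all add: precomp_def del: functor_category_simps)
    show "far (precomp A B X F) \<gamma> \<in> Arr (Fun A X)
        \<and> Dom (Fun A X) (far (precomp A B X F) \<gamma>) = fob (precomp A B X F) (Dom (Fun B X) \<gamma>)
        \<and> Cod (Fun A X) (far (precomp A B X F) \<gamma>) = fob (precomp A B X F) (Cod (Fun B X) \<gamma>)"
      if "\<gamma> \<in> Arr (Fun B X)" for \<gamma>
    proof -
      interpret \<gamma>: is_ntrans B X \<gamma> using that by simp
      show ?thesis
        by (auto intro: F \<gamma>.is_ntrans_axioms simp: \<gamma>.S.is_functor_axioms \<gamma>.T.is_functor_axioms \<gamma>.is_ntrans_axioms)
    qed
  qed (auto intro: F)
qed

lemma precomp_id: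
  assumes A: "category A" and X: "category X"
  shows "precomp A A X (id_functor A) = id_functor (Fun A X)"
proof (rule functor_eqI[OF is_functor_precomp[OF is_functor_id[OF A] X]])
  show "is_functor (Fun A X) (Fun A X) (id_functor (Fun A X))"
    using category_functor_category[OF A X] by auto
  show "far (precomp A A X (id_functor A)) \<gamma> = far (id_functor (Fun A X)) \<gamma>"
    if "\<gamma> \<in> Arr (Fun A X)" for \<gamma>
  proof -
    interpret \<gamma>: is_ntrans A X \<gamma> using that by simp
    have "whisker_right A \<gamma> (id_functor A) = \<gamma>"
      by (intro ntrans_eqI[where A = A])
        (simp_all add: \<gamma>.ncmp_ext comp_functor_id[OF \<gamma>.S.is_functor_axioms] comp_functor_id[OF \<gamma>.T.is_functor_axioms])
    then show ?thesis using that by simp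
  qed
qed simp

lemma Cat_into_simps [simp]:
  "pob (Cat_into K E X) C = Fun (pob E C) X"
  "pone (Cat_into K E X) f
    = precomp (pob E (Dom (one K) f)) (pob E (Cod (one K) f)) X (pone E f)"
  "nsrc (ptwo (Cat_into K E X) \<alpha>) = pone (Cat_into K E X) (Dom (two K) \<alpha>)"
  "ntgt (ptwo (Cat_into K E X) \<alpha>) = pone (Cat_into K E X) (Cod (two K) \<alpha>)"
  "ncmp (ptwo (Cat_into K E X) \<alpha>)
    = (\<lambda>G\<in>Obj (Fun (pob E (Cod (one K) (Dom (two K) \<alpha>))) X).
        whisker_left (pob E (Dom (one K) (Dom (two K) \<alpha>))) G (ptwo E \<alpha>))"
  "nsrc (pcmp (Cat_into K E X) f g) = comp_functor (Fun (pob E (Cod (one K) g)) X)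
    (pone (Cat_into K E X) f) (pone (Cat_into K E X) g)"
  "ntgt (pcmp (Cat_into K E X) f g) = pone (Cat_into K E X) (Cmp (one K) g f)"
  "ncmp (pcmp (Cat_into K E X) f g) = (\<lambda>G\<in>Obj (Fun (pob E (Cod (one K) g)) X).
    whisker_left (pob E (Dom (one K) f)) G (pcmp E g f))"
  by (simp_all add: Cat_into_def Let_def)

text \<open>Both kinds of structure cells of \<open>Cat(E, X)\<close> arise in this way, with \<open>\<tau>\<close> the image of a 2-cell or a
  coherence cell of \<open>E\<close>. Naturality in \<open>\<gamma>\<close> is naturality of \<open>\<gamma>\<close> at the components of \<open>\<tau>\<close>.\<close>

lemma is_ntrans_precomp:
  assumes \<tau>: "is_ntrans A B \<tau>" and X: "category X"
    and P: "is_functor (Fun B X) (Fun A X) P"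
    and Q: "is_functor (Fun B X) (Fun A X) Q"
    and fob: "\<And>G. is_functor B X G \<Longrightarrow> fob P G = comp_functor A G (nsrc \<tau>) \<and> fob Q G = comp_functor A G (ntgt \<tau>)"
    and far: "\<And>\<gamma>. is_ntrans B X \<gamma> \<Longrightarrow> far P \<gamma> = whisker_right A \<gamma> (nsrc \<tau>) \<and> far Q \<gamma> = whisker_right A \<gamma> (ntgt \<tau>)"
  shows "is_ntrans (Fun B X) (Fun A X)
    \<lparr>nsrc = P, ntgt = Q, ncmp = (\<lambda>G\<in>Obj (Fun B X). whisker_left A G \<tau>)\<rparr>"
proof (rule is_ntransI, unfold ntrans.simps)
  interpret \<tau>: is_ntrans A B \<tau> by fact
  fix \<gamma> assume "\<gamma> \<in> Arr (Fun B X)"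
  then interpret \<gamma>: is_ntrans B X \<gamma> by simp
  have "Cmp X (far (ntgt \<gamma>) (ncmp \<tau> x)) (ncmp \<gamma> (fob (nsrc \<tau>) x))
      = Cmp X (ncmp \<gamma> (fob (ntgt \<tau>) x)) (far (nsrc \<gamma>) (ncmp \<tau> x))" if "x \<in> Obj A" for x
    using that \<gamma>.naturality[of "ncmp \<tau> x"] by simp
  then show "Cmp (Fun A X)
      ((\<lambda>G\<in>Obj (Fun B X). whisker_left A G \<tau>) (Cod (Fun B X) \<gamma>)) (far P \<gamma>)
    = Cmp (Fun A X) (far Q \<gamma>)
      ((\<lambda>G\<in>Obj (Fun B X). whisker_left A G \<tau>) (Dom (Fun B X) \<gamma>))"
    by (intro ntrans_eqI[where A = A])
      (auto simp: \<gamma>.S.is_functor_axioms \<gamma>.T.is_functor_axioms \<gamma>.is_ntrans_axioms far)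
qed (use P Q fob \<tau> in auto)

context weighted_pair
begin

abbreviation "CEX X \<equiv> Cat_into K E X"

context
  fixes X :: "('x, 'y) cat"
  assumes X: "category X"
begin

lemma Cat_into_pone:
  assumes "f \<in> homset (one K) C D"
  shows "is_functor (Fun (pob E D) X) (Fun (pob E C) X) (pone (CEX X) f)"
  using is_functor_precomp[OF E.pone_functor[OF assms] X] assms by (simp add: in_homset)

lemma Cat_into_ptwo:
  assumes \<alpha>: "\<alpha> \<in> homset (two K) f g" and f: "f \<in> homset (one K) C D"
  shows "is_ntrans (Fun (pob E D) X) (Fun (pob E C) X) (ptwo (CEX X) \<alpha>)"
proof -
  have g: "g \<in> homset (one K) C D" using \<alpha> f by (auto simp: in_homset)
  have E\<alpha>: "is_ntrans (pob E C) (pob E D) (ptwo E \<alpha>)" "nsrc (ptwo E \<alpha>) = pone E f" "ntgt (ptwo E \<alpha>) = pone E g"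
    using E.ptwo_hom[OF \<alpha> f] by (auto simp: in_homset)
  have eq: "ptwo (CEX X) \<alpha> = \<lparr>nsrc = pone (CEX X) f, ntgt = pone (CEX X) g,
      ncmp = (\<lambda>G\<in>Obj (Fun (pob E D) X). whisker_left (pob E C) G (ptwo E \<alpha>))\<rparr>"
    using \<alpha> f by (intro ntrans.equality) (simp_all add: in_homset)
  show ?thesis
    unfolding eq by (rule is_ntrans_precomp[OF E\<alpha>(1) X Cat_into_pone[OF f] Cat_into_pone[OF g]])
      (use f g in \<open>simp_all add: E\<alpha> in_homset\<close>)
qed

lemma Cat_into_pcmp:
  assumes f: "f \<in> homset (one K) C D" and g: "g \<in> homset (one K) D D'"
  shows "is_ntrans (Fun (pob E D') X) (Fun (pob E C) X) (pcmp (CEX X) f g)"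
proof -
  note gf = E.Cmp_one_homset[OF f g]
  have E: "is_ntrans (pob E C) (pob E D') (pcmp E g f)"
    "nsrc (pcmp E g f) = comp_functor (pob E C) (pone E g) (pone E f)" "ntgt (pcmp E g f) = pone E (Cmp (one K) g f)"
    using E.pcmp_hom[OF f g] by (auto simp: in_homset)
  interpret f: one_cell K E W f C D by (rule one_cellI[OF f])
  interpret g: one_cell K E W g D D' by (rule one_cellI[OF g])
  have eq: "pcmp (CEX X) f g = \<lparr>nsrc = comp_functor (Fun (pob E D') X) (pone (CEX X) f) (pone (CEX X) g),
      ntgt = pone (CEX X) (Cmp (one K) g f),
      ncmp = (\<lambda>G\<in>Obj (Fun (pob E D') X). whisker_left (pob E C) G (pcmp E g f))\<rparr>"
    using f g by (intro ntrans.equality) (simp_all add: in_homset)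
  have f': "Dom (one K) f = C" "Cod (one K) f = D" "Dom (one K) g = D" "Cod (one K) g = D'" "f \<in> Arr (one K)" "g \<in> Arr (one K)"
    using f g by (auto simp: in_homset)
  show ?thesis
    unfolding eq
  proof (rule is_ntrans_precomp[OF E(1) X is_functor_comp[OF Cat_into_pone[OF g] Cat_into_pone[OF f]] Cat_into_pone[OF gf]])
    fix G assume G: "is_functor (pob E D') X G"
    then show "fob (comp_functor (Fun (pob E D') X) (pone (CEX X) f) (pone (CEX X) g)) G
        = comp_functor (pob E C) G (nsrc (pcmp E g f)) \<and>
      fob (pone (CEX X) (Cmp (one K) g f)) G = comp_functor (pob E C) G (ntgt (pcmp E g f))"
      using comp_functor_assoc[OF E.pone_functor[OF f], where H = G and G = "pone E g"]
        is_functor_comp[OF E.pone_functor[OF g] G]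
      by (simp add: f' E)
  next
    fix \<gamma> assume \<gamma>: "is_ntrans (pob E D') X \<gamma>"
    have "whisker_right (pob E C) (whisker_right (pob E D) \<gamma> (pone E g)) (pone E f)
        = whisker_right (pob E C) \<gamma> (comp_functor (pob E C) (pone E g) (pone E f))"
      by (intro ntrans_eqI[where A = "pob E C"])
        (simp_all add: comp_functor_assoc[OF E.pone_functor[OF f]])
    then show "far (comp_functor (Fun (pob E D') X) (pone (CEX X) f) (pone (CEX X) g)) \<gamma>
        = whisker_right (pob E C) \<gamma> (nsrc (pcmp E g f)) \<and>
      far (pone (CEX X) (Cmp (one K) g f)) \<gamma> = whisker_right (pob E C) \<gamma> (ntgt (pcmp E g f))"
      using \<gamma> is_ntrans_whisker_right[OF E.pone_functor[OF g] \<gamma>] by (simp add: f' E)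
  qed
qed

text \<open>Evaluated at a functor \<open>G\<close>, each axiom is the image under \<open>G\<close> of the corresponding axiom for \<open>E\<close>. In
  the naturality of the coherence cells, the horizontal composite in \<open>op2 K\<close> puts the two 2-cells in
  the other order, which is corrected by the interchange law.\<close>

lemma pseudofunctor_Cat_into: "pseudofunctor (op2 K) (CEX X)"
proof (intro pseudofunctor.intro pseudofunctor_axioms.intro, unfold op_unfold)
  show "two_category (op2 K)" by (rule W.two_category_axioms)
  show "category (pob (CEX X) C)" if "C \<in> Obj (one K)" for C
    using E.pob_category[OF that] X by (simp add: category_functor_category)
  show "is_functor (pob (CEX X) a) (pob (CEX X) b) (pone (CEX X) f)" if "f \<in> homset (one K) b a" for f a b
    using Cat_into_pone[OF that] by simp
  show "ptwo (CEX X) \<alpha> \<in> homset (Fun (pob (CEX X) a) (pob (CEX X) b)) (pone (CEX X) f) (pone (CEX X) g)"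
    if "\<alpha> \<in> homset (two K) f g" "f \<in> homset (one K) b a" for \<alpha> f g a b
    using Cat_into_ptwo[OF that] that by (simp add: in_homset)
  show "pone (CEX X) (Idn (one K) a) = id_functor (pob (CEX X) a)" if "a \<in> Obj (one K)" for a
    using that by (simp add: E.normalized precomp_id E.pob_category X)
next
  fix f a b assume f: "f \<in> homset (one K) b a"
  then have f': "Dom (one K) f = b" "Cod (one K) f = a" "f \<in> Arr (one K)" "a \<in> Obj (one K)" "b \<in> Obj (one K)"
    by (auto simp: in_homset)
  interpret f: one_cell K E W f b a by (rule one_cellI[OF f])
  have *: "whisker_left (pob E b) G (Idn (Fun (pob E b) (pob E a)) (pone E f))
      = Idn (Fun (pob E b) X) (comp_functor (pob E b) G (pone E f))"
    if "is_functor (pob E a) X G" for G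
  proof -
    interpret G: is_functor "pob E a" X G by fact
    show ?thesis by (intro ntrans_eqI[where A = "pob E b"]) simp_all
  qed
  show "ptwo (CEX X) (Idn (two K) f) = Idn (Fun (pob (CEX X) a) (pob (CEX X) b)) (pone (CEX X) f)"
    by (rule ntrans_eqI[where A = "Fun (pob E a) X"]) (simp_all add: f' E.ptwo_Idn[OF f] *)
  show "pcmp (CEX X) f (Idn (one K) a) = Idn (Fun (pob (CEX X) a) (pob (CEX X) b)) (pone (CEX X) f)"
    by (rule ntrans_eqI[where A = "Fun (pob E a) X"])
      (use comp_functor_id[OF Cat_into_pone[OF f]] in \<open>simp_all add: f' E.pcmp_unit_left[OF f] * E.normalized
        precomp_id E.pob_category X\<close>)
  show "pcmp (CEX X) (Idn (one K) b) f = Idn (Fun (pob (CEX X) a) (pob (CEX X) b)) (pone (CEX X) f)"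
    by (rule ntrans_eqI[where A = "Fun (pob E a) X"])
      (use comp_functor_id[OF Cat_into_pone[OF f]] in \<open>simp_all add: f' E.pcmp_unit_right[OF f] * E.normalized
        precomp_id E.pob_category X\<close>)
next
  fix \<alpha> \<beta> f g h a b
  assume \<alpha>: "\<alpha> \<in> homset (two K) f g" and \<beta>: "\<beta> \<in> homset (two K) g h" and f: "f \<in> homset (one K) b a"
  then have g: "g \<in> homset (one K) b a" by (auto simp: in_homset)
  have typing: "Dom (one K) f = b" "Cod (one K) f = a" "Dom (one K) g = b" "Cod (one K) g = a"
    "Dom (two K) \<alpha> = f" "Cod (two K) \<alpha> = g" "Dom (two K) \<beta> = g" "Cod (two K) \<beta> = h"
    "\<alpha> \<in> Arr (two K)" "\<beta> \<in> Arr (two K)"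
    using f g \<alpha> \<beta> by (auto simp: in_homset)
  interpret \<alpha>: is_ntrans "pob E b" "pob E a" "ptwo E \<alpha>" using E.ptwo_hom[OF \<alpha> f] by (simp add: in_homset)
  interpret \<beta>: is_ntrans "pob E b" "pob E a" "ptwo E \<beta>" using E.ptwo_hom[OF \<beta> g] by (simp add: in_homset)
  have eq: "ntgt (ptwo E \<alpha>) = nsrc (ptwo E \<beta>)"
    using E.ptwo_hom[OF \<alpha> f] E.ptwo_hom[OF \<beta> g] by (simp add: in_homset)
  have "whisker_left (pob E b) G (ptwo E (Cmp (two K) \<beta> \<alpha>))
      = Cmp (Fun (pob E b) X) (whisker_left (pob E b) G (ptwo E \<beta>)) (whisker_left (pob E b) G (ptwo E \<alpha>))"
    if "is_functor (pob E a) X G" for G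
  proof -
    interpret G: is_functor "pob E a" X G by fact
    show ?thesis by (intro ntrans_eqI[where A = "pob E b"]) (simp_all add: E.ptwo_Cmp[OF \<alpha> \<beta> f] eq)
  qed
  then show "ptwo (CEX X) (Cmp (two K) \<beta> \<alpha>)
      = Cmp (Fun (pob (CEX X) a) (pob (CEX X) b)) (ptwo (CEX X) \<beta>) (ptwo (CEX X) \<alpha>)"
    by (intro ntrans_eqI[where A = "Fun (pob E a) X"]) (simp_all add: typing)
next
  fix f g a b c assume f: "f \<in> homset (one K) b a" and g: "g \<in> homset (one K) c b"
  then have typing: "Dom (one K) f = b" "Cod (one K) f = a" "Dom (one K) g = c" "Cod (one K) g = b"
    by (auto simp: in_homset)
  note pc = Cat_into_pcmp[OF g f]
  show "pcmp (CEX X) g f \<in> homset (Fun (pob (CEX X) a) (pob (CEX X) c))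
      (comp_functor (pob (CEX X) a) (pone (CEX X) g) (pone (CEX X) f)) (pone (CEX X) (Cmp (one K) f g))"
    using pc by (simp add: in_homset typing)
  have "iso_arr (Fun (pob E c) X) (whisker_left (pob E c) G (pcmp E f g))"
    if "is_functor (pob E a) X G" for G
  proof -
    interpret G: is_functor "pob E a" X G by fact
    have "is_ntrans (pob E c) (pob E a) (pcmp E f g)" using E.pcmp_hom[OF g f] by (simp add: in_homset)
    then show ?thesis
      using E.pcmp_component(4)[OF g f] that
      by (intro iso_arr_functor_categoryI is_ntrans_whisker_left[where B = "pob E a"]) auto
  qed
  then show "iso_arr (Fun (pob (CEX X) a) (pob (CEX X) c)) (pcmp (CEX X) g f)"
    using pc by (intro iso_arr_functor_categoryI) (simp_all add: typing)
  fix \<alpha> \<beta> f' g' assume \<alpha>: "\<alpha> \<in> homset (two K) f f'" and \<beta>: "\<beta> \<in> homset (two K) g g'"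
  then have typing2: "Dom (two K) \<alpha> = f" "Cod (two K) \<alpha> = f'" "Dom (two K) \<beta> = g" "Cod (two K) \<beta> = g'"
    "\<alpha> \<in> Arr (two K)" "\<beta> \<in> Arr (two K)"
    "Dom (one K) f' = b" "Cod (one K) f' = a" "Dom (one K) g' = c" "Cod (one K) g' = b"
    using f g by (auto simp: in_homset)
  have f': "f' \<in> homset (one K) b a" and g': "g' \<in> homset (one K) c b" using f g \<alpha> \<beta> by (auto simp: in_homset)
  interpret f: one_cell K E W f b a by (rule one_cellI[OF f])
  interpret f': one_cell K E W f' b a by (rule one_cellI[OF f'])
  interpret g: one_cell K E W g c b by (rule one_cellI[OF g])
  interpret g': one_cell K E W g' c b by (rule one_cellI[OF g'])
  have E\<alpha>: "is_ntrans (pob E b) (pob E a) (ptwo E \<alpha>)" "nsrc (ptwo E \<alpha>) = pone E f" "ntgt (ptwo E \<alpha>) = pone E f'"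
    using E.ptwo_hom[OF \<alpha> f] by (auto simp: in_homset)
  have E\<beta>: "is_ntrans (pob E c) (pob E b) (ptwo E \<beta>)" "nsrc (ptwo E \<beta>) = pone E g" "ntgt (ptwo E \<beta>) = pone E g'"
    using E.ptwo_hom[OF \<beta> g] by (auto simp: in_homset)
  have ntgt_pcmp: "ntgt (pcmp E f' g') = pone E (Cmp (one K) f' g')" "nsrc (pcmp E f g) = comp_functor (pob E c) (pone E f) (pone E g)"
    using E.pcmp_hom[OF g' f'] E.pcmp_hom[OF g f] by (simp_all add: in_homset)
  have \<beta>\<alpha>: "ntgt (ptwo E (hcmp K \<alpha> \<beta>)) = pone E (Cmp (one K) f' g')"
    using E.ptwo_hom[of "hcmp K \<alpha> \<beta>" "Cmp (one K) f g" "Cmp (one K) f' g'" c a] \<alpha> \<beta> f g by (simp add: in_homset)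
  have "Cmp (Fun (pob E c) X) (whisker_left (pob E c) G (pcmp E f' g'))
      (Cmp (Fun (pob E c) X) (whisker_left (pob E c) (comp_functor (pob E b) G (pone E f')) (ptwo E \<beta>))
        (whisker_right (pob E c) (whisker_left (pob E b) G (ptwo E \<alpha>)) (pone E g)))
    = Cmp (Fun (pob E c) X) (whisker_left (pob E c) G (ptwo E (hcmp K \<alpha> \<beta>)))
        (whisker_left (pob E c) G (pcmp E f g))" (is "?L = ?R")
    if G: "is_functor (pob E a) X G" for G
  proof (rule ntrans_eqI[where A = "pob E c"])
    interpret G: is_functor "pob E a" X G by fact
    show "ncmp ?L x = ncmp ?R x" if x: "x \<in> Obj (pob E c)" for x
    proof -
      have gx: "fob (pone E g) x \<in> Obj (pob E b)" "fob (pone E g') x \<in> Obj (pob E b)" using x by auto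
      have bx: "ncmp (ptwo E \<beta>) x \<in> homset (pob E b) (fob (pone E g) x) (fob (pone E g') x)"
        using E.ptwo_component[OF \<beta> g x] by (simp add: in_homset)
      have \<beta>\<alpha>: "hcmp K \<alpha> \<beta> \<in> homset (two K) (Cmp (one K) f g) (Cmp (one K) f' g')"
        using \<alpha> \<beta> f g by (simp add: in_homset)
      note [simp] = E.pcmp_component[OF g f x] E.pcmp_component[OF g' f' x] E.ptwo_component[OF \<beta> g x]
        E.ptwo_component[OF \<alpha> f gx(1)] E.ptwo_component[OF \<alpha> f gx(2)]
        E.ptwo_component[OF \<beta>\<alpha> E.Cmp_one_homset[OF g f] x]
      have "Cmp (pob E a) (ncmp (pcmp E f' g') x)
          (Cmp (pob E a) (far (pone E f') (ncmp (ptwo E \<beta>) x)) (ncmp (ptwo E \<alpha>) (fob (pone E g) x)))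
        = Cmp (pob E a) (ncmp (ptwo E (hcmp K \<alpha> \<beta>)) x) (ncmp (pcmp E f g) x)"
        using E.pcmp_two_naturality[OF g f \<beta> \<alpha> x] by (simp only: E.ptwo_naturality[OF \<alpha> f bx])
      from arg_cong[OF this, of "far G"] show ?thesis using x by simp
    qed
  qed (simp_all add: E\<alpha> E\<beta> ntgt_pcmp \<beta>\<alpha> comp_functor_assoc[OF E.pone_functor[OF g]])
  then show "Cmp (Fun (pob (CEX X) a) (pob (CEX X) c)) (pcmp (CEX X) g' f')
      (hcomp_ntrans (pob (CEX X) a) (pob (CEX X) c) (ptwo (CEX X) \<beta>) (ptwo (CEX X) \<alpha>))
    = Cmp (Fun (pob (CEX X) a) (pob (CEX X) c)) (ptwo (CEX X) (hcmp K \<alpha> \<beta>)) (pcmp (CEX X) g f)"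
    using f g is_functor_comp[OF E.pone_functor[OF f'], where C = X] is_ntrans_whisker_left[OF E\<alpha>(1), where C = X]
    by (intro ntrans_eqI[where A = "Fun (pob E a) X"])
      (simp_all add: typing typing2 hcomp_ntrans_def in_homset)
next
  fix f g h a b c d
  assume f: "f \<in> homset (one K) b a" and g: "g \<in> homset (one K) c b" and h: "h \<in> homset (one K) d c"
  then have typing: "Dom (one K) f = b" "Cod (one K) f = a" "Dom (one K) g = c" "Cod (one K) g = b"
    "Dom (one K) h = d" "Cod (one K) h = c" "f \<in> Arr (one K)" "g \<in> Arr (one K)" "h \<in> Arr (one K)"
    by (auto simp: in_homset)
  interpret f: one_cell K E W f b a by (rule one_cellI[OF f])
  interpret g: one_cell K E W g c b by (rule one_cellI[OF g])
  interpret h: one_cell K E W h d c by (rule one_cellI[OF h])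
  note fg = E.Cmp_one_homset[OF g f] and gh = E.Cmp_one_homset[OF h g]
  have pc: "is_ntrans (pob E c) (pob E a) (pcmp E f g)" "nsrc (pcmp E f g) = comp_functor (pob E c) (pone E f) (pone E g)"
    using E.pcmp_hom[OF g f] by (simp_all add: in_homset)
  have tgt: "ntgt (pcmp E (Cmp (one K) f g) h) = pone E (Cmp (one K) (Cmp (one K) f g) h)"
    "ntgt (pcmp E f (Cmp (one K) g h)) = pone E (Cmp (one K) f (Cmp (one K) g h))"
    "nsrc (pcmp E g h) = comp_functor (pob E d) (pone E g) (pone E h)"
    using E.pcmp_hom[OF h fg] E.pcmp_hom[OF gh f] E.pcmp_hom[OF h g] by (simp_all add: in_homset)
  have "Cmp (Fun (pob E d) X) (whisker_left (pob E d) G (pcmp E (Cmp (one K) f g) h))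
      (whisker_right (pob E d) (whisker_left (pob E c) G (pcmp E f g)) (pone E h))
    = Cmp (Fun (pob E d) X) (whisker_left (pob E d) G (pcmp E f (Cmp (one K) g h)))
      (whisker_left (pob E d) (comp_functor (pob E b) G (pone E f)) (pcmp E g h))" (is "?L = ?R")
    if G: "is_functor (pob E a) X G" for G
  proof (rule ntrans_eqI[where A = "pob E d"])
    interpret G: is_functor "pob E a" X G by fact
    show "ncmp ?L x = ncmp ?R x" if x: "x \<in> Obj (pob E d)" for x
    proof -
      have hx: "fob (pone E h) x \<in> Obj (pob E c)" using x by auto
      note [simp] = E.pcmp_component[OF h g x] E.pcmp_component[OF h fg x] E.pcmp_component[OF gh f x]
        E.pcmp_component[OF g f hx]
      show ?thesis
        using x E.pcmp_assoc_component[OF h g f x, THEN arg_cong[where f = "far G"]]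
        by simp
    qed
  qed (simp_all add: pc tgt typing comp_functor_assoc[OF E.pone_functor[OF h]]
      comp_functor_assoc[OF is_functor_comp[OF E.pone_functor[OF h] E.pone_functor[OF g]]])
  then show "Cmp (Fun (pob (CEX X) a) (pob (CEX X) d)) (pcmp (CEX X) h (Cmp (one K) f g))
      (whisker_left (pob (CEX X) a) (pone (CEX X) h) (pcmp (CEX X) g f))
    = Cmp (Fun (pob (CEX X) a) (pob (CEX X) d)) (pcmp (CEX X) (Cmp (one K) g h) f)
      (whisker_right (pob (CEX X) a) (pcmp (CEX X) h g) (pone (CEX X) f))"
    using is_functor_comp[OF E.pone_functor[OF f], where C = X] is_ntrans_whisker_left[OF pc(1), where C = X]
      comp_functor_assoc[OF Cat_into_pone[OF f], where G = "pone (CEX X) g" and H = "pone (CEX X) h"]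
    by (intro ntrans_eqI[where A = "Fun (pob E a) X"]) (simp_all add: typing)
qed

end

end

section \<open>The category of pseudo-natural transformations and modifications\<close>

context pseudonatural
begin

lemma tone_ntrans:
  assumes "f \<in> homset (one K) a b"
  shows "is_ntrans (pob F a) (pob G b) (tone \<theta> f)"
    "nsrc (tone \<theta> f) = comp_functor (pob F a) (tob \<theta> b) (pone F f)"
    "ntgt (tone \<theta> f) = comp_functor (pob F a) (pone G f) (tob \<theta> a)"
  using tone_hom[OF assms] by (simp_all add: in_homset)

lemma tone_component:
  assumes f: "f \<in> homset (one K) a b" and x: "x \<in> Obj (pob F a)"
  shows "ncmp (tone \<theta> f) x \<in> Arr (pob G b)"
    "Dom (pob G b) (ncmp (tone \<theta> f) x) = fob (tob \<theta> b) (fob (pone F f) x)"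
    "Cod (pob G b) (ncmp (tone \<theta> f) x) = fob (pone G f) (fob (tob \<theta> a) x)"
proof -
  interpret is_ntrans "pob F a" "pob G b" "tone \<theta> f" using tone_ntrans[OF f] by simp
  show "ncmp (tone \<theta> f) x \<in> Arr (pob G b)"
    "Dom (pob G b) (ncmp (tone \<theta> f) x) = fob (tob \<theta> b) (fob (pone F f) x)"
    "Cod (pob G b) (ncmp (tone \<theta> f) x) = fob (pone G f) (fob (tob \<theta> a) x)"
    using x tone_ntrans(2,3)[OF f] by simp_all
qed

end

context modification
begin

lemma mcmp_ntrans:
  assumes "a \<in> Obj (one K)"
  shows "is_ntrans (pob F a) (pob G a) (mcmp m a)" "nsrc (mcmp m a) = tob (msrc m) a" "ntgt (mcmp m a) = tob (mtgt m) a"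
  using mcmp_hom[OF assms] by (simp_all add: in_homset)

lemma mcmp_component:
  assumes "a \<in> Obj (one K)" "x \<in> Obj (pob F a)"
  shows "ncmp (mcmp m a) x \<in> Arr (pob G a)"
    "Dom (pob G a) (ncmp (mcmp m a) x) = fob (tob (msrc m) a) x"
    "Cod (pob G a) (ncmp (mcmp m a) x) = fob (tob (mtgt m) a) x"
proof -
  interpret is_ntrans "pob F a" "pob G a" "mcmp m a" using mcmp_ntrans[OF assms(1)] by simp
  show "ncmp (mcmp m a) x \<in> Arr (pob G a)"
    "Dom (pob G a) (ncmp (mcmp m a) x) = fob (tob (msrc m) a) x"
    "Cod (pob G a) (ncmp (mcmp m a) x) = fob (tob (mtgt m) a) x"
    using assms mcmp_ntrans(2,3)[OF assms(1)] by simp_all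
qed

lemma mcmp_square:
  assumes f: "f \<in> homset (one K) a b" and x: "x \<in> Obj (pob F a)"
  shows "Cmp (pob G b) (far (pone G f) (ncmp (mcmp m a) x)) (ncmp (tone (msrc m) f) x)
    = Cmp (pob G b) (ncmp (tone (mtgt m) f) x) (ncmp (mcmp m b) (fob (pone F f) x))"
  using mcmp_natural[OF f, THEN arg_cong[where f = "\<lambda>\<tau>. ncmp \<tau> x"]] x by simp

end

lemma modificationI:
  assumes S: "pseudonatural K F G (msrc m)" and T: "pseudonatural K F G (mtgt m)"
    and ext: "mcmp m \<in> extensional (Obj (one K))"
    and nt: "\<And>a. a \<in> Obj (one K) \<Longrightarrow> is_ntrans (pob F a) (pob G a) (mcmp m a)
      \<and> nsrc (mcmp m a) = tob (msrc m) a \<and> ntgt (mcmp m a) = tob (mtgt m) a"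
    and sq: "\<And>f a b x. f \<in> homset (one K) a b \<Longrightarrow> x \<in> Obj (pob F a) \<Longrightarrow>
      Cmp (pob G b) (far (pone G f) (ncmp (mcmp m a) x)) (ncmp (tone (msrc m) f) x)
      = Cmp (pob G b) (ncmp (tone (mtgt m) f) x) (ncmp (mcmp m b) (fob (pone F f) x))"
  shows "modification K F G m"
proof (intro modification.intro modification_axioms.intro S T ext)
  interpret S: pseudonatural K F G "msrc m" by (rule S)
  interpret T: pseudonatural K F G "mtgt m" by (rule T)
  show "mcmp m a \<in> homset (Fun (pob F a) (pob G a)) (tob (msrc m) a) (tob (mtgt m) a)"
    if "a \<in> Obj (one K)" for a
    using nt[OF that] by (simp add: in_homset)
  fix f a b assume f: "f \<in> homset (one K) a b"
  then have "a \<in> Obj (one K)" "b \<in> Obj (one K)" by (auto simp: in_homset)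
  note [simp] = nt[OF this(1)] nt[OF this(2)]
  show "Cmp (Fun (pob F a) (pob G b))
        (whisker_left (pob F a) (pone G f) (mcmp m a)) (tone (msrc m) f)
      = Cmp (Fun (pob F a) (pob G b))
        (tone (mtgt m) f) (whisker_right (pob F a) (mcmp m b) (pone F f))"
    by (rule ntrans_eqI[where A = "pob F a"])
      (simp_all add: S.tone_ntrans[OF f] T.tone_ntrans[OF f] sq[OF f])
qed

lemma modification_eqI:
  fixes m n :: "('c, 'f, 'o, 'a, 'p, 'b) modif"
  assumes m: "modification K F G m" and n: "modification K F G n"
    and "msrc m = msrc n" "mtgt m = mtgt n"
    and eq: "\<And>a x. a \<in> Obj (one K) \<Longrightarrow> x \<in> Obj (pob F a) \<Longrightarrow> ncmp (mcmp m a) x = ncmp (mcmp n a) x"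
  shows "m = n"
proof -
  interpret m: modification K F G m by fact
  interpret n: modification K F G n by fact
  have "mcmp m a = mcmp n a" if a: "a \<in> Obj (one K)" for a
    using m.mcmp_ntrans[OF a] n.mcmp_ntrans[OF a] is_ntrans.ncmp_ext assms(3,4) eq[OF a]
    by (intro ntrans_eqI[where A = "pob F a"]) auto
  then have "mcmp m = mcmp n"
    using m.mcmp_ext n.mcmp_ext by (auto intro: extensionalityI)
  then show ?thesis using assms(3,4) by (intro modif.equality) auto
qed

lemma Hom_category_simps [simp]:
  "Obj (Hom_category K F G) = {\<theta>. pseudonatural K F G \<theta>}"
  "Arr (Hom_category K F G) = {m. modification K F G m}"
  "Dom (Hom_category K F G) = msrc" "Cod (Hom_category K F G) = mtgt"
  "msrc (Idn (Hom_category K F G) \<theta>) = \<theta>" "mtgt (Idn (Hom_category K F G) \<theta>) = \<theta>"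
  "mcmp (Idn (Hom_category K F G) \<theta>) = (\<lambda>a\<in>Obj (one K). Idn (Fun (pob F a) (pob G a)) (tob \<theta> a))"
  "msrc (Cmp (Hom_category K F G) n m) = msrc m" "mtgt (Cmp (Hom_category K F G) n m) = mtgt n"
  "mcmp (Cmp (Hom_category K F G) n m)
    = (\<lambda>a\<in>Obj (one K). Cmp (Fun (pob F a) (pob G a)) (mcmp n a) (mcmp m a))"
  by (simp_all add: Hom_category_def)

lemma modification_Idn:
  assumes "pseudonatural K F G \<theta>"
  shows "modification K F G (Idn (Hom_category K F G) \<theta>)"
proof -
  interpret pseudonatural K F G \<theta> by fact
  show ?thesis
  proof (rule modificationI)
    fix f a b x assume f: "f \<in> homset (one K) a b" and x: "x \<in> Obj (pob F a)"
    then have ab: "a \<in> Obj (one K)" "b \<in> Obj (one K)" by (auto simp: in_homset)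
    interpret a: is_functor "pob F a" "pob G a" "tob \<theta> a" by (rule tob_functor[OF ab(1)])
    interpret b: is_functor "pob F b" "pob G b" "tob \<theta> b" by (rule tob_functor[OF ab(2)])
    interpret Ff: is_functor "pob F a" "pob F b" "pone F f" by (rule F.pone_functor[OF f])
    interpret Gf: is_functor "pob G a" "pob G b" "pone G f" by (rule G.pone_functor[OF f])
    show "Cmp (pob G b) (far (pone G f) (ncmp (mcmp (Idn (Hom_category K F G) \<theta>) a) x))
         (ncmp (tone (msrc (Idn (Hom_category K F G) \<theta>)) f) x)
        = Cmp (pob G b) (ncmp (tone (mtgt (Idn (Hom_category K F G) \<theta>)) f) x)
         (ncmp (mcmp (Idn (Hom_category K F G) \<theta>) b) (fob (pone F f) x))"
      using tone_component[OF f x] x ab by simp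
  qed (auto simp: assms tob_functor is_ntrans_Idn)
qed

lemma modification_Cmp:
  assumes m: "modification K F G m" and n: "modification K F G n" and mn: "mtgt m = msrc n"
  shows "modification K F G (Cmp (Hom_category K F G) n m)"
proof -
  interpret m: modification K F G m by fact
  interpret n: modification K F G n by fact
  show ?thesis
  proof (rule modificationI)
    fix f a b x assume f: "f \<in> homset (one K) a b" and x: "x \<in> Obj (pob F a)"
    then have ab: "a \<in> Obj (one K)" "b \<in> Obj (one K)" by (auto simp: in_homset)
    interpret Ff: is_functor "pob F a" "pob F b" "pone F f" by (rule m.S.F.pone_functor[OF f])
    interpret Gf: is_functor "pob G a" "pob G b" "pone G f" by (rule m.S.G.pone_functor[OF f])
    have fx: "fob (pone F f) x \<in> Obj (pob F b)" using x by simp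
    note [simp] = m.mcmp_component[OF ab(1) x] n.mcmp_component[OF ab(1) x]
      m.mcmp_component[OF ab(2) fx] n.mcmp_component[OF ab(2) fx]
      m.S.tone_component[OF f x] m.T.tone_component[OF f x] n.S.tone_component[OF f x] n.T.tone_component[OF f x]
    have "Cmp (pob G b) (far (pone G f) (ncmp (mcmp n a) x))
        (Cmp (pob G b) (far (pone G f) (ncmp (mcmp m a) x)) (ncmp (tone (msrc m) f) x))
      = Cmp (pob G b) (far (pone G f) (ncmp (mcmp n a) x))
        (Cmp (pob G b) (ncmp (tone (msrc n) f) x) (ncmp (mcmp m b) (fob (pone F f) x)))"
      using m.mcmp_square[OF f x] mn by simp
    also have "\<dots> = Cmp (pob G b) (ncmp (tone (mtgt n) f) x)
        (Cmp (pob G b) (ncmp (mcmp n b) (fob (pone F f) x)) (ncmp (mcmp m b) (fob (pone F f) x)))"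
      by (rule Gf.B.square_Cmp[OF n.mcmp_square[OF f x]]) (use x mn in simp_all)
    finally show "Cmp (pob G b) (far (pone G f) (ncmp (mcmp (Cmp (Hom_category K F G) n m) a) x))
         (ncmp (tone (msrc (Cmp (Hom_category K F G) n m)) f) x)
        = Cmp (pob G b) (ncmp (tone (mtgt (Cmp (Hom_category K F G) n m)) f) x)
         (ncmp (mcmp (Cmp (Hom_category K F G) n m) b) (fob (pone F f) x))"
      using x ab mn by simp
  qed (auto simp: m.S.pseudonatural_axioms n.T.pseudonatural_axioms m.mcmp_ntrans n.mcmp_ntrans mn
      intro!: is_ntrans_Cmp)
qed

lemma category_Hom_category:
  assumes "pseudofunctor K F" "pseudofunctor K G"
  shows "category (Hom_category K F G)"
proof -
  interpret F: pseudofunctor K F by fact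
  interpret G: pseudofunctor K G by fact
  show ?thesis
  proof
    show "Dom (Hom_category K F G) m \<in> Obj (Hom_category K F G)"
      "Cod (Hom_category K F G) m \<in> Obj (Hom_category K F G)" if "m \<in> Arr (Hom_category K F G)" for m
      using that by (simp_all add: modification_def)
    show "Idn (Hom_category K F G) \<theta> \<in> homset (Hom_category K F G) \<theta> \<theta>"
      if "\<theta> \<in> Obj (Hom_category K F G)" for \<theta>
      using that by (simp add: in_homset modification_Idn)
    show "Cmp (Hom_category K F G) n m \<in> homset (Hom_category K F G) x z"
      if "m \<in> homset (Hom_category K F G) x y" "n \<in> homset (Hom_category K F G) y z" for m n x y z
      using that by (simp add: in_homset modification_Cmp)
    fix m x y assume m: "m \<in> homset (Hom_category K F G) x y"
    then interpret m: modification K F G m by (simp add: in_homset)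
    have xy: "msrc m = x" "mtgt m = y" using m by (auto simp: in_homset)
    show "Cmp (Hom_category K F G) m (Idn (Hom_category K F G) x) = m"
      "Cmp (Hom_category K F G) (Idn (Hom_category K F G) y) m = m"
    proof -
      have id: "modification K F G (Idn (Hom_category K F G) x)" "modification K F G (Idn (Hom_category K F G) y)"
        using m.S.pseudonatural_axioms m.T.pseudonatural_axioms by (simp_all add: modification_Idn flip: xy)
      have comp: "Cmp (pob G a) (ncmp (mcmp m a) p) (Idn (pob G a) (fob (tob x a) p)) = ncmp (mcmp m a) p"
        "Cmp (pob G a) (Idn (pob G a) (fob (tob y a) p)) (ncmp (mcmp m a) p) = ncmp (mcmp m a) p"
        if "a \<in> Obj (one K)" "p \<in> Obj (pob F a)" for a p
        using m.mcmp_component[OF that] G.pob_category[OF that(1)]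
        by (simp_all add: xy category.Cmp_Idn_right category.Cmp_Idn_left)
      show "Cmp (Hom_category K F G) m (Idn (Hom_category K F G) x) = m"
        by (rule modification_eqI[OF modification_Cmp[OF id(1) m.modification_axioms] m.modification_axioms])
          (simp_all add: xy comp)
      show "Cmp (Hom_category K F G) (Idn (Hom_category K F G) y) m = m"
        by (rule modification_eqI[OF modification_Cmp[OF m.modification_axioms id(2)] m.modification_axioms])
          (simp_all add: xy comp)
    qed
  next
    fix m n l w x y z
    assume a: "m \<in> homset (Hom_category K F G) w x" "n \<in> homset (Hom_category K F G) x y"
      "l \<in> homset (Hom_category K F G) y z"
    interpret m: modification K F G m using a by (simp add: in_homset)
    interpret n: modification K F G n using a by (simp add: in_homset)
    interpret l: modification K F G l using a by (simp add: in_homset)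
    have eq: "mtgt m = msrc n" "mtgt n = msrc l" using a by (auto simp: in_homset)
    have "Cmp (pob G a) (ncmp (mcmp l a) p) (Cmp (pob G a) (ncmp (mcmp n a) p) (ncmp (mcmp m a) p))
      = Cmp (pob G a) (Cmp (pob G a) (ncmp (mcmp l a) p) (ncmp (mcmp n a) p)) (ncmp (mcmp m a) p)"
      if "a \<in> Obj (one K)" "p \<in> Obj (pob F a)" for a p
      using m.mcmp_component[OF that] n.mcmp_component[OF that] l.mcmp_component[OF that] G.pob_category[OF that(1)]
      by (simp add: category.assoc eq)
    then show "Cmp (Hom_category K F G) l (Cmp (Hom_category K F G) n m)
        = Cmp (Hom_category K F G) (Cmp (Hom_category K F G) l n) m"
      by (intro modification_eqI[of K F G] modification_Cmp m.modification_axioms n.modification_axioms l.modification_axioms)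
        (simp_all add: eq)
  qed
qed

section \<open>Cylinders\<close>

text \<open>A pseudo-natural transformation \<open>W \<rightarrow> Cat(E, Z)\<close> with all its variables uncurried: \<open>cylob C Y X\<close> is
  an object of \<open>Z\<close>, the fields \<open>cylE\<close> and \<open>cylW\<close> give the action of arrows of \<open>E C\<close> and \<open>W C\<close>, and
  \<open>cylc f B X\<close> is a component of the coherence cell at \<open>f\<close>. The point of this form is that its axioms
  are equations between arrows of \<open>Z\<close>.\<close>

record ('c, 'f, 'o, 'a, 'p, 'b, 'x, 'y) cylinder =
  cylob :: "'c \<Rightarrow> 'p \<Rightarrow> 'o \<Rightarrow> 'x"
  cylE :: "'c \<Rightarrow> 'p \<Rightarrow> 'a \<Rightarrow> 'y"
  cylW :: "'c \<Rightarrow> 'b \<Rightarrow> 'o \<Rightarrow> 'y"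
  cylc :: "'f \<Rightarrow> 'p \<Rightarrow> 'o \<Rightarrow> 'y"

locale pseudo_cylinder = weighted_pair K E W + Z: category Z
  for K :: "('c, 'f, 't) twocat"
    and E :: "('c, 'f, 't, 'o, 'a) pftor" and W :: "('c, 'f, 't, 'p, 'b) pftor"
    and Z :: "('x, 'y) cat" +
  fixes c :: "('c, 'f, 'o, 'a, 'p, 'b, 'x, 'y) cylinder"
  assumes cylob_Obj: "C \<in> Obj (one K) \<Longrightarrow> Y \<in> Obj (pob W C) \<Longrightarrow> X \<in> Obj (pob E C) \<Longrightarrow> cylob c C Y X \<in> Obj Z"
    and cylE_hom: "C \<in> Obj (one K) \<Longrightarrow> Y \<in> Obj (pob W C) \<Longrightarrow> u \<in> homset (pob E C) X X' \<Longrightarrow>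
      cylE c C Y u \<in> homset Z (cylob c C Y X) (cylob c C Y X')"
    and cylE_Idn: "C \<in> Obj (one K) \<Longrightarrow> Y \<in> Obj (pob W C) \<Longrightarrow> X \<in> Obj (pob E C) \<Longrightarrow>
      cylE c C Y (Idn (pob E C) X) = Idn Z (cylob c C Y X)"
    and cylE_Cmp: "C \<in> Obj (one K) \<Longrightarrow> Y \<in> Obj (pob W C) \<Longrightarrow> u \<in> homset (pob E C) X1 X2 \<Longrightarrow>
      u' \<in> homset (pob E C) X2 X3 \<Longrightarrow> cylE c C Y (Cmp (pob E C) u' u) = Cmp Z (cylE c C Y u') (cylE c C Y u)"
    and cylW_hom: "C \<in> Obj (one K) \<Longrightarrow> X \<in> Obj (pob E C) \<Longrightarrow> v \<in> homset (pob W C) Y Y' \<Longrightarrow>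
      cylW c C v X \<in> homset Z (cylob c C Y X) (cylob c C Y' X)"
    and cylW_Idn: "C \<in> Obj (one K) \<Longrightarrow> X \<in> Obj (pob E C) \<Longrightarrow> Y \<in> Obj (pob W C) \<Longrightarrow>
      cylW c C (Idn (pob W C) Y) X = Idn Z (cylob c C Y X)"
    and cylW_Cmp: "C \<in> Obj (one K) \<Longrightarrow> X \<in> Obj (pob E C) \<Longrightarrow> v \<in> homset (pob W C) Y1 Y2 \<Longrightarrow>
      v' \<in> homset (pob W C) Y2 Y3 \<Longrightarrow> cylW c C (Cmp (pob W C) v' v) X = Cmp Z (cylW c C v' X) (cylW c C v X)"
    and cyl_EW: "C \<in> Obj (one K) \<Longrightarrow> u \<in> homset (pob E C) X X' \<Longrightarrow> v \<in> homset (pob W C) Y Y' \<Longrightarrow>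
      Cmp Z (cylE c C Y' u) (cylW c C v X) = Cmp Z (cylW c C v X') (cylE c C Y u)"
    and cylc_hom: "f \<in> homset (one K) C D \<Longrightarrow> B \<in> Obj (pob W D) \<Longrightarrow> X \<in> Obj (pob E C) \<Longrightarrow>
      cylc c f B X \<in> homset Z (cylob c C (fob (pone W f) B) X) (cylob c D B (fob (pone E f) X))"
    and cylc_iso: "f \<in> homset (one K) C D \<Longrightarrow> B \<in> Obj (pob W D) \<Longrightarrow> X \<in> Obj (pob E C) \<Longrightarrow>
      iso_arr Z (cylc c f B X)"
    and cylc_E: "f \<in> homset (one K) C D \<Longrightarrow> B \<in> Obj (pob W D) \<Longrightarrow> u \<in> homset (pob E C) X X' \<Longrightarrow>
      Cmp Z (cylc c f B X') (cylE c C (fob (pone W f) B) u) = Cmp Z (cylE c D B (far (pone E f) u)) (cylc c f B X)"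
    and cylc_W: "f \<in> homset (one K) C D \<Longrightarrow> y \<in> homset (pob W D) B B' \<Longrightarrow> X \<in> Obj (pob E C) \<Longrightarrow>
      Cmp Z (cylc c f B' X) (cylW c C (far (pone W f) y) X) = Cmp Z (cylW c D y (fob (pone E f) X)) (cylc c f B X)"
    and cylc_two: "f \<in> homset (one K) C D \<Longrightarrow> \<alpha> \<in> homset (two K) f g \<Longrightarrow> B \<in> Obj (pob W D) \<Longrightarrow> X \<in> Obj (pob E C) \<Longrightarrow>
      Cmp Z (cylE c D B (ncmp (ptwo E \<alpha>) X)) (cylc c f B X) = Cmp Z (cylc c g B X) (cylW c C (ncmp (ptwo W \<alpha>) B) X)"
    and cylc_Idn: "C \<in> Obj (one K) \<Longrightarrow> Y \<in> Obj (pob W C) \<Longrightarrow> X \<in> Obj (pob E C) \<Longrightarrow>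
      cylc c (Idn (one K) C) Y X = Idn Z (cylob c C Y X)"
    and cylc_Cmp: "f \<in> homset (one K) C D \<Longrightarrow> g \<in> homset (one K) D D' \<Longrightarrow> B \<in> Obj (pob W D') \<Longrightarrow> X \<in> Obj (pob E C) \<Longrightarrow>
      Cmp Z (cylc c (Cmp (one K) g f) B X) (cylW c C (ncmp (pcmp W f g) B) X)
      = Cmp Z (cylE c D' B (ncmp (pcmp E g f) X))
          (Cmp Z (cylc c g B (fob (pone E f) X)) (cylc c f (fob (pone W g) B) X))"

context weighted_pair
begin

text \<open>Currying a cylinder: \<open>cyl_fun c C Y\<close> is the functor \<open>\<theta>\<^sub>C(Y)\<close>, \<open>cyl_nt c C v\<close> the natural transformation
  \<open>\<theta>\<^sub>C(v)\<close>, and \<open>cyl_cell c f B\<close> the component at \<open>B\<close> of the coherence cell at \<open>f\<close>.\<close>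

definition cyl_fun :: "('c, 'f, 'o, 'a, 'p, 'b, 'x, 'y) cylinder \<Rightarrow> 'c \<Rightarrow> 'p \<Rightarrow> ('o, 'a, 'x, 'y) ftor" where
  "cyl_fun c C Y = \<lparr>fob = (\<lambda>X\<in>Obj (pob E C). cylob c C Y X), far = (\<lambda>u\<in>Arr (pob E C). cylE c C Y u)\<rparr>"

definition cyl_nt :: "('c, 'f, 'o, 'a, 'p, 'b, 'x, 'y) cylinder \<Rightarrow> 'c \<Rightarrow> 'b \<Rightarrow> ('o, 'a, 'x, 'y) ntrans" where
  "cyl_nt c C v = \<lparr>nsrc = cyl_fun c C (Dom (pob W C) v), ntgt = cyl_fun c C (Cod (pob W C) v),
     ncmp = (\<lambda>X\<in>Obj (pob E C). cylW c C v X)\<rparr>"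

definition cyl_cell :: "('c, 'f, 'o, 'a, 'p, 'b, 'x, 'y) cylinder \<Rightarrow> 'f \<Rightarrow> 'p \<Rightarrow> ('o, 'a, 'x, 'y) ntrans" where
  "cyl_cell c f B = \<lparr>nsrc = cyl_fun c (Dom (one K) f) (fob (pone W f) B),
     ntgt = comp_functor (pob E (Dom (one K) f)) (cyl_fun c (Cod (one K) f) B) (pone E f),
     ncmp = (\<lambda>X\<in>Obj (pob E (Dom (one K) f)). cylc c f B X)\<rparr>"

definition cyl_tob where
  "cyl_tob c C = \<lparr>fob = (\<lambda>Y\<in>Obj (pob W C). cyl_fun c C Y), far = (\<lambda>v\<in>Arr (pob W C). cyl_nt c C v)\<rparr>"

definition cyl_pnat :: "('x, 'y) cat \<Rightarrow> ('c, 'f, 'o, 'a, 'p, 'b, 'x, 'y) cylinder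
    \<Rightarrow> ('c, 'f, 'p, 'b, ('o, 'a, 'x, 'y) ftor, ('o, 'a, 'x, 'y) ntrans) pnat" where
  "cyl_pnat Z c = \<lparr>tob = (\<lambda>C\<in>Obj (one K). cyl_tob c C),
     tone = (\<lambda>f\<in>Arr (one K).
       \<lparr>nsrc = comp_functor (pob W (Cod (one K) f)) (cyl_tob c (Dom (one K) f)) (pone W f),
        ntgt = comp_functor (pob W (Cod (one K) f)) (pone (CEX Z) f) (cyl_tob c (Cod (one K) f)),
        ncmp = (\<lambda>B\<in>Obj (pob W (Cod (one K) f)). cyl_cell c f B)\<rparr>)\<rparr>"

definition pnat_cyl :: "('c, 'f, 'p, 'b, ('o, 'a, 'x, 'y) ftor, ('o, 'a, 'x, 'y) ntrans) pnat
    \<Rightarrow> ('c, 'f, 'o, 'a, 'p, 'b, 'x, 'y) cylinder" where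
  "pnat_cyl \<theta> = \<lparr>cylob = (\<lambda>C Y X. fob (fob (tob \<theta> C) Y) X), cylE = (\<lambda>C Y u. far (fob (tob \<theta> C) Y) u),
     cylW = (\<lambda>C v X. ncmp (far (tob \<theta> C) v) X), cylc = (\<lambda>f B X. ncmp (ncmp (tone \<theta> f) B) X)\<rparr>"

lemma cyl_fun_simps [simp]:
  "X \<in> Obj (pob E C) \<Longrightarrow> fob (cyl_fun c C Y) X = cylob c C Y X"
  "u \<in> Arr (pob E C) \<Longrightarrow> far (cyl_fun c C Y) u = cylE c C Y u"
  by (simp_all add: cyl_fun_def)

lemma cyl_nt_simps [simp]:
  "nsrc (cyl_nt c C v) = cyl_fun c C (Dom (pob W C) v)" "ntgt (cyl_nt c C v) = cyl_fun c C (Cod (pob W C) v)"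
  "ncmp (cyl_nt c C v) = (\<lambda>X\<in>Obj (pob E C). cylW c C v X)"
  by (simp_all add: cyl_nt_def)

lemma cyl_cell_simps [simp]:
  "nsrc (cyl_cell c f B) = cyl_fun c (Dom (one K) f) (fob (pone W f) B)"
  "ntgt (cyl_cell c f B) = comp_functor (pob E (Dom (one K) f)) (cyl_fun c (Cod (one K) f) B) (pone E f)"
  "ncmp (cyl_cell c f B) = (\<lambda>X\<in>Obj (pob E (Dom (one K) f)). cylc c f B X)"
  by (simp_all add: cyl_cell_def)

lemma cyl_tob_simps [simp]:
  "Y \<in> Obj (pob W C) \<Longrightarrow> fob (cyl_tob c C) Y = cyl_fun c C Y"
  "v \<in> Arr (pob W C) \<Longrightarrow> far (cyl_tob c C) v = cyl_nt c C v"
  by (simp_all add: cyl_tob_def)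

lemma cyl_pnat_simps [simp]:
  "C \<in> Obj (one K) \<Longrightarrow> tob (cyl_pnat Z c) C = cyl_tob c C"
  "f \<in> Arr (one K) \<Longrightarrow> nsrc (tone (cyl_pnat Z c) f)
    = comp_functor (pob W (Cod (one K) f)) (cyl_tob c (Dom (one K) f)) (pone W f)"
  "f \<in> Arr (one K) \<Longrightarrow> ntgt (tone (cyl_pnat Z c) f)
    = comp_functor (pob W (Cod (one K) f)) (pone (CEX Z) f) (cyl_tob c (Cod (one K) f))"
  "f \<in> Arr (one K) \<Longrightarrow> ncmp (tone (cyl_pnat Z c) f) = (\<lambda>B\<in>Obj (pob W (Cod (one K) f)). cyl_cell c f B)"
  by (simp_all add: cyl_pnat_def del: Cat_into_simps)

lemma pnat_cyl_simps [simp]: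
  "cylob (pnat_cyl \<theta>) C Y X = fob (fob (tob \<theta> C) Y) X" "cylE (pnat_cyl \<theta>) C Y u = far (fob (tob \<theta> C) Y) u"
  "cylW (pnat_cyl \<theta>) C v X = ncmp (far (tob \<theta> C) v) X" "cylc (pnat_cyl \<theta>) f B X = ncmp (ncmp (tone \<theta> f) B) X"
  by (simp_all add: pnat_cyl_def)

end

subsection \<open>From cylinders to pseudo-natural transformations\<close>

context pseudo_cylinder
begin

lemma cylE_simps [simp]:
  assumes "C \<in> Obj (one K)" "Y \<in> Obj (pob W C)" "u \<in> Arr (pob E C)"
  shows "cylE c C Y u \<in> Arr Z" "Dom Z (cylE c C Y u) = cylob c C Y (Dom (pob E C) u)"
    "Cod Z (cylE c C Y u) = cylob c C Y (Cod (pob E C) u)"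
  using cylE_hom[OF assms(1,2)] assms(3) by (simp_all add: in_homset)

lemma cylW_simps [simp]:
  assumes "C \<in> Obj (one K)" "X \<in> Obj (pob E C)" "v \<in> Arr (pob W C)"
  shows "cylW c C v X \<in> Arr Z" "Dom Z (cylW c C v X) = cylob c C (Dom (pob W C) v) X"
    "Cod Z (cylW c C v X) = cylob c C (Cod (pob W C) v) X"
  using cylW_hom[OF assms(1,2)] assms(3) by (simp_all add: in_homset)

lemma cylc_simps:
  assumes "f \<in> homset (one K) C D" "B \<in> Obj (pob W D)" "X \<in> Obj (pob E C)"
  shows "cylc c f B X \<in> Arr Z" "Dom Z (cylc c f B X) = cylob c C (fob (pone W f) B) X"
    "Cod Z (cylc c f B X) = cylob c D B (fob (pone E f) X)"
  using cylc_hom[OF assms] by (simp_all add: in_homset)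

lemma cyl_fun_functor:
  assumes C: "C \<in> Obj (one K)" and Y: "Y \<in> Obj (pob W C)"
  shows "is_functor (pob E C) Z (cyl_fun c C Y)"
proof -
  interpret EC: category "pob E C" by (rule E.pob_category[OF C])
  show ?thesis
  proof (rule is_functorI[OF EC.category_axioms Z.category_axioms])
    show "fob (cyl_fun c C Y) \<in> extensional (Obj (pob E C))" "far (cyl_fun c C Y) \<in> extensional (Arr (pob E C))"
      by (simp_all add: cyl_fun_def)
    show "far (cyl_fun c C Y) (Cmp (pob E C) g f) = Cmp Z (far (cyl_fun c C Y) g) (far (cyl_fun c C Y) f)"
      if "f \<in> Arr (pob E C)" "g \<in> Arr (pob E C)" "Cod (pob E C) f = Dom (pob E C) g" for f g
      using that cylE_Cmp[OF C Y, of f "Dom (pob E C) f" "Cod (pob E C) f" g "Cod (pob E C) g"]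
      by (simp add: in_homset)
  qed (use C Y in \<open>simp_all add: cylob_Obj cylE_Idn\<close>)
qed

lemma cyl_nt_ntrans:
  assumes C: "C \<in> Obj (one K)" and v: "v \<in> Arr (pob W C)"
  shows "is_ntrans (pob E C) Z (cyl_nt c C v)"
proof -
  interpret EC: category "pob E C" by (rule E.pob_category[OF C])
  interpret WC: category "pob W C" by (rule W_category[OF C])
  show ?thesis
  proof (rule is_ntransI)
    show "Cmp Z (ncmp (cyl_nt c C v) (Cod (pob E C) u)) (far (nsrc (cyl_nt c C v)) u)
        = Cmp Z (far (ntgt (cyl_nt c C v)) u) (ncmp (cyl_nt c C v) (Dom (pob E C) u))"
      if "u \<in> Arr (pob E C)" for u
      using that v cyl_EW[OF C, of u "Dom (pob E C) u" "Cod (pob E C) u" v "Dom (pob W C) v" "Cod (pob W C) v"]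
      by (simp add: in_homset)
  qed (use C v in \<open>simp_all add: cyl_fun_functor\<close>)
qed

lemma cyl_tob_functor:
  assumes C: "C \<in> Obj (one K)"
  shows "is_functor (pob W C) (Fun (pob E C) Z) (cyl_tob c C)"
proof -
  interpret EC: category "pob E C" by (rule E.pob_category[OF C])
  interpret WC: category "pob W C" by (rule W_category[OF C])
  show ?thesis
  proof (rule is_functorI[OF WC.category_axioms category_functor_category[OF EC.category_axioms Z.category_axioms]])
    show "fob (cyl_tob c C) \<in> extensional (Obj (pob W C))" "far (cyl_tob c C) \<in> extensional (Arr (pob W C))"
      by (simp_all add: cyl_tob_def)
    show "far (cyl_tob c C) (Idn (pob W C) Y) = Idn (Fun (pob E C) Z) (fob (cyl_tob c C) Y)"
      if "Y \<in> Obj (pob W C)" for Y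
      using that C by (intro ntrans_eqI[where A = "pob E C"]) (simp_all add: cylW_Idn)
    show "far (cyl_tob c C) (Cmp (pob W C) w v)
        = Cmp (Fun (pob E C) Z) (far (cyl_tob c C) w) (far (cyl_tob c C) v)"
      if vw: "v \<in> Arr (pob W C)" "w \<in> Arr (pob W C)" "Cod (pob W C) v = Dom (pob W C) w" for v w
    proof (rule ntrans_eqI[where A = "pob E C"])
      show "ncmp (far (cyl_tob c C) (Cmp (pob W C) w v)) X
          = ncmp (Cmp (Fun (pob E C) Z) (far (cyl_tob c C) w) (far (cyl_tob c C) v)) X"
        if X: "X \<in> Obj (pob E C)" for X
        using vw X cylW_Cmp[OF C X, of v "Dom (pob W C) v" "Cod (pob W C) v" w "Cod (pob W C) w"]
        by (simp add: in_homset)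
    qed (use vw in simp_all)
  qed (use C in \<open>simp_all add: cyl_fun_functor cyl_nt_ntrans\<close>)
qed

lemma cyl_cell_ntrans:
  assumes f: "f \<in> homset (one K) C D" and B: "B \<in> Obj (pob W D)"
  shows "is_ntrans (pob E C) Z (cyl_cell c f B)"
proof -
  interpret f: one_cell K E W f C D by (rule one_cellI[OF f])
  have f': "Dom (one K) f = C" "Cod (one K) f = D" "C \<in> Obj (one K)" "D \<in> Obj (one K)" using f by (auto simp: in_homset)
  show ?thesis
  proof (rule is_ntransI)
    show "is_functor (pob E C) Z (nsrc (cyl_cell c f B))" "is_functor (pob E C) Z (ntgt (cyl_cell c f B))"
      using B is_functor_comp[OF E.pone_functor[OF f] cyl_fun_functor[OF f'(4) B]]
      by (simp_all add: f' cyl_fun_functor)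
    show "Cmp Z (ncmp (cyl_cell c f B) (Cod (pob E C) u)) (far (nsrc (cyl_cell c f B)) u)
        = Cmp Z (far (ntgt (cyl_cell c f B)) u) (ncmp (cyl_cell c f B) (Dom (pob E C) u))"
      if "u \<in> Arr (pob E C)" for u
      using that B cylc_E[OF f B, of u] by (simp add: f' in_homset)
  qed (use B cylc_simps[OF f B] in \<open>simp_all add: f'\<close>)
qed

lemma cyl_tone_ntrans:
  assumes f: "f \<in> homset (one K) C D"
  shows "is_ntrans (pob W D) (Fun (pob E C) Z) (tone (cyl_pnat Z c) f)"
proof -
  interpret f: one_cell K E W f C D by (rule one_cellI[OF f])
  have f': "f \<in> Arr (one K)" "Dom (one K) f = C" "Cod (one K) f = D" "C \<in> Obj (one K)" "D \<in> Obj (one K)"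
    using f by (auto simp: in_homset)
  show ?thesis
  proof (rule is_ntransI)
    show "is_functor (pob W D) (Fun (pob E C) Z) (nsrc (tone (cyl_pnat Z c) f))"
      using is_functor_comp[OF W_pone_functor[OF f] cyl_tob_functor[OF f'(4)]] by (simp add: f')
    show "is_functor (pob W D) (Fun (pob E C) Z) (ntgt (tone (cyl_pnat Z c) f))"
      using is_functor_comp[OF cyl_tob_functor[OF f'(5)] Cat_into_pone[OF Z.category_axioms f]]
      by (simp add: f' del: Cat_into_simps)
    show "Cmp (Fun (pob E C) Z) (ncmp (tone (cyl_pnat Z c) f) (Cod (pob W D) y)) (far (nsrc (tone (cyl_pnat Z c) f)) y)
        = Cmp (Fun (pob E C) Z) (far (ntgt (tone (cyl_pnat Z c) f)) y) (ncmp (tone (cyl_pnat Z c) f) (Dom (pob W D) y))"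
      if y: "y \<in> Arr (pob W D)" for y
    proof (rule ntrans_eqI[where A = "pob E C"])
      show "ncmp (Cmp (Fun (pob E C) Z) (ncmp (tone (cyl_pnat Z c) f) (Cod (pob W D) y)) (far (nsrc (tone (cyl_pnat Z c) f)) y)) X
        = ncmp (Cmp (Fun (pob E C) Z) (far (ntgt (tone (cyl_pnat Z c) f)) y) (ncmp (tone (cyl_pnat Z c) f) (Dom (pob W D) y))) X"
        if X: "X \<in> Obj (pob E C)" for X
        using X y cylc_W[OF f _ X, of y] cyl_nt_ntrans[OF f'(5) y] by (simp add: f' in_homset)
    qed (use y cyl_nt_ntrans[OF f'(5) y] in \<open>simp_all add: f'\<close>)
  qed (use cyl_cell_ntrans[OF f] cyl_fun_functor in \<open>simp_all add: f'\<close>)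
qed

text \<open>The components of each axiom at \<open>B\<close> in \<open>W\<close> and \<open>X\<close> in \<open>E\<close> are an axiom of cylinders.\<close>

lemma cyl_pnat_pseudonatural: "pseudonatural (op2 K) W (CEX Z) (cyl_pnat Z c)"
proof (intro pseudonatural.intro pseudonatural_axioms.intro W.pseudofunctor_axioms
    pseudofunctor_Cat_into Z.category_axioms, unfold op_unfold)
  show "tob (cyl_pnat Z c) \<in> extensional (Obj (one K))" "tone (cyl_pnat Z c) \<in> extensional (Arr (one K))"
    by (simp_all add: cyl_pnat_def)
  show "is_functor (pob W a) (pob (CEX Z) a) (tob (cyl_pnat Z c) a)" if "a \<in> Obj (one K)" for a
    using cyl_tob_functor[OF that] that by simp
  show "tone (cyl_pnat Z c) (Idn (one K) a)
      = Idn (Fun (pob W a) (pob (CEX Z) a)) (tob (cyl_pnat Z c) a)" if a: "a \<in> Obj (one K)" for a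
  proof (rule ntrans_eqI[where A = "pob W a"])
    show "ncmp (tone (cyl_pnat Z c) (Idn (one K) a)) Y
        = ncmp (Idn (Fun (pob W a) (pob (CEX Z) a)) (tob (cyl_pnat Z c) a)) Y"
      if Y: "Y \<in> Obj (pob W a)" for Y
      by (rule ntrans_eqI[where A = "pob E a"])
        (use a Y cyl_fun_functor[OF a Y] in \<open>simp_all add: cylc_Idn E.normalized comp_functor_id\<close>)
  qed (use a cyl_tob_functor[OF a] in \<open>simp_all add: E.normalized W.normalized[unfolded op_unfold]
      precomp_id E.pob_category Z.category_axioms comp_functor_id\<close>)
next
  fix f a b assume f: "f \<in> homset (one K) b a"
  then have f': "f \<in> Arr (one K)" "Dom (one K) f = b" "Cod (one K) f = a" "a \<in> Obj (one K)" "b \<in> Obj (one K)"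
    by (auto simp: in_homset)
  interpret f: one_cell K E W f b a by (rule one_cellI[OF f])
  show "tone (cyl_pnat Z c) f \<in> homset (Fun (pob W a) (pob (CEX Z) b))
      (comp_functor (pob W a) (tob (cyl_pnat Z c) b) (pone W f))
      (comp_functor (pob W a) (pone (CEX Z) f) (tob (cyl_pnat Z c) a))"
    using cyl_tone_ntrans[OF f] by (simp add: in_homset f')
  show "iso_arr (Fun (pob W a) (pob (CEX Z) b)) (tone (cyl_pnat Z c) f)"
    using cyl_tone_ntrans[OF f] cylc_iso[OF f]
    by (auto intro!: iso_arr_functor_categoryI cyl_cell_ntrans[OF f] simp: f')
  show "Cmp (Fun (pob W a) (pob (CEX Z) b)) (whisker_right (pob W a) (ptwo (CEX Z) \<alpha>) (tob (cyl_pnat Z c) a)) (tone (cyl_pnat Z c) f)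
      = Cmp (Fun (pob W a) (pob (CEX Z) b)) (tone (cyl_pnat Z c) g) (whisker_left (pob W a) (tob (cyl_pnat Z c) b) (ptwo W \<alpha>))"
    if \<alpha>: "\<alpha> \<in> homset (two K) f g" for \<alpha> g
  proof -
    have g: "g \<in> homset (one K) b a" and g': "g \<in> Arr (one K)" "Dom (one K) g = b" "Cod (one K) g = a"
      and \<alpha>': "\<alpha> \<in> Arr (two K)" "Dom (two K) \<alpha> = f" "Cod (two K) \<alpha> = g"
      using \<alpha> globular[of \<alpha>] two_simps(2)[of \<alpha>] by (simp_all add: in_homset)
    have W\<alpha>: "nsrc (ptwo W \<alpha>) = pone W f" "ntgt (ptwo W \<alpha>) = pone W g"
      using W.ptwo_hom[unfolded op_unfold, OF \<alpha> f] by (auto simp: in_homset)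
    have E\<alpha>: "nsrc (ptwo E \<alpha>) = pone E f" "ntgt (ptwo E \<alpha>) = pone E g"
      using E.ptwo_hom[OF \<alpha> f] by (auto simp: in_homset)
    have "Cmp (Fun (pob E b) Z) (whisker_left (pob E b) (cyl_fun c a B) (ptwo E \<alpha>)) (cyl_cell c f B)
        = Cmp (Fun (pob E b) Z) (cyl_cell c g B) (cyl_nt c b (ncmp (ptwo W \<alpha>) B))"
      if B: "B \<in> Obj (pob W a)" for B
      by (rule ntrans_eqI[where A = "pob E b"])
        (use f B W_ptwo_component[OF \<alpha> f B] E.ptwo_component[OF \<alpha> f] cylc_two[OF f \<alpha> B]
          in \<open>simp_all add: f' g' W\<alpha> E\<alpha>\<close>)
    then show ?thesis
      by (intro ntrans_eqI[where A = "pob W a"])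
        (use W_ptwo_component[OF \<alpha> f] in \<open>simp_all add: f' g' \<alpha>' W\<alpha> cyl_fun_functor\<close>)
  qed
next
  fix f g a b d assume f: "f \<in> homset (one K) b a" and g: "g \<in> homset (one K) d b"
  then have fg': "f \<in> Arr (one K)" "Dom (one K) f = b" "Cod (one K) f = a" "a \<in> Obj (one K)" "b \<in> Obj (one K)"
    "g \<in> Arr (one K)" "Dom (one K) g = d" "Cod (one K) g = b" "d \<in> Obj (one K)"
    by (auto simp: in_homset)
  note fg = E.Cmp_one_homset[OF g f]
  interpret f: one_cell K E W f b a by (rule one_cellI[OF f])
  interpret g: one_cell K E W g d b by (rule one_cellI[OF g])
  have Wpc: "nsrc (pcmp W g f) = comp_functor (pob W a) (pone W g) (pone W f)" "ntgt (pcmp W g f) = pone W (Cmp (one K) f g)"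
    using W.pcmp_hom[unfolded op_unfold, OF f g] by (simp_all add: in_homset)
  have Epc: "nsrc (pcmp E f g) = comp_functor (pob E d) (pone E f) (pone E g)" "ntgt (pcmp E f g) = pone E (Cmp (one K) f g)"
    using E.pcmp_hom[OF g f] by (simp_all add: in_homset)
  have "Cmp (Fun (pob E d) Z) (cyl_cell c (Cmp (one K) f g) B) (cyl_nt c d (ncmp (pcmp W g f) B))
      = Cmp (Fun (pob E d) Z) (whisker_left (pob E d) (cyl_fun c a B) (pcmp E f g))
          (Cmp (Fun (pob E d) Z) (whisker_right (pob E d) (cyl_cell c f B) (pone E g))
            (cyl_cell c g (fob (pone W f) B)))"
    if B: "B \<in> Obj (pob W a)" for B
    by (rule ntrans_eqI[where A = "pob E d"])
      (use B W_pcmp_component[OF f g B] E.pcmp_component[OF g f] cylc_Cmp[OF g f B]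
        in \<open>simp_all add: fg' Wpc Epc\<close>)
  then show "Cmp (Fun (pob W a) (pob (CEX Z) d)) (tone (cyl_pnat Z c) (Cmp (one K) f g))
        (whisker_left (pob W a) (tob (cyl_pnat Z c) d) (pcmp W g f))
      = Cmp (Fun (pob W a) (pob (CEX Z) d)) (whisker_right (pob W a) (pcmp (CEX Z) g f) (tob (cyl_pnat Z c) a))
          (Cmp (Fun (pob W a) (pob (CEX Z) d)) (whisker_left (pob W a) (pone (CEX Z) g) (tone (cyl_pnat Z c) f))
            (whisker_right (pob W a) (tone (cyl_pnat Z c) g) (pone W f)))"
    by (intro ntrans_eqI[where A = "pob W a"])
      (use W_pcmp_component[OF f g] cyl_cell_ntrans[OF f] in \<open>simp_all add: fg' Wpc cyl_fun_functor
        comp_functor_assoc[OF W_pone_functor[OF f]] comp_functor_assoc[OF cyl_tob_functor[OF fg'(4)]]\<close>)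
qed

end

subsection \<open>From pseudo-natural transformations to cylinders\<close>

context weighted_pair
begin

text \<open>The axioms of a cylinder are read off from functoriality and naturality of the parts of \<open>\<theta>\<close> and from
  the components of its coherence laws.\<close>

lemma pseudo_cylinder_pnat_cyl:
  fixes Z :: "('x, 'y) cat"
  assumes Z: "category Z" and \<theta>: "pseudonatural (op2 K) W (CEX Z) \<theta>"
  shows "pseudo_cylinder K E W Z (pnat_cyl \<theta>)"
proof -
  interpret Z: category Z by fact
  interpret \<theta>: pseudonatural "op2 K" W "CEX Z" \<theta> by fact
  have tobF: "is_functor (pob W C) (Fun (pob E C) Z) (tob \<theta> C)" if "C \<in> Obj (one K)" for C
    using \<theta>.tob_functor[of C] that by simp
  have funF: "is_functor (pob E C) Z (fob (tob \<theta> C) Y)" if "C \<in> Obj (one K)" "Y \<in> Obj (pob W C)" for C Y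
    using is_functor.fob_Obj[OF tobF[OF that(1)] that(2)] by simp
  have ntF: "is_ntrans (pob E C) Z (far (tob \<theta> C) v)" "nsrc (far (tob \<theta> C) v) = fob (tob \<theta> C) (Dom (pob W C) v)"
    "ntgt (far (tob \<theta> C) v) = fob (tob \<theta> C) (Cod (pob W C) v)"
    if "C \<in> Obj (one K)" "v \<in> Arr (pob W C)" for C v
    using is_functor.far_simps[OF tobF[OF that(1)] that(2)] by simp_all
  note toneF = \<theta>.tone_ntrans[unfolded op_unfold]
  have cellF: "is_ntrans (pob E C) Z (ncmp (tone \<theta> f) B)"
    "nsrc (ncmp (tone \<theta> f) B) = fob (tob \<theta> C) (fob (pone W f) B)"
    "ntgt (ncmp (tone \<theta> f) B) = comp_functor (pob E C) (fob (tob \<theta> D) B) (pone E f)"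
    if f: "f \<in> homset (one K) C D" and B: "B \<in> Obj (pob W D)" for f C D B
  proof -
    have D: "D \<in> Obj (one K)" "Dom (one K) f = C" "Cod (one K) f = D" using f by (auto simp: in_homset)
    show "is_ntrans (pob E C) Z (ncmp (tone \<theta> f) B)"
      "nsrc (ncmp (tone \<theta> f) B) = fob (tob \<theta> C) (fob (pone W f) B)"
      "ntgt (ncmp (tone \<theta> f) B) = comp_functor (pob E C) (fob (tob \<theta> D) B) (pone E f)"
      using \<theta>.tone_component[unfolded op_unfold, OF f B] funF[OF D(1) B] by (simp_all add: D)
  qed
  show ?thesis
  proof (intro pseudo_cylinder.intro pseudo_cylinder_axioms.intro weighted_pair_axioms Z, unfold pnat_cyl_simps)
    fix C assume C: "C \<in> Obj (one K)"
    fix Y assume Y: "Y \<in> Obj (pob W C)"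
    interpret Y: is_functor "pob E C" Z "fob (tob \<theta> C) Y" by (rule funF[OF C Y])
    fix X assume X: "X \<in> Obj (pob E C)"
    show "fob (fob (tob \<theta> C) Y) X \<in> Obj Z" using X by simp
    show "far (fob (tob \<theta> C) Y) (Idn (pob E C) X) = Idn Z (fob (fob (tob \<theta> C) Y) X)" using X by simp
    show "ncmp (far (tob \<theta> C) (Idn (pob W C) Y)) X = Idn Z (fob (fob (tob \<theta> C) Y) X)"
      using is_functor.far_Idn[OF tobF[OF C] Y] X by simp
    show "ncmp (ncmp (tone \<theta> (Idn (one K) C)) Y) X = Idn Z (fob (fob (tob \<theta> C) Y) X)"
      using \<theta>.tone_Idn[unfolded op_unfold, OF C] X Y by simp
  next
    fix C Y u X X' assume C: "C \<in> Obj (one K)" and Y: "Y \<in> Obj (pob W C)" and u: "u \<in> homset (pob E C) X X'"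
    interpret Y: is_functor "pob E C" Z "fob (tob \<theta> C) Y" by (rule funF[OF C Y])
    show "far (fob (tob \<theta> C) Y) u \<in> homset Z (fob (fob (tob \<theta> C) Y) X) (fob (fob (tob \<theta> C) Y) X')"
      using u by (rule Y.far_hom)
    show "far (fob (tob \<theta> C) Y) (Cmp (pob E C) u' u) = Cmp Z (far (fob (tob \<theta> C) Y) u') (far (fob (tob \<theta> C) Y) u)"
      if "u' \<in> homset (pob E C) X' X3" for u' X3
      using u that by (rule Y.far_Cmp)
  next
    fix C X v Y Y' assume C: "C \<in> Obj (one K)" and X: "X \<in> Obj (pob E C)" and v: "v \<in> homset (pob W C) Y Y'"
    then have v': "v \<in> Arr (pob W C)" "Dom (pob W C) v = Y" "Cod (pob W C) v = Y'" by (auto simp: in_homset)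
    interpret v: is_ntrans "pob E C" Z "far (tob \<theta> C) v" by (rule ntF[OF C v'(1)])
    show "ncmp (far (tob \<theta> C) v) X \<in> homset Z (fob (fob (tob \<theta> C) Y) X) (fob (fob (tob \<theta> C) Y') X)"
      using X ntF(2,3)[OF C v'(1)] by (simp add: in_homset v')
    show "ncmp (far (tob \<theta> C) (Cmp (pob W C) v2 v)) X = Cmp Z (ncmp (far (tob \<theta> C) v2) X) (ncmp (far (tob \<theta> C) v) X)"
      if "v2 \<in> homset (pob W C) Y' Y3" for v2 Y3
      using is_functor.far_Cmp[OF tobF[OF C] v that] X by simp
  next
    fix C u X X' v Y Y' assume C: "C \<in> Obj (one K)" and u: "u \<in> homset (pob E C) X X'" and v: "v \<in> homset (pob W C) Y Y'"
    then have v': "v \<in> Arr (pob W C)" "Dom (pob W C) v = Y" "Cod (pob W C) v = Y'" by (auto simp: in_homset)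
    interpret v: is_ntrans "pob E C" Z "far (tob \<theta> C) v" by (rule ntF[OF C v'(1)])
    show "Cmp Z (far (fob (tob \<theta> C) Y') u) (ncmp (far (tob \<theta> C) v) X)
        = Cmp Z (ncmp (far (tob \<theta> C) v) X') (far (fob (tob \<theta> C) Y) u)"
      using v.natural[OF u] ntF(2,3)[OF C v'(1)] by (simp add: v')
  next
    fix f C D B X assume f: "f \<in> homset (one K) C D" and B: "B \<in> Obj (pob W D)" and X: "X \<in> Obj (pob E C)"
    interpret cell: is_ntrans "pob E C" Z "ncmp (tone \<theta> f) B" by (rule cellF(1)[OF f B])
    show "ncmp (ncmp (tone \<theta> f) B) X
        \<in> homset Z (fob (fob (tob \<theta> C) (fob (pone W f) B)) X) (fob (fob (tob \<theta> D) B) (fob (pone E f) X))"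
      using X cellF(2,3)[OF f B] by (simp add: in_homset)
    show "iso_arr Z (ncmp (ncmp (tone \<theta> f) B) X)"
      using iso_arr_ncmp[OF iso_arr_ncmp[OF \<theta>.tone_iso[unfolded op_unfold, OF f, unfolded Cat_into_simps] B] X] .
    have D: "D \<in> Obj (one K)" "Dom (one K) f = C" "Cod (one K) f = D" using f by (auto simp: in_homset)
    show "Cmp Z (far (fob (tob \<theta> D) B) (ncmp (ptwo E \<alpha>) X)) (ncmp (ncmp (tone \<theta> f) B) X)
        = Cmp Z (ncmp (ncmp (tone \<theta> g) B) X) (ncmp (far (tob \<theta> C) (ncmp (ptwo W \<alpha>) B)) X)"
      if \<alpha>: "\<alpha> \<in> homset (two K) f g" for \<alpha> g
    proof -
      have "Dom (two K) \<alpha> = f" using \<alpha> by (simp add: in_homset)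
      then show ?thesis
        using \<theta>.tone_natural[unfolded op_unfold, OF f \<alpha>, THEN arg_cong[where f = "\<lambda>\<tau>. ncmp (ncmp \<tau> B) X"]] B X
        by (simp add: D funF[OF D(1) B])
    qed
  next
    fix f C D B u X X' assume f: "f \<in> homset (one K) C D" and B: "B \<in> Obj (pob W D)" and u: "u \<in> homset (pob E C) X X'"
    interpret cell: is_ntrans "pob E C" Z "ncmp (tone \<theta> f) B" by (rule cellF(1)[OF f B])
    show "Cmp Z (ncmp (ncmp (tone \<theta> f) B) X') (far (fob (tob \<theta> C) (fob (pone W f) B)) u)
        = Cmp Z (far (fob (tob \<theta> D) B) (far (pone E f) u)) (ncmp (ncmp (tone \<theta> f) B) X)"
      using cell.natural[OF u] u cellF(2,3)[OF f B] by (simp add: in_homset)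
  next
    fix f C D y B B' X assume f: "f \<in> homset (one K) C D" and y: "y \<in> homset (pob W D) B B'" and X: "X \<in> Obj (pob E C)"
    then have D: "D \<in> Obj (one K)" "Dom (one K) f = C" "Cod (one K) f = D" "y \<in> Arr (pob W D)" by (auto simp: in_homset)
    interpret t: is_ntrans "pob W D" "Fun (pob E C) Z" "tone \<theta> f"
      using toneF(1)[OF f] by simp
    show "Cmp Z (ncmp (ncmp (tone \<theta> f) B') X) (ncmp (far (tob \<theta> C) (far (pone W f) y)) X)
        = Cmp Z (ncmp (far (tob \<theta> D) y) (fob (pone E f) X)) (ncmp (ncmp (tone \<theta> f) B) X)"
      using t.natural[OF y, THEN arg_cong[where f = "\<lambda>\<tau>. ncmp \<tau> X"]] X
      by (simp add: toneF[OF f] D ntF[OF D(1,4)])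
  next
    fix f g C D D' B X assume f: "f \<in> homset (one K) C D" and g: "g \<in> homset (one K) D D'"
      and B: "B \<in> Obj (pob W D')" and X: "X \<in> Obj (pob E C)"
    then have D: "D \<in> Obj (one K)" "Dom (one K) f = C" "Cod (one K) f = D" "Dom (one K) g = D" "Cod (one K) g = D'"
      "D' \<in> Obj (one K)" by (auto simp: in_homset)
    show "Cmp Z (ncmp (ncmp (tone \<theta> (Cmp (one K) g f)) B) X) (ncmp (far (tob \<theta> C) (ncmp (pcmp W f g) B)) X)
        = Cmp Z (far (fob (tob \<theta> D') B) (ncmp (pcmp E g f) X))
          (Cmp Z (ncmp (ncmp (tone \<theta> g) B) (fob (pone E f) X)) (ncmp (ncmp (tone \<theta> f) (fob (pone W g) B)) X))"
      using \<theta>.tone_Cmp[unfolded op_unfold, OF g f, THEN arg_cong[where f = "\<lambda>\<tau>. ncmp (ncmp \<tau> B) X"]] B X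
      by (simp add: D funF[OF D(6) B] cellF[OF g B])
  qed
qed

text \<open>Currying recovers \<open>\<theta>\<close> itself, not merely an isomorphic copy, because all the data that make up a
  pseudo-natural transformation are extensional.\<close>

lemma cyl_pnat_pnat_cyl:
  assumes Z: "category Z" and \<theta>: "pseudonatural (op2 K) W (CEX Z) \<theta>"
  shows "cyl_pnat Z (pnat_cyl \<theta>) = \<theta>"
proof -
  interpret \<theta>: pseudonatural "op2 K" W "CEX Z" \<theta> by fact
  interpret c: pseudo_cylinder K E W Z "pnat_cyl \<theta>" by (rule pseudo_cylinder_pnat_cyl[OF Z \<theta>])
  interpret c\<theta>: pseudonatural "op2 K" W "CEX Z" "cyl_pnat Z (pnat_cyl \<theta>)" by (rule c.cyl_pnat_pseudonatural)
  have fun_eq: "cyl_fun (pnat_cyl \<theta>) C Y = fob (tob \<theta> C) Y" if C: "C \<in> Obj (one K)" and Y: "Y \<in> Obj (pob W C)" for C Y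
    using is_functor.fob_Obj[OF \<theta>.tob_functor[unfolded op_unfold, OF C] Y]
    by (intro functor_eqI[OF c.cyl_fun_functor[OF C Y]]) simp_all
  have tob: "cyl_tob (pnat_cyl \<theta>) C = tob \<theta> C" if C: "C \<in> Obj (one K)" for C
  proof (rule functor_eqI[OF c.cyl_tob_functor[OF C]])
    interpret tob: is_functor "pob W C" "Fun (pob E C) Z" "tob \<theta> C"
      using \<theta>.tob_functor[unfolded op_unfold, OF C] by simp
    show "is_functor (pob W C) (Fun (pob E C) Z) (tob \<theta> C)" ..
    show "fob (cyl_tob (pnat_cyl \<theta>) C) Y = fob (tob \<theta> C) Y" if "Y \<in> Obj (pob W C)" for Y
      using that C by (simp add: fun_eq)
    show "far (cyl_tob (pnat_cyl \<theta>) C) v = far (tob \<theta> C) v" if v: "v \<in> Arr (pob W C)" for v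
      using tob.far_simps[OF v] tob.A.Dom_Obj[OF v] tob.A.Cod_Obj[OF v] v C
      by (intro ntrans_eqI[where A = "pob E C"]) (simp_all add: fun_eq is_ntrans.ncmp_ext)
  qed
  have tone: "tone (cyl_pnat Z (pnat_cyl \<theta>)) f = tone \<theta> f" if f0: "f \<in> Arr (one K)" for f
  proof -
    obtain C D where f: "f \<in> homset (one K) C D" using f0 unfolding in_homset by blast
    then have D: "f \<in> Arr (one K)" "C \<in> Obj (one K)" "D \<in> Obj (one K)" "Dom (one K) f = C" "Cod (one K) f = D"
      by (auto simp: in_homset)
    interpret t: is_ntrans "pob W D" "Fun (pob E C) Z" "tone \<theta> f"
      using \<theta>.tone_ntrans[unfolded op_unfold, OF f] by simp
    interpret f: one_cell K E W f C D by (rule one_cellI[OF f])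
    interpret tob: is_functor "pob W D" "Fun (pob E D) Z" "tob \<theta> D"
      using \<theta>.tob_functor[unfolded op_unfold, OF D(3)] by simp
    show ?thesis
    proof (rule ntrans_eqI[where A = "pob W D"])
      show "ncmp (tone (cyl_pnat Z (pnat_cyl \<theta>)) f) B = ncmp (tone \<theta> f) B" if B: "B \<in> Obj (pob W D)" for B
        using t.ncmp_simps[OF B] B tob.fob_Obj[OF B]
        by (intro ntrans_eqI[where A = "pob E C"])
          (simp_all add: D fun_eq is_ntrans.ncmp_ext \<theta>.tone_ntrans(2,3)[unfolded op_unfold, OF f])
    qed (simp_all add: D tob t.ncmp_ext \<theta>.tone_ntrans(2,3)[unfolded op_unfold, OF f])
  qed
  show ?thesis
  proof (rule pnat.equality)
    show "tob (cyl_pnat Z (pnat_cyl \<theta>)) = tob \<theta>"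
      using \<theta>.tob_ext c\<theta>.tob_ext by (auto intro!: extensionalityI simp: tob)
    show "tone (cyl_pnat Z (pnat_cyl \<theta>)) = tone \<theta>"
      using \<theta>.tone_ext c\<theta>.tone_ext by (auto intro!: extensionalityI simp: tone)
  qed simp
qed

lemma cyl_pnat_eqD:
  assumes "cyl_pnat Z c = cyl_pnat Z d"
  shows "C \<in> Obj (one K) \<Longrightarrow> Y \<in> Obj (pob W C) \<Longrightarrow> X \<in> Obj (pob E C) \<Longrightarrow> cylob c C Y X = cylob d C Y X"
    "C \<in> Obj (one K) \<Longrightarrow> Y \<in> Obj (pob W C) \<Longrightarrow> u \<in> Arr (pob E C) \<Longrightarrow> cylE c C Y u = cylE d C Y u"
    "C \<in> Obj (one K) \<Longrightarrow> v \<in> Arr (pob W C) \<Longrightarrow> X \<in> Obj (pob E C) \<Longrightarrow> cylW c C v X = cylW d C v X"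
    "f \<in> homset (one K) C D \<Longrightarrow> B \<in> Obj (pob W D) \<Longrightarrow> X \<in> Obj (pob E C) \<Longrightarrow> cylc c f B X = cylc d f B X"
  using arg_cong[OF assms, of "\<lambda>\<theta>. fob (fob (tob \<theta> C) Y) X"]
    arg_cong[OF assms, of "\<lambda>\<theta>. far (fob (tob \<theta> C) Y) u"]
    arg_cong[OF assms, of "\<lambda>\<theta>. ncmp (far (tob \<theta> C) v) X"]
    arg_cong[OF assms, of "\<lambda>\<theta>. ncmp (ncmp (tone \<theta> f) B) X"]
  by (simp_all add: in_homset)

end

section \<open>The universal cylinder\<close>

context weighted_pair
begin

text \<open>The three kinds of 1-cells \<open>(1, u, 1)\<close>, \<open>(1, 1, v)\<close> and \<open>(f, 1, 1)\<close>. Composing with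
  the first two kinds involves no coherence cells because \<open>E\<close> and \<open>W\<close> are normalized.\<close>

definition dE where
  "dE C Y u = ((C, Dom (pob E C) u, Y), (Idn (one K) C, u, Idn (pob W C) Y), (C, Cod (pob E C) u, Y))"

definition dW where
  "dW C v X = ((C, X, Dom (pob W C) v), (Idn (one K) C, Idn (pob E C) X, v), (C, X, Cod (pob W C) v))"

definition dc where
  "dc f B X = ((Dom (one K) f, X, fob (pone W f) B),
     (f, Idn (pob E (Cod (one K) f)) (fob (pone E f) X), Idn (pob W (Dom (one K) f)) (fob (pone W f) B)),
     (Cod (one K) f, fob (pone E f) X, B))"

lemma dE_Arr:
  assumes "C \<in> Obj (one K)" "Y \<in> Obj (pob W C)" "u \<in> Arr (pob E C)"
  shows "dE C Y u \<in> Arr D1" "Dom D1 (dE C Y u) = (C, Dom (pob E C) u, Y)" "Cod D1 (dE C Y u) = (C, Cod (pob E C) u, Y)"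
  using assms E.pob_category[of C] W_category[of C]
  by (simp_all add: dE_def Delta_one_Arr Delta_one_Obj in_homset category.Idn_simps category.Dom_Cod_Obj)

lemma dW_Arr:
  assumes "C \<in> Obj (one K)" "X \<in> Obj (pob E C)" "v \<in> Arr (pob W C)"
  shows "dW C v X \<in> Arr D1" "Dom D1 (dW C v X) = (C, X, Dom (pob W C) v)" "Cod D1 (dW C v X) = (C, X, Cod (pob W C) v)"
  using assms E.pob_category[of C] W_category[of C]
  by (simp_all add: dW_def Delta_one_Arr Delta_one_Obj in_homset category.Idn_simps category.Dom_Cod_Obj)

lemma dc_cartesian:
  assumes f: "f \<in> homset (one K) C D" and B: "B \<in> Obj (pob W D)" and X: "X \<in> Obj (pob E C)"
  shows "cartesian K E W (dc f B X)" "dc f B X \<in> Arr D1"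
    "Dom D1 (dc f B X) = (C, X, fob (pone W f) B)" "Cod D1 (dc f B X) = (D, fob (pone E f) X, B)"
proof -
  interpret f: one_cell K E W f C D by (rule one_cellI[OF f])
  show "cartesian K E W (dc f B X)" "dc f B X \<in> Arr D1"
    "Dom D1 (dc f B X) = (C, X, fob (pone W f) B)" "Cod D1 (dc f B X) = (D, fob (pone E f) X, B)"
    using f B X by (auto simp: cartesian_def dc_def Delta_one_Arr Delta_one_Obj in_homset)
qed

context
  fixes C X Y f u v D A B
  assumes a: "((C, X, Y), (f, u, v), (D, A, B)) \<in> Arr D1"
begin

lemma Cmp_dE_left:
  assumes "r \<in> homset (pob E D) A A'"
  shows "Cmp D1 (dE D B r) ((C, X, Y), (f, u, v), (D, A, B)) = ((C, X, Y), (f, Cmp (pob E D) r u, v), (D, A', B))"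
proof -
  have f: "f \<in> homset (one K) C D" and X: "X \<in> Obj (pob E C)" and B: "B \<in> Obj (pob W D)"
    using a by (auto simp: Delta_one_Arr Delta_one_Obj)
  interpret f: one_cell K E W f C D by (rule one_cellI[OF f])
  show ?thesis
    using a assms E.pcmp_unit_left_component[OF f X] W_pcmp_unit_right[OF f B]
    by (simp add: dE_def Delta_one_Arr Delta_one_Obj in_homset)
qed

lemma Cmp_dW_left:
  assumes "r \<in> homset (pob W D) B B'"
  shows "Cmp D1 (dW D r A) ((C, X, Y), (f, u, v), (D, A, B))
    = ((C, X, Y), (f, u, Cmp (pob W C) (far (pone W f) r) v), (D, A, B'))"
proof -
  have f: "f \<in> homset (one K) C D" and X: "X \<in> Obj (pob E C)" and B: "B' \<in> Obj (pob W D)"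
    using a assms category.Cod_Obj[OF W_category] by (auto simp: Delta_one_Arr Delta_one_Obj in_homset)
  interpret f: one_cell K E W f C D by (rule one_cellI[OF f])
  show ?thesis
    using a assms B E.pcmp_unit_left_component[OF f X] W_pcmp_unit_left[OF f B] W_pcmp_unit_right[OF f B]
    by (simp add: dW_def Delta_one_Arr Delta_one_Obj in_homset)
qed

lemma Cmp_dE_right:
  assumes "r \<in> homset (pob E C) X' X"
  shows "Cmp D1 ((C, X, Y), (f, u, v), (D, A, B)) (dE C Y r)
    = ((C, X', Y), (f, Cmp (pob E D) u (far (pone E f) r), v), (D, A, B))"
proof -
  have f: "f \<in> homset (one K) C D" and X: "X' \<in> Obj (pob E C)" and B: "B \<in> Obj (pob W D)"
    using a assms category.Dom_Obj[OF E.pob_category] by (auto simp: Delta_one_Arr Delta_one_Obj in_homset)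
  interpret f: one_cell K E W f C D by (rule one_cellI[OF f])
  show ?thesis
    using a assms X E.pcmp_unit_right_component[OF f X] W_pcmp_unit_left[OF f B] W_pcmp_unit_right[OF f B]
    by (simp add: dE_def Delta_one_Arr Delta_one_Obj in_homset)
qed

lemma Cmp_dW_right:
  assumes "r \<in> homset (pob W C) Y' Y"
  shows "Cmp D1 ((C, X, Y), (f, u, v), (D, A, B)) (dW C r X)
    = ((C, X, Y'), (f, u, Cmp (pob W C) v r), (D, A, B))"
proof -
  have f: "f \<in> homset (one K) C D" and X: "X \<in> Obj (pob E C)" and B: "B \<in> Obj (pob W D)"
    using a by (auto simp: Delta_one_Arr Delta_one_Obj)
  interpret f: one_cell K E W f C D by (rule one_cellI[OF f])
  show ?thesis
    using a assms E.pcmp_unit_right_component[OF f X] W_pcmp_unit_left[OF f B] W_pcmp_unit_right[OF f B]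
    by (simp add: dW_def Delta_one_Arr Delta_one_Obj in_homset)
qed

end

text \<open>This factorization leaves no choice in extending a cylinder to \<open>\<Delta>(E, W)\<close>.\<close>

lemma Delta_one_decomp:
  assumes a: "((C, X, Y), (f, u, v), (D, A, B)) \<in> Arr D1"
  shows "((C, X, Y), (f, u, v), (D, A, B)) = Cmp D1 (dE D B u) (Cmp D1 (dc f B X) (dW C v X))"
proof -
  have f: "f \<in> homset (one K) C D" and X: "X \<in> Obj (pob E C)" and B: "B \<in> Obj (pob W D)"
    and u: "u \<in> homset (pob E D) (fob (pone E f) X) A" and v: "v \<in> homset (pob W C) Y (fob (pone W f) B)"
    using a by (auto simp: Delta_one_Arr Delta_one_Obj)
  interpret f: one_cell K E W f C D by (rule one_cellI[OF f])
  have f': "Dom (one K) f = C" "Cod (one K) f = D" using f by (auto simp: in_homset)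
  note dc = dc_cartesian(2)[OF f B X, unfolded dc_def f']
  have eq: "Cmp D1 (dc f B X) (dW C v X) = ((C, X, Y), (f, Idn (pob E D) (fob (pone E f) X), v), (D, fob (pone E f) X, B))"
    using Cmp_dW_right[OF dc v] v by (simp add: dc_def f' in_homset)
  have "((C, X, Y), (f, Idn (pob E D) (fob (pone E f) X), v), (D, fob (pone E f) X, B)) \<in> Arr D1"
    using a f X B v by (simp add: Delta_one_Arr Delta_one_Obj in_homset)
  from Cmp_dE_left[OF this u] show ?thesis using u by (simp add: eq in_homset)
qed

abbreviation star_cyl :: "('c, 'f, 'o, 'a, 'p, 'b, ('c, 'o, 'p) dobj, ('c, 'f, 'o, 'a, 'p, 'b) star_arr) cylinder" where
  "star_cyl \<equiv> \<lparr>cylob = (\<lambda>C Y X. (C, X, Y)), cylE = (\<lambda>C Y u. cl (dE C Y u)),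
     cylW = (\<lambda>C v X. cl (dW C v X)), cylc = (\<lambda>f B X. cl (dc f B X))\<rparr>"

text \<open>The equations between composites hold already in \<open>\<Delta>(E, W)\<close>, with one exception: compatibility of the
  coherence cells with a 2-cell \<open>\<alpha>\<close> of \<open>K\<close> holds after passing to components, because \<open>\<alpha>\<close> is a 2-cell
  \<open>(f, \<alpha>\<^sub>!, 1) \<Rightarrow> (g, 1, \<alpha>\<^sup>*)\<close> of \<open>\<Delta>(E, W)\<close>.\<close>

lemma pseudo_cylinder_star: "pseudo_cylinder K E W St star_cyl"
proof (intro pseudo_cylinder.intro pseudo_cylinder_axioms.intro weighted_pair_axioms category_star, unfold cylinder.simps)
  fix C X Y assume C: "C \<in> Obj (one K)" and Y: "Y \<in> Obj (pob W C)" and X: "X \<in> Obj (pob E C)"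
  interpret EC: category "pob E C" by (rule E.pob_category[OF C])
  interpret WC: category "pob W C" by (rule W_category[OF C])
  have o: "(C, X, Y) \<in> Obj D1" using C X Y by (simp add: Delta_one_Obj)
  show "(C, X, Y) \<in> Obj St" using o by simp
  have "dE C Y (Idn (pob E C) X) = Idn D1 (C, X, Y)" "dW C (Idn (pob W C) Y) X = Idn D1 (C, X, Y)"
    "dc (Idn (one K) C) Y X = Idn D1 (C, X, Y)"
    using C X Y by (simp_all add: dE_def dW_def dc_def)
  then show "cl (dE C Y (Idn (pob E C) X)) = Idn St (C, X, Y)" "cl (dW C (Idn (pob W C) Y) X) = Idn St (C, X, Y)"
    "cl (dc (Idn (one K) C) Y X) = Idn St (C, X, Y)"
    using star_class_Idn[OF o] by (simp_all only:)
next
  fix C Y u X X' assume C: "C \<in> Obj (one K)" and Y: "Y \<in> Obj (pob W C)" and u: "u \<in> homset (pob E C) X X'"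
  then have u': "u \<in> Arr (pob E C)" "Dom (pob E C) u = X" "Cod (pob E C) u = X'" by (auto simp: in_homset)
  show "cl (dE C Y u) \<in> homset St (C, X, Y) (C, X', Y)"
    using dE_Arr[OF C Y u'(1)] by (simp add: in_homset u')
  fix r X3 assume r: "r \<in> homset (pob E C) X' X3"
  then have r': "r \<in> Arr (pob E C)" "Dom (pob E C) r = X'" "Cod (pob E C) r = X3" by (auto simp: in_homset)
  have "Cmp D1 (dE C Y r) (dE C Y u) = dE C Y (Cmp (pob E C) r u)"
    using Cmp_dE_left[OF dE_Arr(1)[OF C Y u'(1), unfolded dE_def u'] r] u' r' category.Cmp_simps[OF E.pob_category[OF C]]
    by (simp add: dE_def)
  then show "cl (dE C Y (Cmp (pob E C) r u)) = Cmp St (cl (dE C Y r)) (cl (dE C Y u))"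
    using star_class_Cmp[of "dE C Y u" "dE C Y r"] dE_Arr[OF C Y u'(1)] dE_Arr[OF C Y r'(1)] by (simp add: u' r')
next
  fix C X v Y Y' assume C: "C \<in> Obj (one K)" and X: "X \<in> Obj (pob E C)" and v: "v \<in> homset (pob W C) Y Y'"
  then have v': "v \<in> Arr (pob W C)" "Dom (pob W C) v = Y" "Cod (pob W C) v = Y'" by (auto simp: in_homset)
  show "cl (dW C v X) \<in> homset St (C, X, Y) (C, X, Y')"
    using dW_Arr[OF C X v'(1)] by (simp add: in_homset v')
  fix r Y3 assume r: "r \<in> homset (pob W C) Y' Y3"
  then have r': "r \<in> Arr (pob W C)" "Dom (pob W C) r = Y'" "Cod (pob W C) r = Y3" by (auto simp: in_homset)
  have "Cmp D1 (dW C r X) (dW C v X) = dW C (Cmp (pob W C) r v) X"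
    using Cmp_dW_left[OF dW_Arr(1)[OF C X v'(1), unfolded dW_def v'] r] v' r' C category.Cmp_simps[OF W_category[OF C]]
    by (simp add: dW_def)
  then show "cl (dW C (Cmp (pob W C) r v) X) = Cmp St (cl (dW C r X)) (cl (dW C v X))"
    using star_class_Cmp[of "dW C v X" "dW C r X"] dW_Arr[OF C X v'(1)] dW_Arr[OF C X r'(1)] by (simp add: v' r')
next
  fix C u X X' v Y Y' assume C: "C \<in> Obj (one K)" and u: "u \<in> homset (pob E C) X X'" and v: "v \<in> homset (pob W C) Y Y'"
  interpret EC: category "pob E C" by (rule E.pob_category[OF C])
  interpret WC: category "pob W C" by (rule W_category[OF C])
  have u': "u \<in> Arr (pob E C)" "Dom (pob E C) u = X" "Cod (pob E C) u = X'" using u by (auto simp: in_homset)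
  have v': "v \<in> Arr (pob W C)" "Dom (pob W C) v = Y" "Cod (pob W C) v = Y'" using v by (auto simp: in_homset)
  have o: "X \<in> Obj (pob E C)" "X' \<in> Obj (pob E C)" "Y \<in> Obj (pob W C)" "Y' \<in> Obj (pob W C)" using u' v' by auto
  note dv = dW_Arr[OF C o(1) v'(1)] dW_Arr[OF C o(2) v'(1)] and du = dE_Arr[OF C o(3) u'(1)] dE_Arr[OF C o(4) u'(1)]
  have "Cmp D1 (dE C Y' u) (dW C v X) = Cmp D1 (dW C v X') (dE C Y u)"
    using Cmp_dE_left[OF dv(1)[unfolded dW_def v'] u] Cmp_dW_left[OF du(1)[unfolded dE_def u'] v] u' v' C o
    by (simp add: dW_def dE_def)
  then show "Cmp St (cl (dE C Y' u)) (cl (dW C v X)) = Cmp St (cl (dW C v X')) (cl (dE C Y u))"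
    using star_class_Cmp[of "dW C v X" "dE C Y' u"] star_class_Cmp[of "dE C Y u" "dW C v X'"] dv du
    by (simp add: u' v')
next
  fix f C D B X assume f: "f \<in> homset (one K) C D" and B: "B \<in> Obj (pob W D)" and X: "X \<in> Obj (pob E C)"
  note dc = dc_cartesian[OF f B X]
  show "cl (dc f B X) \<in> homset St (C, X, fob (pone W f) B) (D, fob (pone E f) X, B)"
    using dc by (simp add: in_homset)
  show "iso_arr St (cl (dc f B X))" using dc(1) by (rule iso_star_class)
  fix \<alpha> g assume \<alpha>: "\<alpha> \<in> homset (two K) f g"
  then have g: "g \<in> homset (one K) C D" using f by (auto simp: in_homset)
  interpret f: one_cell K E W f C D by (rule one_cellI[OF f])
  interpret g: one_cell K E W g C D by (rule one_cellI[OF g])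
  have f': "Dom (one K) f = C" "Cod (one K) f = D" "Dom (one K) g = C" "Cod (one K) g = D" "C \<in> Obj (one K)" "D \<in> Obj (one K)"
    using f g by (auto simp: in_homset)
  note dg = dc_cartesian[OF g B X] and E\<alpha> = E.ptwo_component[OF \<alpha> f X] and W\<alpha> = W_ptwo_component[OF \<alpha> f B]
  have h: "ncmp (ptwo E \<alpha>) X \<in> homset (pob E D) (fob (pone E f) X) (fob (pone E g) X)"
    "ncmp (ptwo W \<alpha>) B \<in> homset (pob W C) (fob (pone W f) B) (fob (pone W g) B)"
    using E\<alpha> W\<alpha> by (simp_all add: in_homset)
  have 1: "Cmp D1 (dE D B (ncmp (ptwo E \<alpha>) X)) (dc f B X)
      = ((C, X, fob (pone W f) B), (f, ncmp (ptwo E \<alpha>) X, Idn (pob W C) (fob (pone W f) B)), (D, fob (pone E g) X, B))"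
    using Cmp_dE_left[OF dc(2)[unfolded dc_def f'] h(1)] E\<alpha> by (simp add: dc_def f')
  have 2: "Cmp D1 (dc g B X) (dW C (ncmp (ptwo W \<alpha>) B) X)
      = ((C, X, fob (pone W f) B), (g, Idn (pob E D) (fob (pone E g) X), ncmp (ptwo W \<alpha>) B), (D, fob (pone E g) X, B))"
    using Cmp_dW_right[OF dg(2)[unfolded dc_def f'] h(2)] W\<alpha> by (simp add: dc_def f')
  have "(Cmp D1 (dE D B (ncmp (ptwo E \<alpha>) X)) (dc f B X), \<alpha>, Cmp D1 (dc g B X) (dW C (ncmp (ptwo W \<alpha>) B) X)) \<in> Arr (two D2)"
    unfolding 1 2 Delta_two_Arr Delta_one_Arr using f g \<alpha> X B E\<alpha> W\<alpha> f'
    by (simp add: Delta_one_Obj in_homset)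
  from star_class_two_cell[OF this]
  show "Cmp St (cl (dE D B (ncmp (ptwo E \<alpha>) X))) (cl (dc f B X)) = Cmp St (cl (dc g B X)) (cl (dW C (ncmp (ptwo W \<alpha>) B) X))"
    using star_class_Cmp[of "dc f B X" "dE D B (ncmp (ptwo E \<alpha>) X)"] star_class_Cmp[of "dW C (ncmp (ptwo W \<alpha>) B) X" "dc g B X"]
      dE_Arr[OF f'(6) B E\<alpha>(1)] dW_Arr[OF f'(5) X W\<alpha>(1)] dc dg E\<alpha> W\<alpha> by simp
next
  fix f C D B u X X' assume f: "f \<in> homset (one K) C D" and B: "B \<in> Obj (pob W D)" and u: "u \<in> homset (pob E C) X X'"
  interpret f: one_cell K E W f C D by (rule one_cellI[OF f])
  have f': "Dom (one K) f = C" "Cod (one K) f = D" "C \<in> Obj (one K)" "D \<in> Obj (one K)" using f by (auto simp: in_homset)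
  have u': "u \<in> Arr (pob E C)" "Dom (pob E C) u = X" "Cod (pob E C) u = X'" using u by (auto simp: in_homset)
  have o: "X \<in> Obj (pob E C)" "X' \<in> Obj (pob E C)" "fob (pone W f) B \<in> Obj (pob W C)"
    "far (pone E f) u \<in> Arr (pob E D)" using u' B by auto
  note dc = dc_cartesian[OF f B o(1)] dc_cartesian[OF f B o(2)]
  note du = dE_Arr[OF f'(3) o(3) u'(1)] dE_Arr[OF f'(4) B o(4)]
  have "Cmp D1 (dc f B X') (dE C (fob (pone W f) B) u) = Cmp D1 (dE D B (far (pone E f) u)) (dc f B X)"
    using Cmp_dE_right[OF dc(6)[unfolded dc_def f'] u] Cmp_dE_left[OF dc(2)[unfolded dc_def f'] f.Ef.far_hom[OF u]] u'
    by (simp add: dc_def f')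
  then show "Cmp St (cl (dc f B X')) (cl (dE C (fob (pone W f) B) u)) = Cmp St (cl (dE D B (far (pone E f) u))) (cl (dc f B X))"
    using star_class_Cmp[of "dE C (fob (pone W f) B) u" "dc f B X'"] star_class_Cmp[of "dc f B X" "dE D B (far (pone E f) u)"] dc du u'
    by simp
next
  fix f C D y B B' X assume f: "f \<in> homset (one K) C D" and y: "y \<in> homset (pob W D) B B'" and X: "X \<in> Obj (pob E C)"
  interpret f: one_cell K E W f C D by (rule one_cellI[OF f])
  have f': "Dom (one K) f = C" "Cod (one K) f = D" "C \<in> Obj (one K)" "D \<in> Obj (one K)" using f by (auto simp: in_homset)
  have y': "y \<in> Arr (pob W D)" "Dom (pob W D) y = B" "Cod (pob W D) y = B'" using y by (auto simp: in_homset)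
  have o: "B \<in> Obj (pob W D)" "B' \<in> Obj (pob W D)" "fob (pone E f) X \<in> Obj (pob E D)"
    "far (pone W f) y \<in> Arr (pob W C)" using y' X by auto
  note dc = dc_cartesian[OF f o(1) X] dc_cartesian[OF f o(2) X]
  note dy = dW_Arr[OF f'(4) o(3) y'(1)] dW_Arr[OF f'(3) X o(4)]
  have "Cmp D1 (dc f B' X) (dW C (far (pone W f) y) X) = Cmp D1 (dW D y (fob (pone E f) X)) (dc f B X)"
    using Cmp_dW_right[OF dc(6)[unfolded dc_def f'] f.Wf.far_hom[OF y]] Cmp_dW_left[OF dc(2)[unfolded dc_def f'] y] y'
    by (simp add: dc_def f')
  then show "Cmp St (cl (dc f B' X)) (cl (dW C (far (pone W f) y) X)) = Cmp St (cl (dW D y (fob (pone E f) X))) (cl (dc f B X))"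
    using star_class_Cmp[of "dW C (far (pone W f) y) X" "dc f B' X"] star_class_Cmp[of "dc f B X" "dW D y (fob (pone E f) X)"] dc dy y'
    by simp
next
  fix f g C D D' B X assume f: "f \<in> homset (one K) C D" and g: "g \<in> homset (one K) D D'"
    and B: "B \<in> Obj (pob W D')" and X: "X \<in> Obj (pob E C)"
  interpret f: one_cell K E W f C D by (rule one_cellI[OF f])
  interpret g: one_cell K E W g D D' by (rule one_cellI[OF g])
  note gf = E.Cmp_one_homset[OF f g]
  have f': "f \<in> Arr (one K)" "g \<in> Arr (one K)" "Dom (one K) f = C" "Cod (one K) f = D" "Dom (one K) g = D" "Cod (one K) g = D'"
    "C \<in> Obj (one K)" "D' \<in> Obj (one K)"
    using f g by (auto simp: in_homset)
  have o: "fob (pone E f) X \<in> Obj (pob E D)" "fob (pone W g) B \<in> Obj (pob W D)" using X B by auto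
  note Ep = E.pcmp_component[OF f g X] and Wp = W_pcmp_component[OF g f B]
  have h: "ncmp (pcmp E g f) X \<in> homset (pob E D') (fob (pone E g) (fob (pone E f) X)) (fob (pone E (Cmp (one K) g f)) X)"
    "ncmp (pcmp W f g) B \<in> homset (pob W C) (fob (pone W f) (fob (pone W g) B)) (fob (pone W (Cmp (one K) g f)) B)"
    using Ep Wp by (simp_all add: in_homset)
  note dgf = dc_cartesian[OF gf B X] and df = dc_cartesian[OF f o(2) X] and dg = dc_cartesian[OF g B o(1)]
  note dp = dE_Arr[OF f'(8) B Ep(1)] and dq = dW_Arr[OF f'(7) X Wp(1)]
  interpret D: category D1 by (rule category_Delta_one)
  have c: "Cmp D1 (dc g B (fob (pone E f) X)) (dc f (fob (pone W g) B) X)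
      = ((C, X, fob (pone W f) (fob (pone W g) B)),
         (Cmp (one K) g f, inv_arr (pob E D') (ncmp (pcmp E g f) X), ncmp (pcmp W f g) B),
         (D', fob (pone E g) (fob (pone E f) X), B))"
    using X B Ep Wp by (simp add: dc_def f')
  have cA: "Cmp D1 (dc g B (fob (pone E f) X)) (dc f (fob (pone W g) B) X) \<in> Arr D1"
    using df dg by simp
  have "Cmp D1 (dc (Cmp (one K) g f) B X) (dW C (ncmp (pcmp W f g) B) X)
      = Cmp D1 (dE D' B (ncmp (pcmp E g f) X)) (Cmp D1 (dc g B (fob (pone E f) X)) (dc f (fob (pone W g) B) X))"
    using Cmp_dW_right[OF dgf(2)[unfolded dc_def] , simplified f' one.Cmp_simps, OF h(2)]
      Cmp_dE_left[OF cA[unfolded c] h(1)] Ep Wp unfolding c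
    by (simp add: dc_def f')
  then show "Cmp St (cl (dc (Cmp (one K) g f) B X)) (cl (dW C (ncmp (pcmp W f g) B) X))
      = Cmp St (cl (dE D' B (ncmp (pcmp E g f) X)))
          (Cmp St (cl (dc g B (fob (pone E f) X))) (cl (dc f (fob (pone W g) B) X)))"
    using star_class_Cmp[of "dW C (ncmp (pcmp W f g) B) X" "dc (Cmp (one K) g f) B X"]
      star_class_Cmp[of "Cmp D1 (dc g B (fob (pone E f) X)) (dc f (fob (pone W g) B) X)" "dE D' B (ncmp (pcmp E g f) X)"]
      star_class_Cmp[of "dc f (fob (pone W g) B) X" "dc g B (fob (pone E f) X)"] dgf df dg dp dq Ep Wp cA
    by simp
qed

lemma xi_eq: "xi K E W = cyl_pnat St star_cyl"
proof -
  have fun_eq: "xi_ob K E W C Y = cyl_fun star_cyl C Y" for C Y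
    by (simp add: xi_ob_def cyl_fun_def dE_def)
  have nt: "xi_arr K E W C v = cyl_nt star_cyl C v" for C v
    by (simp add: xi_arr_def cyl_nt_def fun_eq dW_def)
  have tob: "\<lparr>fob = (\<lambda>Y\<in>Obj (pob W C). xi_ob K E W C Y), far = (\<lambda>v\<in>Arr (pob W C). xi_arr K E W C v)\<rparr>
      = cyl_tob star_cyl C" for C
    by (simp add: cyl_tob_def fun_eq nt)
  interpret S: pseudo_cylinder K E W St star_cyl by (rule pseudo_cylinder_star)
  have cell: "\<lparr>nsrc = \<lparr>fob = (\<lambda>B\<in>Obj (pob W D). xi_ob K E W C (fob (pone W f) B)),
                 far = (\<lambda>y\<in>Arr (pob W D). xi_arr K E W C (far (pone W f) y))\<rparr>,
         ntgt = \<lparr>fob = (\<lambda>B\<in>Obj (pob W D). comp_functor (pob E C) (xi_ob K E W D B) (pone E f)),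
                 far = (\<lambda>y\<in>Arr (pob W D). whisker_right (pob E C) (xi_arr K E W D y) (pone E f))\<rparr>,
         ncmp = (\<lambda>B\<in>Obj (pob W D).
           \<lparr>nsrc = xi_ob K E W C (fob (pone W f) B),
            ntgt = comp_functor (pob E C) (xi_ob K E W D B) (pone E f),
            ncmp = (\<lambda>X\<in>Obj (pob E C).
              cl ((C, X, fob (pone W f) B),
                 (f, Idn (pob E D) (fob (pone E f) X), Idn (pob W C) (fob (pone W f) B)),
                 (D, fob (pone E f) X, B)))\<rparr>)\<rparr>
    = \<lparr>nsrc = comp_functor (pob W D) (cyl_tob star_cyl C) (pone W f),
       ntgt = comp_functor (pob W D) (pone (CEX St) f) (cyl_tob star_cyl D),
       ncmp = (\<lambda>B\<in>Obj (pob W D). cyl_cell star_cyl f B)\<rparr>"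
    if f: "f \<in> homset (one K) C D" for f C D
  proof -
    have f': "Dom (one K) f = C" "Cod (one K) f = D" "C \<in> Obj (one K)" "D \<in> Obj (one K)" using f by (auto simp: in_homset)
    interpret f: one_cell K E W f C D by (rule one_cellI[OF f])
    have 1: "\<lparr>fob = (\<lambda>B\<in>Obj (pob W D). xi_ob K E W C (fob (pone W f) B)),
                 far = (\<lambda>y\<in>Arr (pob W D). xi_arr K E W C (far (pone W f) y))\<rparr>
      = comp_functor (pob W D) (cyl_tob star_cyl C) (pone W f)"
      by (simp add: comp_functor_def compose_def fun_eq nt cong: restrict_cong)
    have 2: "\<lparr>fob = (\<lambda>B\<in>Obj (pob W D). comp_functor (pob E C) (xi_ob K E W D B) (pone E f)),
                 far = (\<lambda>y\<in>Arr (pob W D). whisker_right (pob E C) (xi_arr K E W D y) (pone E f))\<rparr>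
      = comp_functor (pob W D) (pone (CEX St) f) (cyl_tob star_cyl D)"
      using S.cyl_fun_functor[OF f'(4)] S.cyl_nt_ntrans[OF f'(4)]
      by (simp add: comp_functor_def[of "pob W D"] compose_def fun_eq nt f' cong: restrict_cong)
    have 3: "\<lparr>nsrc = xi_ob K E W C (fob (pone W f) B),
            ntgt = comp_functor (pob E C) (xi_ob K E W D B) (pone E f),
            ncmp = (\<lambda>X\<in>Obj (pob E C).
              cl ((C, X, fob (pone W f) B),
                 (f, Idn (pob E D) (fob (pone E f) X), Idn (pob W C) (fob (pone W f) B)),
                 (D, fob (pone E f) X, B)))\<rparr> = cyl_cell star_cyl f B" for B
      by (simp add: cyl_cell_def fun_eq dc_def f')
    show ?thesis unfolding 1 2 3 ..
  qed
  show ?thesis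
    unfolding xi_def cyl_pnat_def tob Let_def using cell[unfolded in_homset]
    by (simp cong: restrict_cong del: Cat_into_simps)
qed

end

subsection \<open>Every cylinder factors through the universal one\<close>

context pseudo_cylinder
begin

text \<open>The value on arrows is forced by the factorization \<open>(f, u, v) = (1, u, 1) (f, 1, 1) (1, 1, v)\<close>.\<close>

definition cyl_ext where
  "cyl_ext = \<lparr>fob = (\<lambda>x\<in>Obj D1. case x of (C, X, Y) \<Rightarrow> cylob c C Y X),
     far = (\<lambda>a\<in>Arr D1. case a of ((C, X, Y), (f, u, v), (D, A, B)) \<Rightarrow>
       Cmp Z (cylE c D B u) (Cmp Z (cylc c f B X) (cylW c C v X)))\<rparr>"

lemma cyl_ext_simps [simp]:
  "(C, X, Y) \<in> Obj D1 \<Longrightarrow> fob cyl_ext (C, X, Y) = cylob c C Y X"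
  "((C, X, Y), (f, u, v), (D, A, B)) \<in> Arr D1 \<Longrightarrow> far cyl_ext ((C, X, Y), (f, u, v), (D, A, B))
    = Cmp Z (cylE c D B u) (Cmp Z (cylc c f B X) (cylW c C v X))"
  by (simp_all add: cyl_ext_def)

text \<open>Starting from the composite, the coherence cell at \<open>g \<circ> f\<close> is split into those at \<open>f\<close> and \<open>g\<close>, which
  absorbs the coherence cell of \<open>W\<close> and cancels the inverse coherence cell of \<open>E\<close>; then \<open>y\<close> and \<open>u\<close> are
  moved past the coherence cells and past each other.\<close>

lemma cyl_ext_Cmp:
  assumes a: "((C, X, Y), (f, u, v), (D, A, B)) \<in> Arr D1"
    and b: "((D, A, B), (g, x, y), (D', A', B')) \<in> Arr D1"
  shows "far cyl_ext (Cmp D1 ((D, A, B), (g, x, y), (D', A', B')) ((C, X, Y), (f, u, v), (D, A, B)))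
    = Cmp Z (far cyl_ext ((D, A, B), (g, x, y), (D', A', B'))) (far cyl_ext ((C, X, Y), (f, u, v), (D, A, B)))"
proof -
  have f: "f \<in> homset (one K) C D" and g: "g \<in> homset (one K) D D'"
    and X: "X \<in> Obj (pob E C)" and A: "A \<in> Obj (pob E D)" and B: "B \<in> Obj (pob W D)" and B': "B' \<in> Obj (pob W D')"
    and C: "C \<in> Obj (one K)" and D: "D \<in> Obj (one K)" and D': "D' \<in> Obj (one K)"
    and u: "u \<in> homset (pob E D) (fob (pone E f) X) A" and y: "y \<in> homset (pob W D) B (fob (pone W g) B')"
    using a b by (auto simp: Delta_one_Arr Delta_one_Obj)
  interpret f: one_cell K E W f C D by (rule one_cellI[OF f])
  interpret g: one_cell K E W g D D' by (rule one_cellI[OF g])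
  note gf = E.Cmp_one_homset[OF f g]
  have fX: "fob (pone E f) X \<in> Obj (pob E D)" and gB: "fob (pone W g) B' \<in> Obj (pob W D)" using X B' by auto
  note cells = a[unfolded Delta_one_Arr Delta_one_Obj in_homset] b[unfolded Delta_one_Arr Delta_one_Obj in_homset]
  note [simp] = E.pcmp_component[OF f g X] W_pcmp_component[OF g f B']
    cylc_simps[OF f B X] cylc_simps[OF f gB X] cylc_simps[OF g B' fX] cylc_simps[OF g B' A] cylc_simps[OF gf B' X]
  let ?C = "Cmp Z"
  let ?p = "ncmp (pcmp E g f) X" and ?q = "ncmp (pcmp W f g) B'"
  let ?ip = "inv_arr (pob E D') ?p"
  have eE: "cylE c D' B' (Cmp (pob E D') k h) = ?C (cylE c D' B' k) (cylE c D' B' h)"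
    if "h \<in> Arr (pob E D')" "k \<in> Arr (pob E D')" "Cod (pob E D') h = Dom (pob E D') k" for h k
    using cylE_Cmp[OF D' B', of h "Dom (pob E D') h" "Cod (pob E D') h" k "Cod (pob E D') k"] that by (simp add: in_homset)
  have eW: "cylW c C (Cmp (pob W C) k h) X = ?C (cylW c C k X) (cylW c C h X)"
    if "h \<in> Arr (pob W C)" "k \<in> Arr (pob W C)" "Cod (pob W C) h = Dom (pob W C) k" for h k
    using cylW_Cmp[OF C X, of h "Dom (pob W C) h" "Cod (pob W C) h" k "Cod (pob W C) k"] that by (simp add: in_homset)
  have ip: "?C (cylE c D' B' ?ip) (?C (cylE c D' B' ?p) k) = k"
    if "k \<in> Arr Z" "Cod Z k = cylob c D' B' (fob (pone E g) (fob (pone E f) X))" for k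
  proof -
    have "?C (cylE c D' B' ?ip) (cylE c D' B' ?p) = Idn Z (cylob c D' B' (fob (pone E g) (fob (pone E f) X)))"
      using D' B' X cylE_Idn[OF D' B', of "fob (pone E g) (fob (pone E f) X)"] by (simp flip: eE)
    then show ?thesis using that D' B' X
      by (simp flip: Z.assoc)
  qed
  have "far cyl_ext (Cmp D1 ((D, A, B), (g, x, y), (D', A', B')) ((C, X, Y), (f, u, v), (D, A, B)))
    = ?C (cylE c D' B' (Cmp (pob E D') x (Cmp (pob E D') (far (pone E g) u) ?ip)))
      (?C (cylc c (Cmp (one K) g f) B' X) (cylW c C (Cmp (pob W C) ?q (Cmp (pob W C) (far (pone W f) y) v)) X))"
    using Delta_one_Cmp_Arr[OF a b] by simp
  also have "\<dots> = ?C (cylE c D' B' x) (?C (cylE c D' B' (far (pone E g) u)) (?C (cylE c D' B' ?ip)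
      (?C (cylc c (Cmp (one K) g f) B' X) (?C (cylW c C ?q X) (?C (cylW c C (far (pone W f) y) X) (cylW c C v X))))))"
    using cells by (simp add: eE eW)
  also have "?C (cylc c (Cmp (one K) g f) B' X) (?C (cylW c C ?q X) (?C (cylW c C (far (pone W f) y) X) (cylW c C v X)))
    = ?C (cylE c D' B' ?p) (?C (?C (cylc c g B' (fob (pone E f) X)) (cylc c f (fob (pone W g) B') X))
        (?C (cylW c C (far (pone W f) y) X) (cylW c C v X)))"
    by (rule Z.square_Cmp[OF cylc_Cmp[OF f g B' X]]) (use cells in simp_all)
  also have "?C (cylE c D' B' ?ip) \<dots> = ?C (?C (cylc c g B' (fob (pone E f) X)) (cylc c f (fob (pone W g) B') X))
        (?C (cylW c C (far (pone W f) y) X) (cylW c C v X))"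
    by (rule ip) (use cells in simp_all)
  also have "\<dots> = ?C (cylc c g B' (fob (pone E f) X)) (?C (cylc c f (fob (pone W g) B') X)
        (?C (cylW c C (far (pone W f) y) X) (cylW c C v X)))"
    using cells by simp
  also have "?C (cylc c f (fob (pone W g) B') X) (?C (cylW c C (far (pone W f) y) X) (cylW c C v X))
    = ?C (cylW c D y (fob (pone E f) X)) (?C (cylc c f B X) (cylW c C v X))"
    by (rule Z.square_Cmp[OF cylc_W[OF f y X]]) (use cells in simp_all)
  also have "?C (cylE c D' B' (far (pone E g) u)) (?C (cylc c g B' (fob (pone E f) X))
      (?C (cylW c D y (fob (pone E f) X)) (?C (cylc c f B X) (cylW c C v X))))
    = ?C (cylc c g B' A) (?C (cylE c D (fob (pone W g) B') u)
      (?C (cylW c D y (fob (pone E f) X)) (?C (cylc c f B X) (cylW c C v X))))"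
    by (rule Z.square_Cmp[OF cylc_E[OF g B' u, symmetric]]) (use cells in simp_all)
  also have "?C (cylE c D (fob (pone W g) B') u) (?C (cylW c D y (fob (pone E f) X)) (?C (cylc c f B X) (cylW c C v X)))
    = ?C (cylW c D y A) (?C (cylE c D B u) (?C (cylc c f B X) (cylW c C v X)))"
    by (rule Z.square_Cmp[OF cyl_EW[OF D u y]]) (use cells in simp_all)
  finally show ?thesis using a b cells by simp
qed

lemma cyl_ext_functor: "is_functor D1 Z cyl_ext"
proof (rule is_functorI[OF category_Delta_one Z.category_axioms])
  show "fob cyl_ext \<in> extensional (Obj D1)" "far cyl_ext \<in> extensional (Arr D1)"
    by (simp_all add: cyl_ext_def)
  show "fob cyl_ext x \<in> Obj Z" if "x \<in> Obj D1" for x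
    using that by (cases x) (simp add: Delta_one_Obj cylob_Obj)
  show "far cyl_ext a \<in> Arr Z \<and> Dom Z (far cyl_ext a) = fob cyl_ext (Dom D1 a) \<and> Cod Z (far cyl_ext a) = fob cyl_ext (Cod D1 a)"
    if a: "a \<in> Arr D1" for a
  proof -
    obtain C X Y f u v D A B where eq: "a = ((C, X, Y), (f, u, v), (D, A, B))" using a by (rule Delta_one_cases)
    show ?thesis
      using a cylc_simps[of f C D B X] unfolding eq by (simp add: Delta_one_Arr Delta_one_Obj in_homset)
  qed
  show "far cyl_ext (Idn D1 x) = Idn Z (fob cyl_ext x)" if x: "x \<in> Obj D1" for x
  proof -
    obtain C X Y where eq: "x = (C, X, Y)" by (cases x)
    show ?thesis
      using x Delta_one_Idn_Arr[of C X Y] unfolding eq by (simp add: Delta_one_Obj cylob_Obj cylE_Idn cylW_Idn cylc_Idn)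
  qed
  show "far cyl_ext (Cmp D1 b a) = Cmp Z (far cyl_ext b) (far cyl_ext a)"
    if a: "a \<in> Arr D1" and b: "b \<in> Arr D1" and ab: "Cod D1 a = Dom D1 b" for a b
  proof -
    obtain C X Y f u v D A B where eq: "a = ((C, X, Y), (f, u, v), (D, A, B))" using a by (rule Delta_one_cases)
    moreover obtain g x y D' A' B' where "b = ((D, A, B), (g, x, y), (D', A', B'))"
      using b ab eq by (elim Delta_one_cases) auto
    ultimately show ?thesis using a b cyl_ext_Cmp by simp
  qed
qed

text \<open>This is naturality of the coherence cells in 2-cells.\<close>

lemma cyl_ext_two_cell:
  assumes "(p, \<alpha>, q) \<in> Arr (two D2)"
  shows "far cyl_ext p = far cyl_ext q"
proof -
  obtain C X Y f u v D A B g x y where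
    eq: "p = ((C, X, Y), (f, u, v), (D, A, B))" "q = ((C, X, Y), (g, x, y), (D, A, B))"
    using assms by (elim Delta_two_cases) auto
  note cell = assms[unfolded eq Delta_two_Arr Delta_one_Arr Delta_one_Obj]
  have f: "f \<in> homset (one K) C D" and g: "g \<in> homset (one K) C D" and \<alpha>: "\<alpha> \<in> homset (two K) f g"
    and X: "X \<in> Obj (pob E C)" and B: "B \<in> Obj (pob W D)" and C: "C \<in> Obj (one K)" and D: "D \<in> Obj (one K)"
    and x: "x \<in> homset (pob E D) (fob (pone E g) X) A" and v: "v \<in> homset (pob W C) Y (fob (pone W f) B)"
    and u: "Cmp (pob E D) x (ncmp (ptwo E \<alpha>) X) = u" and y: "Cmp (pob W C) (ncmp (ptwo W \<alpha>) B) v = y"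
    using cell by - (elim conjE, assumption)+
  have h: "ncmp (ptwo E \<alpha>) X \<in> homset (pob E D) (fob (pone E f) X) (fob (pone E g) X)"
    "ncmp (ptwo W \<alpha>) B \<in> homset (pob W C) (fob (pone W f) B) (fob (pone W g) B)"
    using E.ptwo_component[OF \<alpha> f X] W_ptwo_component[OF \<alpha> f B] by (simp_all add: in_homset)
  note typing = h[unfolded in_homset] x[unfolded in_homset] v[unfolded in_homset] X B C D
  note [simp] = cylc_simps[OF f B X] cylc_simps[OF g B X]
  let ?C = "Cmp Z"
  have "?C (cylE c D B (Cmp (pob E D) x (ncmp (ptwo E \<alpha>) X))) (?C (cylc c f B X) (cylW c C v X))
    = ?C (cylE c D B x) (?C (cylE c D B (ncmp (ptwo E \<alpha>) X)) (?C (cylc c f B X) (cylW c C v X)))"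
    using typing by (simp add: cylE_Cmp[OF D B h(1) x])
  also have "?C (cylE c D B (ncmp (ptwo E \<alpha>) X)) (?C (cylc c f B X) (cylW c C v X))
    = ?C (cylc c g B X) (?C (cylW c C (ncmp (ptwo W \<alpha>) B) X) (cylW c C v X))"
    by (rule Z.square_Cmp[OF cylc_two[OF f \<alpha> B X]]) (use typing in simp_all)
  also have "?C (cylW c C (ncmp (ptwo W \<alpha>) B) X) (cylW c C v X) = cylW c C y X"
    unfolding y[symmetric] by (rule cylW_Cmp[OF C X v h(2), symmetric])
  finally show ?thesis
    using Delta_two_D(1,2)[OF assms] unfolding eq u by (simp only: cyl_ext_simps)
qed

text \<open>All three factors are invertible: those at \<open>u\<close> and \<open>v\<close> as images of invertible arrows under functors.\<close>

lemma cyl_ext_cartesian: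
  assumes "cartesian K E W a"
  shows "iso_arr Z (far cyl_ext a)"
proof -
  have a: "a \<in> Arr D1" using assms by (rule cartesian_Arr)
  then obtain C X Y f u v D A B where eq: "a = ((C, X, Y), (f, u, v), (D, A, B))" by (rule Delta_one_cases)
  have iso: "iso_arr (pob E D) u" "iso_arr (pob W C) v" using assms by (simp_all add: cartesian_def eq)
  have f: "f \<in> homset (one K) C D" and X: "X \<in> Obj (pob E C)" and B: "B \<in> Obj (pob W D)"
    and C: "C \<in> Obj (one K)" and D: "D \<in> Obj (one K)"
    and u: "u \<in> homset (pob E D) (fob (pone E f) X) A" and v: "v \<in> homset (pob W C) Y (fob (pone W f) B)"
    using a by (auto simp: eq Delta_one_Arr Delta_one_Obj)
  have u': "u \<in> Arr (pob E D)" "Dom (pob E D) u = fob (pone E f) X"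
    and v': "v \<in> Arr (pob W C)" "Cod (pob W C) v = fob (pone W f) B"
    using u v by (auto simp: in_homset)
  have "iso_arr Z (cylE c D B u)"
    using is_functor.iso_arr_far[OF cyl_fun_functor[OF D B] iso(1)] u' by simp
  moreover have "iso_arr Z (cylW c C v X)"
    using iso_arr_ncmp[OF is_functor.iso_arr_far[OF cyl_tob_functor[OF C] iso(2)] X] v' X by simp
  ultimately show ?thesis
    using a cylc_iso[OF f B X] cylc_simps[OF f B X] u' v' C D X B
    by (simp add: eq Z.iso_arr_Cmp)
qed

end

context weighted_pair
begin

definition cyl_map :: "('x, 'y, 'z, 'w) ftor \<Rightarrow> ('c, 'f, 'o, 'a, 'p, 'b, 'x, 'y) cylinder
    \<Rightarrow> ('c, 'f, 'o, 'a, 'p, 'b, 'z, 'w) cylinder" where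
  "cyl_map F c = \<lparr>cylob = (\<lambda>C Y X. fob F (cylob c C Y X)), cylE = (\<lambda>C Y u. far F (cylE c C Y u)),
     cylW = (\<lambda>C v X. far F (cylW c C v X)), cylc = (\<lambda>f B X. far F (cylc c f B X))\<rparr>"

lemma cyl_map_simps [simp]:
  "cylob (cyl_map F c) C Y X = fob F (cylob c C Y X)" "cylE (cyl_map F c) C Y u = far F (cylE c C Y u)"
  "cylW (cyl_map F c) C v X = far F (cylW c C v X)" "cylc (cyl_map F c) f B X = far F (cylc c f B X)"
  by (simp_all add: cyl_map_def)

lemma pseudo_cylinder_map:
  assumes "pseudo_cylinder K E W Z c" "is_functor Z V F"
  shows "pseudo_cylinder K E W V (cyl_map F c)"
proof -
  interpret c: pseudo_cylinder K E W Z c by fact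
  interpret F: is_functor Z V F by fact
  show ?thesis
  proof (intro pseudo_cylinder.intro pseudo_cylinder_axioms.intro weighted_pair_axioms F.B.category_axioms, unfold cyl_map_simps)
    fix f g C D D' B X assume f: "f \<in> homset (one K) C D" and g: "g \<in> homset (one K) D D'"
      and B: "B \<in> Obj (pob W D')" and X: "X \<in> Obj (pob E C)"
    have C: "C \<in> Obj (one K)" "D' \<in> Obj (one K)" using f g by (auto simp: in_homset)
    have o: "fob (pone E f) X \<in> Obj (pob E D)" "fob (pone W g) B \<in> Obj (pob W D)"
      using is_functor.fob_Obj[OF E.pone_functor[OF f] X] is_functor.fob_Obj[OF W_pone_functor[OF g] B] by auto
    show "Cmp V (far F (cylc c (Cmp (one K) g f) B X)) (far F (cylW c C (ncmp (pcmp W f g) B) X))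
      = Cmp V (far F (cylE c D' B (ncmp (pcmp E g f) X)))
          (Cmp V (far F (cylc c g B (fob (pone E f) X))) (far F (cylc c f (fob (pone W g) B) X)))"
      using c.cylc_Cmp[OF f g B X, THEN arg_cong[where f = "far F"]]
        E.pcmp_component[OF f g X] W_pcmp_component[OF g f B] C X B
        c.cylc_simps[OF E.Cmp_one_homset[OF f g] B X] c.cylc_simps[OF g B o(1)] c.cylc_simps[OF f o(2) X]
      by simp
  next
    fix f C D \<alpha> g B X assume f: "f \<in> homset (one K) C D" and \<alpha>: "\<alpha> \<in> homset (two K) f g"
      and B: "B \<in> Obj (pob W D)" and X: "X \<in> Obj (pob E C)"
    have C: "C \<in> Obj (one K)" "D \<in> Obj (one K)" and g: "g \<in> homset (one K) C D" using f \<alpha> by (auto simp: in_homset)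
    show "Cmp V (far F (cylE c D B (ncmp (ptwo E \<alpha>) X))) (far F (cylc c f B X))
      = Cmp V (far F (cylc c g B X)) (far F (cylW c C (ncmp (ptwo W \<alpha>) B) X))"
      using c.cylc_two[OF f \<alpha> B X, THEN arg_cong[where f = "far F"]] C B X
        E.ptwo_component[OF \<alpha> f X] W_ptwo_component[OF \<alpha> f B] c.cylc_simps[OF f B X] c.cylc_simps[OF g B X]
      by simp
  next
    fix f C D B u X X' assume f: "f \<in> homset (one K) C D" and B: "B \<in> Obj (pob W D)" and u: "u \<in> homset (pob E C) X X'"
    have C: "C \<in> Obj (one K)" "D \<in> Obj (one K)" using f by (auto simp: in_homset)
    interpret f: one_cell K E W f C D by (rule one_cellI[OF f])
    have u': "u \<in> Arr (pob E C)" "Dom (pob E C) u = X" "Cod (pob E C) u = X'" using u by (auto simp: in_homset)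
    have X: "X \<in> Obj (pob E C)" "X' \<in> Obj (pob E C)" using u' by auto
    show "Cmp V (far F (cylc c f B X')) (far F (cylE c C (fob (pone W f) B) u))
      = Cmp V (far F (cylE c D B (far (pone E f) u))) (far F (cylc c f B X))"
      using c.cylc_E[OF f B u, THEN arg_cong[where f = "far F"]] C B X u' is_functor.fob_Obj[OF W_pone_functor[OF f] B]
        c.cylc_simps[OF f B X(1)] c.cylc_simps[OF f B X(2)]
      by simp
  next
    fix f C D y B B' X assume f: "f \<in> homset (one K) C D" and y: "y \<in> homset (pob W D) B B'" and X: "X \<in> Obj (pob E C)"
    have C: "C \<in> Obj (one K)" "D \<in> Obj (one K)" using f by (auto simp: in_homset)
    interpret f: one_cell K E W f C D by (rule one_cellI[OF f])
    have y': "y \<in> Arr (pob W D)" "Dom (pob W D) y = B" "Cod (pob W D) y = B'" using y by (auto simp: in_homset)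
    have B: "B \<in> Obj (pob W D)" "B' \<in> Obj (pob W D)" using y' by auto
    show "Cmp V (far F (cylc c f B' X)) (far F (cylW c C (far (pone W f) y) X))
      = Cmp V (far F (cylW c D y (fob (pone E f) X))) (far F (cylc c f B X))"
      using c.cylc_W[OF f y X, THEN arg_cong[where f = "far F"]] C B X y' is_functor.fob_Obj[OF E.pone_functor[OF f] X]
        c.cylc_simps[OF f B(1) X] c.cylc_simps[OF f B(2) X]
      by simp
  next
    fix C u X X' v Y Y' assume C: "C \<in> Obj (one K)" and u: "u \<in> homset (pob E C) X X'" and v: "v \<in> homset (pob W C) Y Y'"
    interpret EC: category "pob E C" by (rule E.pob_category[OF C])
    interpret WC: category "pob W C" by (rule W_category[OF C])
    have u': "u \<in> Arr (pob E C)" "Dom (pob E C) u = X" "Cod (pob E C) u = X'" using u by (auto simp: in_homset)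
    have v': "v \<in> Arr (pob W C)" "Dom (pob W C) v = Y" "Cod (pob W C) v = Y'" using v by (auto simp: in_homset)
    have o: "X \<in> Obj (pob E C)" "X' \<in> Obj (pob E C)" "Y \<in> Obj (pob W C)" "Y' \<in> Obj (pob W C)" using u' v' by auto
    show "Cmp V (far F (cylE c C Y' u)) (far F (cylW c C v X)) = Cmp V (far F (cylW c C v X')) (far F (cylE c C Y u))"
      using c.cyl_EW[OF C u v, THEN arg_cong[where f = "far F"]] C u' v' o by simp
  next
    fix f C D B X assume f: "f \<in> homset (one K) C D" "B \<in> Obj (pob W D)" "X \<in> Obj (pob E C)"
    show "far F (cylc c f B X) \<in> homset V (fob F (cylob c C (fob (pone W f) B) X)) (fob F (cylob c D B (fob (pone E f) X)))"
      using c.cylc_hom[OF f] by (rule F.far_hom)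
    show "iso_arr V (far F (cylc c f B X))" using c.cylc_iso[OF f] by simp
  next
    fix C Y u X X' u' X3 assume a: "C \<in> Obj (one K)" "Y \<in> Obj (pob W C)" "u \<in> homset (pob E C) X X'"
    show "far F (cylE c C Y u) \<in> homset V (fob F (cylob c C Y X)) (fob F (cylob c C Y X'))"
      using c.cylE_hom[OF a] by (rule F.far_hom)
    assume b: "u' \<in> homset (pob E C) X' X3"
    show "far F (cylE c C Y (Cmp (pob E C) u' u)) = Cmp V (far F (cylE c C Y u')) (far F (cylE c C Y u))"
      unfolding c.cylE_Cmp[OF a b] by (rule F.far_Cmp[OF c.cylE_hom[OF a] c.cylE_hom[OF a(1,2) b]])
  next
    fix C X v Y Y' v' Y3 assume a: "C \<in> Obj (one K)" "X \<in> Obj (pob E C)" "v \<in> homset (pob W C) Y Y'"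
    show "far F (cylW c C v X) \<in> homset V (fob F (cylob c C Y X)) (fob F (cylob c C Y' X))"
      using c.cylW_hom[OF a] by (rule F.far_hom)
    assume b: "v' \<in> homset (pob W C) Y' Y3"
    show "far F (cylW c C (Cmp (pob W C) v' v) X) = Cmp V (far F (cylW c C v' X)) (far F (cylW c C v X))"
      unfolding c.cylW_Cmp[OF a b] by (rule F.far_Cmp[OF c.cylW_hom[OF a] c.cylW_hom[OF a(1,2) b]])
  qed (simp_all add: c.cylob_Obj c.cylE_Idn c.cylW_Idn c.cylc_Idn)
qed

lemma cyl_pnat_cong:
  assumes c: "pseudo_cylinder K E W Z c" and d: "pseudo_cylinder K E W Z d"
    and ob: "\<And>C X Y. C \<in> Obj (one K) \<Longrightarrow> Y \<in> Obj (pob W C) \<Longrightarrow> X \<in> Obj (pob E C) \<Longrightarrow> cylob c C Y X = cylob d C Y X"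
    and E: "\<And>C Y u. C \<in> Obj (one K) \<Longrightarrow> Y \<in> Obj (pob W C) \<Longrightarrow> u \<in> Arr (pob E C) \<Longrightarrow> cylE c C Y u = cylE d C Y u"
    and W: "\<And>C v X. C \<in> Obj (one K) \<Longrightarrow> v \<in> Arr (pob W C) \<Longrightarrow> X \<in> Obj (pob E C) \<Longrightarrow> cylW c C v X = cylW d C v X"
    and cell: "\<And>f C D B X. f \<in> homset (one K) C D \<Longrightarrow> B \<in> Obj (pob W D) \<Longrightarrow> X \<in> Obj (pob E C) \<Longrightarrow> cylc c f B X = cylc d f B X"
  shows "cyl_pnat Z c = cyl_pnat Z d"
proof -
  have fn: "cyl_fun c C Y = cyl_fun d C Y" if "C \<in> Obj (one K)" "Y \<in> Obj (pob W C)" for C Y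
    using that by (simp add: cyl_fun_def ob E cong: restrict_cong)
  have nt: "cyl_nt c C v = cyl_nt d C v" if "C \<in> Obj (one K)" "v \<in> Arr (pob W C)" for C v
    using that category.Dom_Obj[OF W_category] category.Cod_Obj[OF W_category]
    by (simp add: cyl_nt_def fn W cong: restrict_cong)
  have tob: "cyl_tob c C = cyl_tob d C" if "C \<in> Obj (one K)" for C
    using that by (simp add: cyl_tob_def fn nt cong: restrict_cong)
  have cell: "cyl_cell c f B = cyl_cell d f B" if "f \<in> Arr (one K)" "B \<in> Obj (pob W (Cod (one K) f))" for f B
    using that is_functor.fob_Obj[OF W_pone_functor[of f]]
    by (simp add: cyl_cell_def fn cell in_homset cong: restrict_cong)
  show ?thesis
    by (simp add: cyl_pnat_def tob cell cong: restrict_cong del: Cat_into_simps)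
qed

end

section \<open>The induced functor\<close>

lemma postcomp_simps [simp]:
  "is_functor C A G \<Longrightarrow> fob (postcomp C A F) G = comp_functor C F G"
  "is_ntrans C A \<gamma> \<Longrightarrow> far (postcomp C A F) \<gamma> = whisker_left C F \<gamma>"
  by (simp_all add: postcomp_def)

lemma is_functor_postcomp:
  assumes C: "category C" and F: "is_functor A B F"
  shows "is_functor (Fun C A) (Fun C B) (postcomp C A F)"
proof -
  interpret F: is_functor A B F by fact
  show ?thesis
  proof (rule is_functorI)
    show "category (Fun C A)" "category (Fun C B)"
      using C F.A.category_axioms F.B.category_axioms by (simp_all add: category_functor_category)
    show "fob (postcomp C A F) \<in> extensional (Obj (Fun C A))"
      "far (postcomp C A F) \<in> extensional (Arr (Fun C A))"
      by (simp_all add: postcomp_def del: functor_category_simps)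
    show "fob (postcomp C A F) G \<in> Obj (Fun C B)" if "G \<in> Obj (Fun C A)" for G
      using that F is_functor_comp by simp
    show "far (postcomp C A F) (Idn (Fun C A) G) = Idn (Fun C B) (fob (postcomp C A F) G)"
      if "G \<in> Obj (Fun C A)" for G
    proof -
      interpret G: is_functor C A G using that by simp
      show ?thesis using that by (intro ntrans_eqI[where A = C]) (simp_all add: is_ntrans_Idn)
    qed
    show "far (postcomp C A F) \<gamma> \<in> Arr (Fun C B)
        \<and> Dom (Fun C B) (far (postcomp C A F) \<gamma>) = fob (postcomp C A F) (Dom (Fun C A) \<gamma>)
        \<and> Cod (Fun C B) (far (postcomp C A F) \<gamma>) = fob (postcomp C A F) (Cod (Fun C A) \<gamma>)"
      if "\<gamma> \<in> Arr (Fun C A)" for \<gamma>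
    proof -
      interpret \<gamma>: is_ntrans C A \<gamma> using that by simp
      show ?thesis
        using is_ntrans_whisker_left[OF \<gamma>.is_ntrans_axioms F]
        by (simp add: \<gamma>.S.is_functor_axioms \<gamma>.T.is_functor_axioms \<gamma>.is_ntrans_axioms)
    qed
    show "far (postcomp C A F) (Cmp (Fun C A) \<delta> \<gamma>)
        = Cmp (Fun C B) (far (postcomp C A F) \<delta>) (far (postcomp C A F) \<gamma>)"
      if "\<gamma> \<in> Arr (Fun C A)" "\<delta> \<in> Arr (Fun C A)"
        "Cod (Fun C A) \<gamma> = Dom (Fun C A) \<delta>" for \<gamma> \<delta>
    proof -
      interpret \<gamma>: is_ntrans C A \<gamma> using that by simp
      interpret \<delta>: is_ntrans C A \<delta> using that by simp
      show ?thesis using that by (intro ntrans_eqI[where A = C]) (simp_all add: is_ntrans_Cmp)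
    qed
  qed
qed

lemma is_ntrans_postcomp:
  assumes C: "category C" and \<sigma>: "is_ntrans A B \<sigma>"
  shows "is_ntrans (Fun C A) (Fun C B)
    \<lparr>nsrc = postcomp C A (nsrc \<sigma>), ntgt = postcomp C A (ntgt \<sigma>),
     ncmp = (\<lambda>G\<in>Obj (Fun C A). whisker_right C \<sigma> G)\<rparr>"
proof (rule is_ntransI, unfold ntrans.simps)
  interpret \<sigma>: is_ntrans A B \<sigma> by fact
  show "is_functor (Fun C A) (Fun C B) (postcomp C A (nsrc \<sigma>))"
    "is_functor (Fun C A) (Fun C B) (postcomp C A (ntgt \<sigma>))"
    using C \<sigma>.S.is_functor_axioms \<sigma>.T.is_functor_axioms by (auto intro: is_functor_postcomp)
  fix \<gamma> assume \<gamma>: "\<gamma> \<in> Arr (Fun C A)"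
  then interpret \<gamma>: is_ntrans C A \<gamma> by simp
  have "Cmp B (ncmp \<sigma> (fob (ntgt \<gamma>) x)) (far (nsrc \<sigma>) (ncmp \<gamma> x))
      = Cmp B (far (ntgt \<sigma>) (ncmp \<gamma> x)) (ncmp \<sigma> (fob (nsrc \<gamma>) x))" if "x \<in> Obj C" for x
    using that \<sigma>.naturality[of "ncmp \<gamma> x"] by simp
  then show "Cmp (Fun C B)
      ((\<lambda>G\<in>Obj (Fun C A). whisker_right C \<sigma> G) (Cod (Fun C A) \<gamma>)) (far (postcomp C A (nsrc \<sigma>)) \<gamma>)
    = Cmp (Fun C B) (far (postcomp C A (ntgt \<sigma>)) \<gamma>)
      ((\<lambda>G\<in>Obj (Fun C A). whisker_right C \<sigma> G) (Dom (Fun C A) \<gamma>))"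
    by (intro ntrans_eqI[where A = C])
      (simp_all add: \<gamma>.S.is_functor_axioms \<gamma>.T.is_functor_axioms \<gamma>.is_ntrans_axioms)
qed (use is_ntrans_whisker_right[OF _ \<sigma>] in auto)

context weighted_pair
begin

lemma cyl_fun_map:
  assumes c: "pseudo_cylinder K E W V c" and F: "is_functor V Z F" and C: "C \<in> Obj (one K)" and Y: "Y \<in> Obj (pob W C)"
  shows "comp_functor (pob E C) F (cyl_fun c C Y) = cyl_fun (cyl_map F c) C Y"
  by (rule functor_eqI[OF is_functor_comp[OF pseudo_cylinder.cyl_fun_functor[OF c C Y] F]
        pseudo_cylinder.cyl_fun_functor[OF pseudo_cylinder_map[OF c F] C Y]]) simp_all

lemma cyl_nt_map:
  assumes c: "pseudo_cylinder K E W V c" and F: "is_functor V Z F" and C: "C \<in> Obj (one K)" and v: "v \<in> Arr (pob W C)"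
  shows "whisker_left (pob E C) F (cyl_nt c C v) = cyl_nt (cyl_map F c) C v"
  using category.Dom_Obj[OF W_category[OF C] v] category.Cod_Obj[OF W_category[OF C] v] C
  by (intro ntrans_eqI[where A = "pob E C"]) (simp_all add: cyl_fun_map[OF c F])

text \<open>The transformation \<open>Cat(E, F)\<close> is strict, so the coherence cells of the composite are the images
  under \<open>F\<close> of those of the cylinder.\<close>

lemma comp_pnat_Cat_post:
  assumes c: "pseudo_cylinder K E W V c" and F: "is_functor V Z F"
  shows "comp_pnat (op2 K) W (CEX Z) (Cat_post K E V Z F) (cyl_pnat V c) = cyl_pnat Z (cyl_map F c)"
proof -
  interpret c: pseudo_cylinder K E W V c by fact
  interpret F: is_functor V Z F by fact
  have cF: "pseudo_cylinder K E W Z (cyl_map F c)" by (rule pseudo_cylinder_map[OF c F])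
  interpret cF: pseudo_cylinder K E W Z "cyl_map F c" by (rule cF)
  have post: "is_functor (Fun (pob E C) V) (Fun (pob E C) Z) (postcomp (pob E C) V F)"
    if "C \<in> Obj (one K)" for C
    by (rule is_functor_postcomp[OF E.pob_category[OF that] F])
  have tob: "comp_functor (pob W C) (postcomp (pob E C) V F) (cyl_tob c C) = cyl_tob (cyl_map F c) C"
    if C: "C \<in> Obj (one K)" for C
    by (rule functor_eqI[OF is_functor_comp[OF c.cyl_tob_functor[OF C] post[OF C]] cF.cyl_tob_functor[OF C]])
      (use C in \<open>simp_all add: c.cyl_fun_functor cyl_fun_map[OF c F] c.cyl_nt_ntrans cyl_nt_map[OF c F]\<close>)
  have tone: "Cmp (Fun (pob W D) (Fun (pob E C) Z))
      (whisker_right (pob W D) (tone (Cat_post K E V Z F) f) (cyl_tob c D))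
      (whisker_left (pob W D) (postcomp (pob E C) V F) (tone (cyl_pnat V c) f))
    = tone (cyl_pnat Z (cyl_map F c)) f" if f: "f \<in> homset (one K) C D" for f C D
  proof -
    have f': "f \<in> Arr (one K)" "Dom (one K) f = C" "Cod (one K) f = D" "C \<in> Obj (one K)" "D \<in> Obj (one K)"
      using f by (auto simp: in_homset)
    interpret f: one_cell K E W f C D by (rule one_cellI[OF f])
    have chi: "tone (Cat_post K E V Z F) f = Idn (Fun (Fun (pob E D) V) (Fun (pob E C) Z))
        (comp_functor (Fun (pob E D) V) (postcomp (pob E C) V F) (precomp (pob E C) (pob E D) V (pone E f)))"
      by (simp add: Cat_post_def Let_def f')
    have pre: "is_functor (Fun (pob E D) V) (Fun (pob E C) V) (precomp (pob E C) (pob E D) V (pone E f))"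
      by (rule is_functor_precomp[OF E.pone_functor[OF f] c.Z.category_axioms])
    have preZ: "is_functor (Fun (pob E D) Z) (Fun (pob E C) Z) (precomp (pob E C) (pob E D) Z (pone E f))"
      by (rule is_functor_precomp[OF E.pone_functor[OF f] F.B.category_axioms])
    note fD = c.cyl_fun_functor[OF f'(5)] and fC = c.cyl_fun_functor[OF f'(4)]
    note gD = cF.cyl_fun_functor[OF f'(5)]
    have ff: "is_functor (pob E C) V (comp_functor (pob E C) (cyl_fun c D B) (pone E f))" if "B \<in> Obj (pob W D)" for B
      by (rule is_functor_comp[OF E.pone_functor[OF f] fD[OF that]])
    have assoc: "comp_functor (pob E C) F (comp_functor (pob E C) (cyl_fun c D B) (pone E f))
        = comp_functor (pob E C) (cyl_fun (cyl_map F c) D B) (pone E f)" if "B \<in> Obj (pob W D)" for B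
      using comp_functor_assoc[OF E.pone_functor[OF f], where H = F and G = "cyl_fun c D B"]
      by (simp add: cyl_fun_map[OF c F f'(5) that])
    have cell: "Cmp (Fun (pob E C) Z)
        (Idn (Fun (pob E C) Z) (comp_functor (pob E C) (cyl_fun (cyl_map F c) D B) (pone E f)))
        (whisker_left (pob E C) F (cyl_cell c f B)) = cyl_cell (cyl_map F c) f B" if B: "B \<in> Obj (pob W D)" for B
      by (rule ntrans_eqI[where A = "pob E C"])
        (use B c.cylc_simps[OF f B] c.cylob_Obj[OF f'(5) B] in \<open>simp_all add: f' cyl_fun_map[OF c F]\<close>)
    have tgt: "comp_functor (pob W D) (comp_functor (Fun (pob E D) V) (postcomp (pob E C) V F)
          (precomp (pob E C) (pob E D) V (pone E f))) (cyl_tob c D)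
        = comp_functor (pob W D) (precomp (pob E C) (pob E D) Z (pone E f)) (cyl_tob (cyl_map F c) D)"
    proof (rule functor_eqI[OF is_functor_comp[OF c.cyl_tob_functor[OF f'(5)] is_functor_comp[OF pre post[OF f'(4)]]]
          is_functor_comp[OF cF.cyl_tob_functor[OF f'(5)] preZ]])
      fix y assume y: "y \<in> Arr (pob W D)"
      note nD = c.cyl_nt_ntrans[OF f'(5) y] and mD = cF.cyl_nt_ntrans[OF f'(5) y]
      have wr: "is_ntrans (pob E C) V (whisker_right (pob E C) (cyl_nt c D y) (pone E f))"
        by (rule is_ntrans_whisker_right[OF E.pone_functor[OF f] nD])
      have "whisker_left (pob E C) F (whisker_right (pob E C) (cyl_nt c D y) (pone E f))
          = whisker_right (pob E C) (cyl_nt (cyl_map F c) D y) (pone E f)"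
        by (rule ntrans_eqI[where A = "pob E C"]) (use y in \<open>simp_all add: assoc\<close>)
      then show "far (comp_functor (pob W D) (comp_functor (Fun (pob E D) V) (postcomp (pob E C) V F)
            (precomp (pob E C) (pob E D) V (pone E f))) (cyl_tob c D)) y
          = far (comp_functor (pob W D) (precomp (pob E C) (pob E D) Z (pone E f)) (cyl_tob (cyl_map F c) D)) y"
        using y by (simp add: nD mD wr)
    qed (simp_all add: fD gD ff assoc)
    show ?thesis
    proof (rule ntrans_eqI[where A = "pob W D"])
      fix B assume B: "B \<in> Obj (pob W D)"
      show "ncmp (Cmp (Fun (pob W D) (Fun (pob E C) Z))
          (whisker_right (pob W D) (tone (Cat_post K E V Z F) f) (cyl_tob c D))
          (whisker_left (pob W D) (postcomp (pob E C) V F) (tone (cyl_pnat V c) f))) B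
        = ncmp (tone (cyl_pnat Z (cyl_map F c)) f) B"
        using B cell[OF B] c.cyl_cell_ntrans[OF f B] by (simp add: chi f' fD ff assoc)
    qed (use tob[OF f'(4)] in \<open>simp_all add: chi f' tgt comp_functor_assoc[OF W_pone_functor[OF f], symmetric]\<close>)
  qed
  show ?thesis
  proof (rule pnat.equality)
    show "tob (comp_pnat (op2 K) W (CEX Z) (Cat_post K E V Z F) (cyl_pnat V c)) = tob (cyl_pnat Z (cyl_map F c))"
      by (rule extensionalityI[of _ "Obj (one K)"])
        (simp_all add: comp_pnat_def Cat_post_def tob, simp add: cyl_pnat_def)
    show "tone (comp_pnat (op2 K) W (CEX Z) (Cat_post K E V Z F) (cyl_pnat V c)) = tone (cyl_pnat Z (cyl_map F c))"
    proof (rule extensionalityI[of _ "Arr (one K)"])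
      fix f assume f: "f \<in> Arr (one K)"
      have "tob (Cat_post K E V Z F) (Dom (one K) f) = postcomp (pob E (Dom (one K) f)) V F"
        using f by (simp add: Cat_post_def)
      then show "tone (comp_pnat (op2 K) W (CEX Z) (Cat_post K E V Z F) (cyl_pnat V c)) f = tone (cyl_pnat Z (cyl_map F c)) f"
        using tone[of f "Dom (one K) f" "Cod (one K) f"] f by (simp add: comp_pnat_def Let_def in_homset)
    qed (simp_all add: comp_pnat_def cyl_pnat_def)
  qed simp
qed

text \<open>Extensionality reduces equality of modifications to equality of their doubly indexed components.\<close>

lemma modif_eqI:
  assumes m: "modification (op2 K) W (CEX Z) m" and n: "modification (op2 K) W (CEX Z) n"
    and "msrc m = msrc n" "mtgt m = mtgt n"
    and eq: "\<And>C Y X. C \<in> Obj (one K) \<Longrightarrow> Y \<in> Obj (pob W C) \<Longrightarrow> X \<in> Obj (pob E C)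
      \<Longrightarrow> ncmp (ncmp (mcmp m C) Y) X = ncmp (ncmp (mcmp n C) Y) X"
  shows "m = n"
proof (rule modification_eqI[OF m n assms(3,4)], unfold op_unfold)
  interpret m: modification "op2 K" W "CEX Z" m by fact
  interpret n: modification "op2 K" W "CEX Z" n by fact
  fix C Y assume C: "C \<in> Obj (one K)" and Y: "Y \<in> Obj (pob W C)"
  show "ncmp (mcmp m C) Y = ncmp (mcmp n C) Y"
    using m.mcmp_component[unfolded op_unfold, OF C Y] n.mcmp_component[unfolded op_unfold, OF C Y] assms(3,4) eq[OF C Y]
    by (intro ntrans_eqI[where A = "pob E C"]) (simp_all add: is_ntrans.ncmp_ext)
qed

text \<open>The components are those of \<open>\<sigma>\<close> at the objects of the cylinder; compatibility with the coherence
  cells is naturality of \<open>\<sigma>\<close> at them.\<close>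

lemma modif_whisker_cyl:
  fixes V :: "('s, 'r) cat" and Z :: "('x, 'y) cat"
  assumes c: "pseudo_cylinder K E W V c" and \<sigma>: "is_ntrans V Z \<sigma>"
  defines "m \<equiv> modif_whisker (op2 K) W (CEX Z) (Cat_post_modif K E V Z \<sigma>) (cyl_pnat V c)"
  shows "modification (op2 K) W (CEX Z) m"
    "msrc m = cyl_pnat Z (cyl_map (nsrc \<sigma>) c)" "mtgt m = cyl_pnat Z (cyl_map (ntgt \<sigma>) c)"
    "C \<in> Obj (one K) \<Longrightarrow> Y \<in> Obj (pob W C) \<Longrightarrow> X \<in> Obj (pob E C)
      \<Longrightarrow> ncmp (ncmp (mcmp m C) Y) X = ncmp \<sigma> (cylob c C Y X)"
proof -
  interpret c: pseudo_cylinder K E W V c by fact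
  interpret \<sigma>: is_ntrans V Z \<sigma> by fact
  note cS = pseudo_cylinder_map[OF c \<sigma>.S.is_functor_axioms] and cT = pseudo_cylinder_map[OF c \<sigma>.T.is_functor_axioms]
  interpret cS: pseudo_cylinder K E W Z "cyl_map (nsrc \<sigma>) c" by (rule cS)
  interpret cT: pseudo_cylinder K E W Z "cyl_map (ntgt \<sigma>) c" by (rule cT)
  show src: "msrc m = cyl_pnat Z (cyl_map (nsrc \<sigma>) c)" and tgt: "mtgt m = cyl_pnat Z (cyl_map (ntgt \<sigma>) c)"
    using comp_pnat_Cat_post[OF c \<sigma>.S.is_functor_axioms] comp_pnat_Cat_post[OF c \<sigma>.T.is_functor_axioms]
    by (simp_all add: m_def modif_whisker_def Cat_post_modif_def)
  let ?P = "\<lambda>C. \<lparr>nsrc = postcomp (pob E C) V (nsrc \<sigma>), ntgt = postcomp (pob E C) V (ntgt \<sigma>),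
     ncmp = (\<lambda>G\<in>Obj (Fun (pob E C) V). whisker_right (pob E C) \<sigma> G)\<rparr>"
  have mc: "mcmp m C = whisker_right (pob W C) (?P C) (cyl_tob c C)" if "C \<in> Obj (one K)" for C
    using that by (simp add: m_def modif_whisker_def Cat_post_modif_def)
  have mcY: "ncmp (mcmp m C) Y = whisker_right (pob E C) \<sigma> (cyl_fun c C Y)"
    if "C \<in> Obj (one K)" "Y \<in> Obj (pob W C)" for C Y
    using that by (simp add: mc c.cyl_fun_functor)
  show "ncmp (ncmp (mcmp m C) Y) X = ncmp \<sigma> (cylob c C Y X)"
    if "C \<in> Obj (one K)" "Y \<in> Obj (pob W C)" "X \<in> Obj (pob E C)" for C Y X
    using that by (simp add: mcY)
  have nt: "is_ntrans (pob W C) (Fun (pob E C) Z) (mcmp m C)" if "C \<in> Obj (one K)" for C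
    unfolding mc[OF that]
    by (rule is_ntrans_whisker_right[OF c.cyl_tob_functor[OF that] is_ntrans_postcomp[OF E.pob_category[OF that] \<sigma>]])
  have st: "nsrc (mcmp m C) = cyl_tob (cyl_map (nsrc \<sigma>) c) C" "ntgt (mcmp m C) = cyl_tob (cyl_map (ntgt \<sigma>) c) C"
    if C: "C \<in> Obj (one K)" for C
  proof -
    have tob: "comp_functor (pob W C) (postcomp (pob E C) V F) (cyl_tob c C) = cyl_tob (cyl_map F c) C"
      if F: "is_functor V Z F" for F
      using arg_cong[OF comp_pnat_Cat_post[OF c F], of "\<lambda>\<theta>. tob \<theta> C"] C
      by (simp add: comp_pnat_def Cat_post_def)
    show "nsrc (mcmp m C) = cyl_tob (cyl_map (nsrc \<sigma>) c) C" "ntgt (mcmp m C) = cyl_tob (cyl_map (ntgt \<sigma>) c) C"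
      using tob[OF \<sigma>.S.is_functor_axioms] tob[OF \<sigma>.T.is_functor_axioms] C by (simp_all add: mc)
  qed
  show "modification (op2 K) W (CEX Z) m"
  proof (rule modificationI, unfold op_unfold src tgt)
    show "pseudonatural (op2 K) W (CEX Z) (cyl_pnat Z (cyl_map (nsrc \<sigma>) c))" by (rule cS.cyl_pnat_pseudonatural)
    show "pseudonatural (op2 K) W (CEX Z) (cyl_pnat Z (cyl_map (ntgt \<sigma>) c))" by (rule cT.cyl_pnat_pseudonatural)
    show "mcmp m \<in> extensional (Obj (one K))" by (simp add: m_def modif_whisker_def)
    show "is_ntrans (pob W C) (pob (CEX Z) C) (mcmp m C) \<and>
        nsrc (mcmp m C) = tob (cyl_pnat Z (cyl_map (nsrc \<sigma>) c)) C \<and>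
        ntgt (mcmp m C) = tob (cyl_pnat Z (cyl_map (ntgt \<sigma>) c)) C" if "C \<in> Obj (one K)" for C
      using nt[OF that] st[OF that] that by simp
    fix f D C B assume f: "f \<in> homset (one K) C D" and B: "B \<in> Obj (pob W D)"
    have f': "f \<in> Arr (one K)" "Dom (one K) f = C" "Cod (one K) f = D" "C \<in> Obj (one K)" "D \<in> Obj (one K)"
      using f by (auto simp: in_homset)
    interpret f: one_cell K E W f C D by (rule one_cellI[OF f])
    have wB: "fob (pone W f) B \<in> Obj (pob W C)" using B by simp
    have wr: "is_ntrans (pob E D) Z (whisker_right (pob E D) \<sigma> (cyl_fun c D B))"
      by (rule is_ntrans_whisker_right[OF c.cyl_fun_functor[OF f'(5) B] \<sigma>])
    have "Cmp (Fun (pob E C) Z) (whisker_right (pob E C) (whisker_right (pob E D) \<sigma> (cyl_fun c D B)) (pone E f))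
          (cyl_cell (cyl_map (nsrc \<sigma>) c) f B)
        = Cmp (Fun (pob E C) Z) (cyl_cell (cyl_map (ntgt \<sigma>) c) f B)
          (whisker_right (pob E C) \<sigma> (cyl_fun c C (fob (pone W f) B)))"
    proof (rule ntrans_eqI[where A = "pob E C"])
      fix X assume X: "X \<in> Obj (pob E C)"
      show "ncmp (Cmp (Fun (pob E C) Z) (whisker_right (pob E C) (whisker_right (pob E D) \<sigma> (cyl_fun c D B)) (pone E f))
          (cyl_cell (cyl_map (nsrc \<sigma>) c) f B)) X
        = ncmp (Cmp (Fun (pob E C) Z) (cyl_cell (cyl_map (ntgt \<sigma>) c) f B)
          (whisker_right (pob E C) \<sigma> (cyl_fun c C (fob (pone W f) B)))) X"
        using X \<sigma>.naturality[OF c.cylc_simps(1)[OF f B X]] c.cylc_simps[OF f B X] by (simp add: f')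
    qed (simp_all add: f' cyl_fun_map[OF c \<sigma>.S.is_functor_axioms f'(4) wB] cyl_fun_map[OF c \<sigma>.T.is_functor_axioms f'(5) B])
    then show "Cmp (pob (CEX Z) C) (far (pone (CEX Z) f) (ncmp (mcmp m D) B)) (ncmp (tone (cyl_pnat Z (cyl_map (nsrc \<sigma>) c)) f) B)
        = Cmp (pob (CEX Z) C) (ncmp (tone (cyl_pnat Z (cyl_map (ntgt \<sigma>) c)) f) B) (ncmp (mcmp m C) (fob (pone W f) B))"
      using B by (simp add: f' mcY wr)
  qed
qed

text \<open>Arrows of \<open>E \<star> W\<close> are generated by the classes of the 1-cells \<open>(1, u, 1)\<close>, \<open>(1, 1, v)\<close>, \<open>(f, 1, 1)\<close>
  and inverses, so naturality need only be checked on these.\<close>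

lemma star_naturality:
  assumes F: "is_functor St Z F" and G: "is_functor St Z G"
    and s: "\<And>x. x \<in> Obj D1 \<Longrightarrow> s x \<in> homset Z (fob F x) (fob G x)"
    and hE: "\<And>C Y u. C \<in> Obj (one K) \<Longrightarrow> Y \<in> Obj (pob W C) \<Longrightarrow> u \<in> Arr (pob E C) \<Longrightarrow>
      Cmp Z (s (C, Cod (pob E C) u, Y)) (far F (cl (dE C Y u))) = Cmp Z (far G (cl (dE C Y u))) (s (C, Dom (pob E C) u, Y))"
    and hW: "\<And>C X v. C \<in> Obj (one K) \<Longrightarrow> X \<in> Obj (pob E C) \<Longrightarrow> v \<in> Arr (pob W C) \<Longrightarrow>
      Cmp Z (s (C, X, Cod (pob W C) v)) (far F (cl (dW C v X))) = Cmp Z (far G (cl (dW C v X))) (s (C, X, Dom (pob W C) v))"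
    and hc: "\<And>f C D B X. f \<in> homset (one K) C D \<Longrightarrow> B \<in> Obj (pob W D) \<Longrightarrow> X \<in> Obj (pob E C) \<Longrightarrow>
      Cmp Z (s (D, fob (pone E f) X, B)) (far F (cl (dc f B X))) = Cmp Z (far G (cl (dc f B X))) (s (C, X, fob (pone W f) B))"
    and a: "a \<in> Arr St"
  shows "Cmp Z (s (Cod St a)) (far F a) = Cmp Z (far G a) (s (Dom St a))"
proof -
  interpret F: is_functor St Z F by fact
  interpret G: is_functor St Z G by fact
  have s' [simp]: "s x \<in> Arr Z" "Dom Z (s x) = fob F x" "Cod Z (s x) = fob G x" if "x \<in> Obj D1" for x
    using s[OF that] by (simp_all add: in_homset)
  have obj [simp]: "Dom St a \<in> Obj D1" "Cod St a \<in> Obj D1" if "a \<in> Arr St" for a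
    using that St.Dom_Obj[of a] St.Cod_Obj[of a] by simp_all
  have comp: "Cmp Z (s (Cod St (Cmp St b a))) (far F (Cmp St b a)) = Cmp Z (far G (Cmp St b a)) (s (Dom St (Cmp St b a)))"
    if ab: "a \<in> Arr St" "b \<in> Arr St" "Cod St a = Dom St b"
      and na: "Cmp Z (s (Cod St a)) (far F a) = Cmp Z (far G a) (s (Dom St a))"
      and nb: "Cmp Z (s (Cod St b)) (far F b) = Cmp Z (far G b) (s (Dom St b))" for a b
  proof -
    have "Cmp Z (s (Cod St b)) (Cmp Z (far F b) (far F a)) = Cmp Z (far G b) (Cmp Z (s (Dom St b)) (far F a))"
      by (rule F.B.square_Cmp[OF nb]) (use ab in simp_all)
    also have "\<dots> = Cmp Z (far G b) (Cmp Z (far G a) (s (Dom St a)))"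
      using na ab by simp
    finally show ?thesis using ab by simp
  qed
  have cl: "Cmp Z (s (Cod D1 d)) (far F (cl d)) = Cmp Z (far G (cl d)) (s (Dom D1 d))" if d: "d \<in> Arr D1" for d
  proof -
    obtain C X Y f u v D A B where eq: "d = ((C, X, Y), (f, u, v), (D, A, B))" using d by (rule Delta_one_cases)
    have f: "f \<in> homset (one K) C D" and X: "X \<in> Obj (pob E C)" and B: "B \<in> Obj (pob W D)"
      and C: "C \<in> Obj (one K)" and D: "D \<in> Obj (one K)"
      and u: "u \<in> homset (pob E D) (fob (pone E f) X) A" and v: "v \<in> homset (pob W C) Y (fob (pone W f) B)"
      using d by (auto simp: eq Delta_one_Arr Delta_one_Obj)
    have u': "u \<in> Arr (pob E D)" "Dom (pob E D) u = fob (pone E f) X" "Cod (pob E D) u = A"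
      and v': "v \<in> Arr (pob W C)" "Dom (pob W C) v = Y" "Cod (pob W C) v = fob (pone W f) B"
      using u v by (auto simp: in_homset)
    interpret D: category D1 by (rule category_Delta_one)
    note arrs = dE_Arr[OF D B u'(1), unfolded u'] dW_Arr[OF C X v'(1), unfolded v'] dc_cartesian[OF f B X]
    note eq' = Delta_one_decomp[OF d[unfolded eq], folded eq]
    have cl_d: "cl d = Cmp St (cl (dE D B u)) (Cmp St (cl (dc f B X)) (cl (dW C v X)))"
      unfolding eq' using arrs by (subst star_class_Cmp, simp_all add: star_class_Cmp)
    have cd: "Cod D1 d = Cod St (cl d)" "Dom D1 d = Dom St (cl d)" using d by simp_all
    show ?thesis
      unfolding cd cl_d
      by (intro comp) (use arrs hE[OF D B u'(1)] hW[OF C X v'(1)] hc[OF f B X] u' v' in simp_all)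
  qed
  from a show ?thesis
  proof (induction rule: star_induct)
    case (Idn x)
    then show ?case by simp
  next
    case (Fwd d a)
    then show ?case using cl[OF Fwd(1)] by (intro comp) simp_all
  next
    case (Bwd d a)
    have d: "d \<in> Arr D1" "iso_arr St (cl d)" using Bwd(1) by (auto intro: cartesian_Arr iso_star_class)
    have "Cmp Z (inv_arr Z (far G (cl d))) (s (Cod D1 d)) = Cmp Z (s (Dom D1 d)) (inv_arr Z (far F (cl d)))"
      by (rule F.B.inv_arr_square[OF cl[OF d(1)]]) (use d in simp_all)
    then have "Cmp Z (s (Cod St (inv_arr St (cl d)))) (far F (inv_arr St (cl d)))
        = Cmp Z (far G (inv_arr St (cl d))) (s (Dom St (inv_arr St (cl d))))"
      using d by (simp add: F.far_inv_arr G.far_inv_arr)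
    with Bwd d show ?case by (intro comp) simp_all
  qed
qed

text \<open>Functors that agree on objects are equal if the identities form a natural transformation between
  them, which can be tested on generators.\<close>

lemma star_functor_eqI:
  assumes F: "is_functor St Z F" and G: "is_functor St Z G"
    and eq: "cyl_pnat Z (cyl_map F star_cyl) = cyl_pnat Z (cyl_map G star_cyl)"
  shows "F = G"
proof (rule functor_eqI[OF F G])
  interpret F: is_functor St Z F by fact
  interpret G: is_functor St Z G by fact
  note eqs = cyl_pnat_eqD[OF eq, simplified]
  show ob: "fob F x = fob G x" if "x \<in> Obj St" for x
    using that eqs(1) by (cases x) (simp add: Delta_one_Obj)
  fix a assume a: "a \<in> Arr St"
  have "Cmp Z (Idn Z (fob F (Cod St a))) (far F a) = Cmp Z (far G a) (Idn Z (fob F (Dom St a)))"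
  proof (rule star_naturality[OF F G, where s = "\<lambda>x. Idn Z (fob F x)"])
    fix x assume "x \<in> Obj D1"
    then show "Idn Z (fob F x) \<in> homset Z (fob F x) (fob G x)" using ob[of x] by (simp add: in_homset)
  next
    fix C Y u assume h: "C \<in> Obj (one K)" "Y \<in> Obj (pob W C)" "u \<in> Arr (pob E C)"
    show "Cmp Z (Idn Z (fob F (C, Cod (pob E C) u, Y))) (far F (cl (dE C Y u)))
        = Cmp Z (far G (cl (dE C Y u))) (Idn Z (fob F (C, Dom (pob E C) u, Y)))"
      using h dE_Arr[OF h] F.far_simps[of "cl (dE C Y u)"] by (simp flip: eqs(2))
  next
    fix C X v assume h: "C \<in> Obj (one K)" "X \<in> Obj (pob E C)" "v \<in> Arr (pob W C)"
    show "Cmp Z (Idn Z (fob F (C, X, Cod (pob W C) v))) (far F (cl (dW C v X)))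
        = Cmp Z (far G (cl (dW C v X))) (Idn Z (fob F (C, X, Dom (pob W C) v)))"
      using h dW_Arr[OF h] F.far_simps[of "cl (dW C v X)"] by (simp flip: eqs(3))
  next
    fix f C D B X assume h: "f \<in> homset (one K) C D" "B \<in> Obj (pob W D)" "X \<in> Obj (pob E C)"
    show "Cmp Z (Idn Z (fob F (D, fob (pone E f) X, B))) (far F (cl (dc f B X)))
        = Cmp Z (far G (cl (dc f B X))) (Idn Z (fob F (C, X, fob (pone W f) B)))"
      using h dc_cartesian[OF h] F.far_simps[of "cl (dc f B X)"] by (simp flip: eqs(4)[OF h])
  qed (rule a)
  then show "far F a = far G a" using a ob[OF St.Dom_Obj[OF a]] G.far_simps[OF a] by simp
qed

text \<open>On \<open>(1, u, 1)\<close>, \<open>(1, 1, v)\<close> and \<open>(f, 1, 1)\<close> two of the three factors in the extension of \<open>c\<close> to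
  \<open>\<Delta>(E, W)\<close> are identities, so the extension restricts to \<open>c\<close>.\<close>

lemma star_functor_exists:
  assumes "pseudo_cylinder K E W Z c"
  obtains F where "is_functor St Z F" "cyl_pnat Z (cyl_map F star_cyl) = cyl_pnat Z c"
proof -
  interpret c: pseudo_cylinder K E W Z c by fact
  obtain F where F: "is_functor St Z F" and ob: "\<And>x. x \<in> Obj D1 \<Longrightarrow> fob F x = fob c.cyl_ext x"
    and ar: "\<And>a. a \<in> Arr D1 \<Longrightarrow> far F (cl a) = far c.cyl_ext a"
    by (rule star_lift[OF c.cyl_ext_functor], erule c.cyl_ext_two_cell, erule c.cyl_ext_cartesian) blast
  have "cyl_pnat Z (cyl_map F star_cyl) = cyl_pnat Z c"
  proof (rule cyl_pnat_cong[OF pseudo_cylinder_map[OF pseudo_cylinder_star F] assms])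
    fix C X Y assume h: "C \<in> Obj (one K)" "Y \<in> Obj (pob W C)" "X \<in> Obj (pob E C)"
    then show "cylob (cyl_map F star_cyl) C Y X = cylob c C Y X" by (simp add: ob Delta_one_Obj)
  next
    fix C Y u assume h: "C \<in> Obj (one K)" "Y \<in> Obj (pob W C)" "u \<in> Arr (pob E C)"
    have X: "Dom (pob E C) u \<in> Obj (pob E C)" using category.Dom_Obj[OF E.pob_category[OF h(1)] h(3)] .
    show "cylE (cyl_map F star_cyl) C Y u = cylE c C Y u"
      using dE_Arr(1)[OF h] c.cylob_Obj[OF h(1,2) X] h X
      by (simp add: ar) (simp add: dE_def c.cylc_Idn c.cylW_Idn)
  next
    fix C v X assume h: "C \<in> Obj (one K)" "v \<in> Arr (pob W C)" "X \<in> Obj (pob E C)"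
    have Y: "Cod (pob W C) v \<in> Obj (pob W C)" using category.Cod_Obj[OF W_category[OF h(1)] h(2)] .
    show "cylW (cyl_map F star_cyl) C v X = cylW c C v X"
      using dW_Arr(1)[OF h(1,3,2)] c.cylob_Obj[OF h(1) Y h(3)] h Y
      by (simp add: ar) (simp add: dW_def c.cylc_Idn c.cylE_Idn)
  next
    fix f C D B X assume h: "f \<in> homset (one K) C D" "B \<in> Obj (pob W D)" "X \<in> Obj (pob E C)"
    have o: "C \<in> Obj (one K)" "D \<in> Obj (one K)" "Dom (one K) f = C" "Cod (one K) f = D" using h by (auto simp: in_homset)
    have o2: "fob (pone E f) X \<in> Obj (pob E D)" "fob (pone W f) B \<in> Obj (pob W C)"
      using is_functor.fob_Obj[OF E.pone_functor[OF h(1)] h(3)] is_functor.fob_Obj[OF W_pone_functor[OF h(1)] h(2)] by auto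
    show "cylc (cyl_map F star_cyl) f B X = cylc c f B X"
      using dc_cartesian(2)[OF h] c.cylc_simps[OF h] h o o2
      by (simp add: ar) (simp add: dc_def c.cylE_Idn c.cylW_Idn)
  qed
  with F show thesis by (rule that)
qed

text \<open>Bijectivity on objects is the universal property of \<open>E \<star> W\<close> for cylinders. On arrows, a modification
  is a family of arrows indexed by the objects \<open>(C, X, Y)\<close>, and its axioms are naturality with respect
  to the three kinds of generators.\<close>

lemma induced_functor_iso:
  fixes Z :: "('x, 'y) cat"
  assumes Z: "category Z"
  shows "iso_of_categories (Fun St Z) (Hom_category (op2 K) W (CEX Z)) (induced_functor K E W St (xi K E W) Z)"
proof -
  let ?I = "induced_functor K E W St (xi K E W) Z"
  let ?H = "Hom_category (op2 K) W (CEX Z)"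
  have fob: "fob ?I F = cyl_pnat Z (cyl_map F star_cyl)" if "is_functor St Z F" for F
    using that comp_pnat_Cat_post[OF pseudo_cylinder_star that] by (simp add: induced_functor_def xi_eq)
  have far: "far ?I \<sigma> = modif_whisker (op2 K) W (CEX Z) (Cat_post_modif K E St Z \<sigma>) (cyl_pnat St star_cyl)"
    if "is_ntrans St Z \<sigma>" for \<sigma>
    using that by (simp add: induced_functor_def xi_eq)
  have m: "modification (op2 K) W (CEX Z) (far ?I \<sigma>)"
    "msrc (far ?I \<sigma>) = cyl_pnat Z (cyl_map (nsrc \<sigma>) star_cyl)"
    "mtgt (far ?I \<sigma>) = cyl_pnat Z (cyl_map (ntgt \<sigma>) star_cyl)"
    "\<And>C X Y. C \<in> Obj (one K) \<Longrightarrow> Y \<in> Obj (pob W C) \<Longrightarrow> X \<in> Obj (pob E C)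
      \<Longrightarrow> ncmp (ncmp (mcmp (far ?I \<sigma>) C) Y) X = ncmp \<sigma> (C, X, Y)"
    if "is_ntrans St Z \<sigma>" for \<sigma>
    using modif_whisker_cyl[OF pseudo_cylinder_star that] far[OF that] by simp_all
  have ps: "pseudonatural (op2 K) W (CEX Z) (cyl_pnat Z (cyl_map F star_cyl))" if "is_functor St Z F" for F
    by (rule pseudo_cylinder.cyl_pnat_pseudonatural[OF pseudo_cylinder_map[OF pseudo_cylinder_star that]])
  have catH: "category ?H"
    by (rule category_Hom_category[OF W.pseudofunctor_axioms pseudofunctor_Cat_into[OF Z]])
  have catS: "category (Fun St Z)" by (rule category_functor_category[OF category_star Z])
  have funct: "is_functor (Fun St Z) ?H ?I"
  proof (rule is_functorI[OF catS catH])
    show "fob ?I \<in> extensional (Obj (Fun St Z))" "far ?I \<in> extensional (Arr (Fun St Z))"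
      by (simp_all add: induced_functor_def del: functor_category_simps)
    show "fob ?I F \<in> Obj ?H" if "F \<in> Obj (Fun St Z)" for F
      using that by (simp add: fob ps)
    show "far ?I \<sigma> \<in> Arr ?H \<and> Dom ?H (far ?I \<sigma>) = fob ?I (Dom (Fun St Z) \<sigma>)
        \<and> Cod ?H (far ?I \<sigma>) = fob ?I (Cod (Fun St Z) \<sigma>)" if "\<sigma> \<in> Arr (Fun St Z)" for \<sigma>
    proof -
      interpret \<sigma>: is_ntrans St Z \<sigma> using that by simp
      note s = \<sigma>.is_ntrans_axioms
      show ?thesis using m(1-3)[OF s] by (simp add: fob \<sigma>.S.is_functor_axioms \<sigma>.T.is_functor_axioms)
    qed
    show "far ?I (Idn (Fun St Z) F) = Idn ?H (fob ?I F)" if "F \<in> Obj (Fun St Z)" for F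
    proof -
      have F: "is_functor St Z F" using that by simp
      note s = is_ntrans_Idn[OF F]
      show ?thesis
        by (rule modif_eqI[OF m(1)[OF s] modification_Idn])
          (use m(2,3)[OF s] m(4)[OF s] ps[OF F] in \<open>simp_all add: fob F Delta_one_Obj\<close>)
    qed
    show "far ?I (Cmp (Fun St Z) \<tau> \<sigma>) = Cmp ?H (far ?I \<tau>) (far ?I \<sigma>)"
      if st: "\<sigma> \<in> Arr (Fun St Z)" "\<tau> \<in> Arr (Fun St Z)"
        "Cod (Fun St Z) \<sigma> = Dom (Fun St Z) \<tau>" for \<sigma> \<tau>
    proof -
      have s: "is_ntrans St Z \<sigma>" and t: "is_ntrans St Z \<tau>" and eq: "ntgt \<sigma> = nsrc \<tau>" using st by simp_all
      note ts = is_ntrans_Cmp[OF s t eq]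
      have eq': "mtgt (far ?I \<sigma>) = msrc (far ?I \<tau>)" using m(3)[OF s] m(2)[OF t] eq by simp
      show ?thesis
        by (rule modif_eqI[OF m(1)[OF ts] modification_Cmp[OF m(1)[OF s] m(1)[OF t] eq']])
          (use m(2-4)[OF ts] m(2-4)[OF s] m(2-4)[OF t] in \<open>simp_all add: Delta_one_Obj\<close>)
    qed
  qed
  have inj: "F = G" if "is_functor St Z F" "is_functor St Z G" "fob ?I F = fob ?I G" for F G
    using that star_functor_eqI by (simp add: fob)
  have surj: "\<exists>F. is_functor St Z F \<and> \<theta> = fob ?I F" if \<theta>: "pseudonatural (op2 K) W (CEX Z) \<theta>" for \<theta>
  proof -
    obtain F where "is_functor St Z F" "cyl_pnat Z (cyl_map F star_cyl) = cyl_pnat Z (pnat_cyl \<theta>)"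
      using star_functor_exists[OF pseudo_cylinder_pnat_cyl[OF Z \<theta>]] by blast
    then show ?thesis using cyl_pnat_pnat_cyl[OF Z \<theta>] by (auto simp: fob)
  qed
  have ob: "bij_betw (fob ?I) (Obj (Fun St Z)) (Obj ?H)"
    unfolding bij_betw_def
  proof
    show "inj_on (fob ?I) (Obj (Fun St Z))" using inj by (auto intro!: inj_onI)
    show "fob ?I ` Obj (Fun St Z) = Obj ?H"
      unfolding functor_category_simps Hom_category_simps
    proof (intro subset_antisym subsetI)
      fix \<theta> assume "\<theta> \<in> {\<theta>. pseudonatural (op2 K) W (CEX Z) \<theta>}"
      then show "\<theta> \<in> fob ?I ` {F. is_functor St Z F}" using surj by blast
    qed (auto simp: fob ps)
  qed
  have inj_far: "\<sigma> = \<tau>" if s: "is_ntrans St Z \<sigma>" and t: "is_ntrans St Z \<tau>" and eq: "far ?I \<sigma> = far ?I \<tau>" for \<sigma> \<tau>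
  proof -
    interpret s: is_ntrans St Z \<sigma> by (rule s)
    interpret t: is_ntrans St Z \<tau> by (rule t)
    show ?thesis
    proof (rule ntrans_eqI[OF s.ncmp_ext t.ncmp_ext])
      show "nsrc \<sigma> = nsrc \<tau>"
        using m(2)[OF s] m(2)[OF t] eq by (intro inj s.S.is_functor_axioms t.S.is_functor_axioms)
          (simp add: fob s.S.is_functor_axioms t.S.is_functor_axioms)
      show "ntgt \<sigma> = ntgt \<tau>"
        using m(3)[OF s] m(3)[OF t] eq by (intro inj s.T.is_functor_axioms t.T.is_functor_axioms)
          (simp add: fob s.T.is_functor_axioms t.T.is_functor_axioms)
      show "ncmp \<sigma> x = ncmp \<tau> x" if "x \<in> Obj St" for x
      proof -
        obtain C X Y where x: "x = (C, X, Y)" by (cases x)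
        show ?thesis using that m(4)[OF s, of C Y X] m(4)[OF t, of C Y X] eq by (simp add: x Delta_one_Obj)
      qed
    qed
  qed
  have surj_far: "\<exists>\<sigma>. is_ntrans St Z \<sigma> \<and> n = far ?I \<sigma>" if n: "modification (op2 K) W (CEX Z) n" for n
  proof -
    interpret n: modification "op2 K" W "CEX Z" n by (rule n)
    obtain F where F: "is_functor St Z F" "msrc n = cyl_pnat Z (cyl_map F star_cyl)"
      using surj[OF n.S.pseudonatural_axioms] fob by auto
    obtain G where G: "is_functor St Z G" "mtgt n = cyl_pnat Z (cyl_map G star_cyl)"
      using surj[OF n.T.pseudonatural_axioms] fob by auto
    interpret F: is_functor St Z F by (rule F(1))
    interpret G: is_functor St Z G by (rule G(1))
    define s where "s = (\<lambda>x\<in>Obj D1. case x of (C, X, Y) \<Rightarrow> ncmp (ncmp (mcmp n C) Y) X)"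
    define \<sigma> where "\<sigma> = \<lparr>nsrc = F, ntgt = G, ncmp = s\<rparr>"
    have s_eq: "s (C, X, Y) = ncmp (ncmp (mcmp n C) Y) X"
      if "C \<in> Obj (one K)" "X \<in> Obj (pob E C)" "Y \<in> Obj (pob W C)" for C X Y
      using that by (simp add: s_def Delta_one_Obj)
    have nY: "is_ntrans (pob E C) Z (ncmp (mcmp n C) Y)" "nsrc (ncmp (mcmp n C) Y) = cyl_fun (cyl_map F star_cyl) C Y"
      "ntgt (ncmp (mcmp n C) Y) = cyl_fun (cyl_map G star_cyl) C Y"
      if "C \<in> Obj (one K)" "Y \<in> Obj (pob W C)" for C Y
      using n.mcmp_component[unfolded op_unfold, OF that] that by (simp_all add: F G)
    have s_hom: "s x \<in> homset Z (fob F x) (fob G x)" if x: "x \<in> Obj D1" for x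
    proof -
      obtain C X Y where eq: "x = (C, X, Y)" by (cases x)
      have h: "C \<in> Obj (one K)" "X \<in> Obj (pob E C)" "Y \<in> Obj (pob W C)" using x by (auto simp: eq Delta_one_Obj)
      interpret nY: is_ntrans "pob E C" Z "ncmp (mcmp n C) Y" by (rule nY(1)[OF h(1,3)])
      show ?thesis using nY.ncmp_simps[OF h(2)] nY(2,3)[OF h(1,3)] h by (simp add: eq s_eq in_homset)
    qed
    have nat: "Cmp Z (s (Cod St a)) (far F a) = Cmp Z (far G a) (s (Dom St a))" if "a \<in> Arr St" for a
    proof (rule star_naturality[OF F(1) G(1) s_hom _ _ _ that])
      fix C Y u assume h: "C \<in> Obj (one K)" "Y \<in> Obj (pob W C)" "u \<in> Arr (pob E C)"
      interpret EC: category "pob E C" by (rule E.pob_category[OF h(1)])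
      interpret nY: is_ntrans "pob E C" Z "ncmp (mcmp n C) Y" by (rule nY(1)[OF h(1,2)])
      show "Cmp Z (s (C, Cod (pob E C) u, Y)) (far F (cl (dE C Y u))) = Cmp Z (far G (cl (dE C Y u))) (s (C, Dom (pob E C) u, Y))"
        using nY.naturality[OF h(3)] nY(2,3)[OF h(1,2)] h by (simp add: s_eq)
    next
      fix C X v assume h: "C \<in> Obj (one K)" "X \<in> Obj (pob E C)" "v \<in> Arr (pob W C)"
      interpret WC: category "pob W C" by (rule W_category[OF h(1)])
      interpret nC: is_ntrans "pob W C" "Fun (pob E C) Z" "mcmp n C"
        using n.mcmp_ntrans[unfolded op_unfold, OF h(1)] by simp
      show "Cmp Z (s (C, X, Cod (pob W C) v)) (far F (cl (dW C v X))) = Cmp Z (far G (cl (dW C v X))) (s (C, X, Dom (pob W C) v))"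
        using nC.naturality[OF h(3), THEN arg_cong[where f = "\<lambda>\<tau>. ncmp \<tau> X"]]
          n.mcmp_ntrans(2,3)[unfolded op_unfold, OF h(1)] h by (simp add: s_eq F G)
    next
      fix f C D B X assume h: "f \<in> homset (one K) C D" "B \<in> Obj (pob W D)" "X \<in> Obj (pob E C)"
      have o: "C \<in> Obj (one K)" "D \<in> Obj (one K)" "Dom (one K) f = C" "Cod (one K) f = D" "f \<in> Arr (one K)"
        using h by (auto simp: in_homset)
      have o2: "fob (pone E f) X \<in> Obj (pob E D)" "fob (pone W f) B \<in> Obj (pob W C)"
        using is_functor.fob_Obj[OF E.pone_functor[OF h(1)] h(3)] is_functor.fob_Obj[OF W_pone_functor[OF h(1)] h(2)] by auto
      show "Cmp Z (s (D, fob (pone E f) X, B)) (far F (cl (dc f B X))) = Cmp Z (far G (cl (dc f B X))) (s (C, X, fob (pone W f) B))"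
        using n.mcmp_square[unfolded op_unfold, OF h(1,2), THEN arg_cong[where f = "\<lambda>\<tau>. ncmp \<tau> X"]] h o o2
        by (simp add: s_eq F G nY)
    qed
    have \<sigma>: "is_ntrans St Z \<sigma>"
    proof (rule is_ntransI)
      show "ncmp \<sigma> \<in> extensional (Obj St)" by (simp add: \<sigma>_def s_def)
    qed (use s_hom nat in \<open>simp_all add: \<sigma>_def F(1) G(1) in_homset\<close>)
    have "n = far ?I \<sigma>"
      by (rule modif_eqI[OF n m(1)[OF \<sigma>]])
        (use m(2-4)[OF \<sigma>] in \<open>simp_all add: F G, simp_all add: \<sigma>_def F G s_eq\<close>)
    with \<sigma> show ?thesis by blast
  qed
  have ar: "bij_betw (far ?I) (Arr (Fun St Z)) (Arr ?H)"
    unfolding bij_betw_def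
  proof
    show "inj_on (far ?I) (Arr (Fun St Z))" using inj_far by (auto intro!: inj_onI)
    show "far ?I ` Arr (Fun St Z) = Arr ?H"
      unfolding functor_category_simps Hom_category_simps
    proof (intro subset_antisym subsetI)
      fix n assume "n \<in> {n. modification (op2 K) W (CEX Z) n}"
      then show "n \<in> far ?I ` {\<sigma>. is_ntrans St Z \<sigma>}" using surj_far by blast
    qed (auto simp: m(1))
  qed
  show ?thesis by (rule iso_of_categories_if_bij[OF funct ob ar])
qed

end

section \<open>The weighted pseudo-colimit\<close>

theorem theorem1p1:
  fixes K :: "('c, 'f, 't) twocat"
    and E :: "('c, 'f, 't, 'o, 'a) pftor"
    and W :: "('c, 'f, 't, 'p, 'b) pftor"
  assumes "two_category K"
    and "pseudofunctor K E"
    and "pseudofunctor (op2 K) W"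
  shows "category (star K E W)
    \<and> pseudonatural (op2 K) W (Cat_into K E (star K E W)) (xi K E W)
    \<and> (\<forall>X :: ('x, 'y) cat. category X \<longrightarrow>
         iso_of_categories
           (Fun (star K E W) X)
           (Hom_category (op2 K) W (Cat_into K E X))
           (induced_functor K E W (star K E W) (xi K E W) X))"
proof -
  interpret weighted_pair K E W
    using assms by (intro weighted_pair.intro)
  interpret S: pseudo_cylinder K E W St star_cyl by (rule pseudo_cylinder_star)
  show ?thesis
    using category_star S.cyl_pnat_pseudonatural induced_functor_iso unfolding xi_eq by blast
qed

end
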